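(* Let $b\ge 3$ and $m\ge 2$ be integers. Let $\lambda\in(b-1,b)$ be the Pisot number satisfying $x^m-(b-1)(x^{m-1}+x^{m-2}+\cdots+x+1)=0$, and let $\eta\in(b-1,b)$ be the Pisot number satisfying $x^m-bx^{m-1}+1=0$. (i) For any $\omega\in(D_b^m)^{\mathbb{N}_0}$ we have $$\frac{\log \eta}{\log b} \le \dim_L K^\omega \le \dim_H K^{\omega}\le\dim_P K^{\omega}\le \dim_A K^{\omega} \le \frac{\log \lambda}{\log b}.$$ (ii) For any $\frac{\log \eta}{\log b} \le \alpha \le \beta \le \frac{\log \lambda}{\log b}$ we have $$\dim_H\Big\{\omega\in (D_b^m)^{\mathbb{N}_0} : \dim_{H} K^{\omega}=\alpha,~ \dim_{P} K^{\omega}=\beta \Big\}\ge \frac{1}{m}.$$ (iii) We have $$\dim_H\Big\{\omega\in (D_b^m)^{\mathbb{N}_0} :\dim_{L} K^{\omega}< \dim_{H} K^{\omega}<\dim_{P} K^{\omega}< \dim_{A} K^{\omega} \Big\}\ge \frac{1}{m}.$$ Here the Hausdorff dimension of subsets of $(D_b^m)^{\mathbb{N}_0}$ is taken with respect to the metric $\varrho(\omega,\tau)=b^{-m\cdot\inf\{k\in\mathbb{N}_0:\omega^k\ne\tau^k\}}$.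
   Context: $\mathbb{N}=\{1,2,\ldots\}$, $\mathbb{N}_0=\mathbb{N}\cup\{0\}$, $D_b=\{0,1,\ldots,b-1\}$; $D_b^n$ is the set of words of length $n$ over $D_b$. $(D_b^m)^{\mathbb{N}_0}$ is the set of infinite sequences $\omega=\omega^0\omega^1\ldots$ with each $\omega^k\in D_b^m$ (superscripts are indices). For such $\omega$, $K^\omega=\{\sum_{i=1}^\infty d_ib^{-i}: d_i\in D_b\ \forall i\in\mathbb N,\ d_{k+1}d_{k+2}\ldots d_{k+m}\ne\omega^k\ \forall k\in\mathbb{N}_0\}$. $\dim_H$ and $\dim_P$ are Hausdorff and packing dimension. For a bounded set $E\subset\mathbb{R}^n$ the Assouad and lower dimensions are $\dim_A E=\inf\{s\ge0:\exists C>0,\rho>0,\forall\,0<r<R<\rho,\ \sup_{x\in E}N_r(B(x,R)\cap E)\le C(R/r)^s\}$ and $\dim_L E=\sup\{s\ge0:\exists C>0,\rho>0,\forall\,0<r<R<\rho,\ \inf_{x\in E}N_r(B(x,R)\cap E)\ge C(R/r)^s\}$, where $N_r(F)$ is the smallest number of balls of diameter $r$ required to cover the bounded set $F$ and $B(x,R)$ is the closed ball. A Pisot number is an algebraic integer greater than $1$ whose algebraic conjugates (other than itself) have modulus strictly less than $1$. *)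

theory Defs
  imports
    "HOL-Analysis.Analysis"
    "HOL-Computational_Algebra.Polynomial"
begin

section \<open>Pisot numbers\<close>

text \<open>An irreducible rational polynomial vanishing at \<open>x\<close> is the minimal polynomial of \<open>x\<close>
  up to a nonzero constant factor.\<close>

definition algebraic_conjugates :: "complex \<Rightarrow> complex set" where
  "algebraic_conjugates x =
     {z. \<exists>p :: rat poly. irreducible p \<and> poly (map_poly of_rat p) x = 0
                        \<and> poly (map_poly of_rat p) z = 0}"

definition pisot :: "real \<Rightarrow> bool" where
  "pisot x \<longleftrightarrow> algebraic_int x \<and> x > 1 \<and>
     (\<forall>z \<in> algebraic_conjugates (complex_of_real x) - {complex_of_real x}. cmod z < 1)"


section \<open>Hausdorff dimension in a metric space\<close>

definition mdiameter :: "'a metric \<Rightarrow> 'a set \<Rightarrow> ennreal" where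
  "mdiameter X U = (SUP (x, y) \<in> U \<times> U. ennreal (mdist X x y))"

text \<open>The \<open>s\<close>-th power of the diameter, for sets of finite diameter, with the usual conventions
  that the empty set contributes \<open>0\<close> and that \<open>0\<^sup>0 = 1\<close> (whereas \<open>0 powr 0 = 0\<close>).\<close>

definition diam_pow :: "'a metric \<Rightarrow> real \<Rightarrow> 'a set \<Rightarrow> ennreal" where
  "diam_pow X s U =
     (if U = {} then 0 else if s = 0 then 1 else ennreal (enn2real (mdiameter X U) powr s))"

definition hausdorff_premeasure :: "'a metric \<Rightarrow> real \<Rightarrow> real \<Rightarrow> 'a set \<Rightarrow> ennreal" where
  "hausdorff_premeasure X s \<delta> E =
     (INF U \<in> {U :: nat \<Rightarrow> 'a set. (\<forall>i. U i \<subseteq> mspace X \<and> mdiameter X (U i) \<le> ennreal \<delta>)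
                                  \<and> E \<subseteq> (\<Union>i. U i)}.
        \<Sum>i. diam_pow X s (U i))"

definition hausdorff_measure :: "'a metric \<Rightarrow> real \<Rightarrow> 'a set \<Rightarrow> ennreal" where
  "hausdorff_measure X s E = (SUP \<delta> \<in> {0<..}. hausdorff_premeasure X s \<delta> E)"

definition hausdorff_dim :: "'a metric \<Rightarrow> 'a set \<Rightarrow> ereal" where
  "hausdorff_dim X E = Inf {ereal s | s. 0 \<le> s \<and> hausdorff_measure X s E = 0}"


section \<open>Packing dimension in Euclidean space\<close>

text \<open>The supremum is over packings of \<open>E\<close> by disjoint closed balls centred in \<open>E\<close> of radius at
  most \<open>\<delta>\<close>, encoded by pairs (centre, radius). Restricting to finite packings does not change
  the supremum.\<close>

definition packing_sup :: "real \<Rightarrow> real \<Rightarrow> 'a::euclidean_space set \<Rightarrow> ennreal" where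
  "packing_sup s \<delta> E =
     (SUP F \<in> {F. finite F \<and> (\<forall>(x, r) \<in> F. x \<in> E \<and> 0 < r \<and> r \<le> \<delta>)
                  \<and> disjoint_family_on (\<lambda>(x, r). cball x r) F}.
        \<Sum>(x, r) \<in> F. ennreal ((2 * r) powr s))"

definition packing_premeasure :: "real \<Rightarrow> 'a::euclidean_space set \<Rightarrow> ennreal" where
  "packing_premeasure s E = (INF \<delta> \<in> {0<..}. packing_sup s \<delta> E)"

definition packing_measure :: "real \<Rightarrow> 'a::euclidean_space set \<Rightarrow> ennreal" where
  "packing_measure s E =
     (INF A \<in> {A :: nat \<Rightarrow> 'a set. E \<subseteq> (\<Union>i. A i)}. \<Sum>i. packing_premeasure s (A i))"

definition packing_dim :: "'a::euclidean_space set \<Rightarrow> ereal" where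
  "packing_dim E = Inf {ereal s | s. 0 \<le> s \<and> packing_measure s E = 0}"


section \<open>Assouad and lower dimension of bounded sets\<close>

text \<open>The centres of the covering balls are arbitrary; for bounded \<open>F\<close> and \<open>r > 0\<close> a finite
  cover exists.\<close>

definition covering_number :: "real \<Rightarrow> 'a::euclidean_space set \<Rightarrow> nat" where
  "covering_number r F =
     (LEAST n. \<exists>C. finite C \<and> card C = n \<and> F \<subseteq> (\<Union>c\<in>C. cball c (r / 2)))"

definition assouad_dim :: "'a::euclidean_space set \<Rightarrow> ereal" where
  "assouad_dim E = Inf {ereal s | s. 0 \<le> s \<and>
     (\<exists>C>0. \<exists>\<rho>>0. \<forall>r R. 0 < r \<and> r < R \<and> R < \<rho> \<longrightarrow>
        (SUP x\<in>E. ereal (covering_number r (cball x R \<inter> E))) \<le> ereal (C * (R / r) powr s))}"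

definition lower_dim :: "'a::euclidean_space set \<Rightarrow> ereal" where
  "lower_dim E = Sup {ereal s | s. 0 \<le> s \<and>
     (\<exists>C>0. \<exists>\<rho>>0. \<forall>r R. 0 < r \<and> r < R \<and> R < \<rho> \<longrightarrow>
        (INF x\<in>E. ereal (covering_number r (cball x R \<inter> E))) \<ge> ereal (C * (R / r) powr s))}"


section \<open>Sequences of words and the sets they define\<close>

definition words :: "nat \<Rightarrow> nat \<Rightarrow> nat list set" where
  "words b n = {w. length w = n \<and> set w \<subseteq> {0..<b}}"

definition word_seqs :: "nat \<Rightarrow> nat \<Rightarrow> (nat \<Rightarrow> nat list) set" where
  "word_seqs b m = {\<omega>. \<forall>k. \<omega> k \<in> words b m}"

text \<open>The case distinction is the convention \<open>inf {} = \<infinity>\<close>.\<close>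

definition word_seq_dist :: "nat \<Rightarrow> nat \<Rightarrow> (nat \<Rightarrow> nat list) \<Rightarrow> (nat \<Rightarrow> nat list) \<Rightarrow> real" where
  "word_seq_dist b m \<omega> \<tau> =
     (if \<omega> = \<tau> then 0 else real b powr (- real (m * Inf {k. \<omega> k \<noteq> \<tau> k})))"

definition word_seq_metric :: "nat \<Rightarrow> nat \<Rightarrow> (nat \<Rightarrow> nat list) metric" where
  "word_seq_metric b m = metric (word_seqs b m, word_seq_dist b m)"

lemma Metric_space_word_seqs:
  assumes "b \<ge> 1"
  shows "Metric_space (word_seqs b m) (word_seq_dist b m)"
proof
  fix x y z :: "nat \<Rightarrow> nat list"
  show "0 \<le> word_seq_dist b m x y" by (simp add: word_seq_dist_def)
  have "{k. x k \<noteq> y k} = {k. y k \<noteq> x k}" by auto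
  then show "word_seq_dist b m x y = word_seq_dist b m y x"
    by (simp add: word_seq_dist_def)
  show "word_seq_dist b m x y = 0 \<longleftrightarrow> x = y"
    using assms by (simp add: word_seq_dist_def)
  show "word_seq_dist b m x z \<le> word_seq_dist b m x y + word_seq_dist b m y z"
  proof (cases "x = y \<or> y = z \<or> x = z")
    case True
    then show ?thesis by (auto simp: word_seq_dist_def)
  next
    case False
    define i where "i = (\<lambda>u v :: nat \<Rightarrow> nat list. Inf {k. u k \<noteq> v k})"
    from False have "{k. x k \<noteq> z k} \<noteq> {}" by auto
    then have "x (i x z) \<noteq> z (i x z)"
      using Inf_nat_def1[of "{k. x k \<noteq> z k}"] by (simp add: i_def)
    then consider "x (i x z) \<noteq> y (i x z)" | "y (i x z) \<noteq> z (i x z)" by metis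
    then have "i x y \<le> i x z \<or> i y z \<le> i x z"
      by cases (auto simp: i_def intro!: cInf_lower)
    then have "real b powr (- real (m * i x z)) \<le> real b powr (- real (m * i x y)) \<or>
               real b powr (- real (m * i x z)) \<le> real b powr (- real (m * i y z))"
      using assms by (auto intro!: powr_mono mult_le_mono2 simp del: of_nat_mult)
    moreover have "0 \<le> real b powr (- real (m * i x y))" "0 \<le> real b powr (- real (m * i y z))"
      by auto
    ultimately show ?thesis
      using False unfolding word_seq_dist_def i_def by (auto simp del: of_nat_mult powr_ge_zero)
  qed
qed

lemma
  assumes "b \<ge> 1"
  shows mspace_word_seq_metric: "mspace (word_seq_metric b m) = word_seqs b m"
    and mdist_word_seq_metric: "mdist (word_seq_metric b m) = word_seq_dist b m"
  using Metric_space.mspace_metric[OF Metric_space_word_seqs[OF assms]]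
        Metric_space.mdist_metric[OF Metric_space_word_seqs[OF assms]]
  unfolding word_seq_metric_def by auto

text \<open>Digits are indexed from \<open>1\<close>; the value \<open>d 0\<close> is irrelevant.\<close>

definition K_set :: "nat \<Rightarrow> nat \<Rightarrow> (nat \<Rightarrow> nat list) \<Rightarrow> real set" where
  "K_set b m \<omega> =
     {(\<Sum>i. real (d (Suc i)) / real b ^ Suc i) | d :: nat \<Rightarrow> nat.
        (\<forall>i\<ge>1. d i \<in> {0..<b}) \<and> (\<forall>k. map d [k + 1..<k + m + 1] \<noteq> \<omega> k)}"

end

theory Submission
  imports Defs "HOL-Library.Discrete_Functions"
begin

text \<open>
  Let \<open>T\<close> be the tree of finite words that avoid \<open>\<omega> k\<close> at every position \<open>k\<close>, and let \<open>F n\<close> be the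
  number of its nodes of length \<open>n\<close>. Since a forbidden word removes at most one of at least three
  children, all nodes of length \<open>n\<close> have, up to a factor \<open>2 ^ (m - 1)\<close>, the same number
  \<open>F (n + j) / F n\<close> of descendants of length \<open>n + j\<close>. For such a homogeneous tree all four dimensions
  can be read off \<open>F\<close>: the Hausdorff and packing dimensions are the lower and upper growth exponents
  of \<open>F\<close> in base \<open>b\<close>, and the lower and Assouad dimensions are the extreme exponents of
  \<open>F (n + j) / F n\<close>. The quotient lies between constant multiples of \<open>\<eta> ^ j\<close> and \<open>\<lambda> ^ j\<close>, which gives (i).

  Fix any digit sequence \<open>a\<close>. On a stretch where \<open>\<omega> k\<close> is the factor of \<open>a\<close> at \<open>k\<close>, the forbidden words
  overlap maximally and the growth rate is \<open>\<lambda>\<close>; where the last digit of each factor is changed, they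
  do not overlap at all and the growth rate is \<open>\<eta>\<close>. Mixing the two kinds of stretches in suitable
  proportions prescribes the exponents, and the free choice of \<open>a\<close>, one digit per \<open>m\<close> digits of \<open>\<omega>\<close>,
  accounts for the dimension \<open>1 / m\<close> in (ii) and (iii).
\<close>

text \<open>Lower bounds for dimensions usually call for a measure. Here counting replaces it: since
  the nodes of one level are interchangeable up to a constant, a family of nodes at levels
  \<open>n i\<close> that meets every branch must satisfy
  \<open>(\<Sum>i. 1 / F (n i)) \<ge> c\<close>. The same count on the full \<open>b\<close>-ary
  tree of the free sequences \<open>a\<close> gives the bound \<open>1 / m\<close>.

  The rate \<lambda> comes from peeling words at their right end, the rate \<eta> from peeling them
  at their left end; extremal sequences turn either inequality into an equality.

  The obstacle in prescribing exponents is that every change between the two kinds of stretches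
  costs a constant factor of \<open>F\<close>. Blocks between consecutive squares balance this: only
  \<open>O(sqrt n)\<close> changes occur before \<open>n\<close>, so the constants vanish from the
  exponents, while the stretches still become arbitrarily long, which pushes the lower and Assouad
  dimensions to their extremes. To separate \<alpha> from \<beta>, the mean rate of the blocks
  alternates on doubly exponential ranges, each of which drowns out its past.\<close>

definition digit_val :: "nat \<Rightarrow> (nat \<Rightarrow> nat) \<Rightarrow> real" where
  "digit_val b d = (\<Sum>i. real (d i) / real b ^ Suc i)"

text \<open>The leading digit comes first, so \<open>word_val b w / b ^ length w\<close> is the left
  endpoint of the \<open>b\<close>-adic interval of \<open>w\<close>.\<close>

definition word_val :: "nat \<Rightarrow> nat list \<Rightarrow> nat" where
  "word_val b w = foldl (\<lambda>z x. b * z + x) 0 w"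

lemma digit_val_sums:
  assumes "b \<ge> 2" "\<And>i. d i < b"
  shows "(\<lambda>i. real (d i) / real b ^ Suc i) sums digit_val b d"
    and "0 \<le> digit_val b d" "digit_val b d \<le> 1"
proof -
  have "(\<lambda>i. (1 / real b) ^ i) sums (1 / (1 - 1 / real b))"
    by (rule geometric_sums) (use assms(1) in auto)
  then have "(\<lambda>i. (real b - 1) / real b * (1 / real b) ^ i) sums
             ((real b - 1) / real b * (1 / (1 - 1 / real b)))"
    by (rule sums_mult)
  then have g: "(\<lambda>i. (real b - 1) / real b ^ Suc i) sums 1"
    using assms(1) by (simp add: field_simps power_divide)
  have le: "real (d i) / real b ^ Suc i \<le> (real b - 1) / real b ^ Suc i" for i
  proof -
    have "real (d i) \<le> real b - 1" using assms(2)[of i] by linarith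
    then show ?thesis using assms(1) by (intro divide_right_mono) auto
  qed
  have s: "summable (\<lambda>i. real (d i) / real b ^ Suc i)"
    by (rule summable_comparison_test'[OF sums_summable[OF g], of 0]) (use le in auto)
  then show "(\<lambda>i. real (d i) / real b ^ Suc i) sums digit_val b d"
    unfolding digit_val_def by (rule summable_sums)
  show "0 \<le> digit_val b d"
    unfolding digit_val_def by (rule suminf_nonneg[OF s]) auto
  have "digit_val b d \<le> (\<Sum>i. (real b - 1) / real b ^ Suc i)"
    unfolding digit_val_def by (rule suminf_le[OF le s sums_summable[OF g]])
  then show "digit_val b d \<le> 1" using sums_unique[OF g] by simp
qed

text \<open>Multiplication by \<open>b ^ n\<close> moves the point past \<open>n\<close> digits,
  which become an integer; the remainder is again an expansion, so it lies in the unit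
  interval.\<close>

lemma digit_val_split:
  assumes "b \<ge> 2" "\<And>i. d i < b"
  shows "real b ^ n * digit_val b d
         = real (word_val b (map d [0..<n])) + digit_val b (\<lambda>i. d (i + n))"
proof (induction n)
  case 0
  then show ?case by (simp add: word_val_def)
next
  case (Suc n)
  have dn: "d (i + n) < b" for i by (rule assms(2))
  have s: "(\<lambda>i. real (d (i + n)) / real b ^ Suc i) sums digit_val b (\<lambda>i. d (i + n))"
    using digit_val_sums(1)[of b "\<lambda>i. d (i + n)", OF assms(1) dn] .
  then have "(\<lambda>i. real (d (Suc i + n)) / real b ^ Suc (Suc i)) sums
      (digit_val b (\<lambda>i. d (i + n)) - real (d n) / real b)"
    by (subst sums_Suc_iff) simp
  then have "(\<lambda>i. real b * (real (d (Suc i + n)) / real b ^ Suc (Suc i))) sums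
      (real b * (digit_val b (\<lambda>i. d (i + n)) - real (d n) / real b))"
    by (rule sums_mult)
  moreover have "real b * (real (d (Suc i + n)) / real b ^ Suc (Suc i))
      = real (d (i + Suc n)) / real b ^ Suc i" for i
    using assms(1) by simp
  moreover have "real b * (digit_val b (\<lambda>i. d (i + n)) - real (d n) / real b)
      = real b * digit_val b (\<lambda>i. d (i + n)) - real (d n)"
    using assms(1) by (simp add: right_diff_distrib)
  ultimately have "(\<lambda>i. real (d (i + Suc n)) / real b ^ Suc i) sums
      (real b * digit_val b (\<lambda>i. d (i + n)) - real (d n))"
    by simp
  then have "digit_val b (\<lambda>i. d (i + Suc n)) = real b * digit_val b (\<lambda>i. d (i + n)) - real (d n)"
    unfolding digit_val_def by (simp add: sums_iff)
  with Suc show ?case by (simp add: word_val_def algebra_simps)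
qed

lemma word_val_inj:
  assumes "length v = length w" "set v \<subseteq> {0..<b}" "set w \<subseteq> {0..<b}" "word_val b v = word_val b w"
  shows "v = w"
  using assms
proof (induction v arbitrary: w rule: rev_induct)
  case Nil
  then show ?case by simp
next
  case (snoc x v)
  obtain w' y where w: "w = w' @ [y]" using snoc.prems(1) by (cases w rule: rev_cases) auto
  have e: "b * word_val b v + x = b * word_val b w' + y"
    using snoc.prems(4) by (simp add: w word_val_def)
  have xy: "x < b" "y < b" using snoc.prems w by auto
  have "x = y" using arg_cong[OF e, of "\<lambda>t. t mod b"] xy by simp
  moreover have "word_val b v = word_val b w'" using e xy \<open>x = y\<close> by auto
  ultimately show ?case using snoc w by auto
qed

section \<open>Homogeneous digit trees\<close>

definition level :: "nat list set \<Rightarrow> nat \<Rightarrow> nat list set" where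
  "level T n = {w \<in> T. length w = n}"

definition descendants :: "nat list set \<Rightarrow> nat list \<Rightarrow> nat \<Rightarrow> nat list set" where
  "descendants T w j = {u. length u = j \<and> w @ u \<in> T}"

text \<open>The quotient \<open>card (level T (n + j)) / card (level T n)\<close> is the average
  number of descendants at depth \<open>j\<close>; the last two assumptions compare every node with
  this average, free of division. By \<open>child\<close> there are no dead ends, so every node lies
  on an infinite branch.\<close>

locale digit_tree =
  fixes b :: nat and T :: "nat list set" and c :: real
  assumes b_ge2: "b \<ge> 2"
    and digits: "w \<in> T \<Longrightarrow> set w \<subseteq> {0..<b}"
    and Nil_in: "[] \<in> T"
    and prefix_in: "u @ v \<in> T \<Longrightarrow> u \<in> T"
    and child: "w \<in> T \<Longrightarrow> \<exists>x. w @ [x] \<in> T"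
    and c_pos: "c > 0"
    and many_descendants: "w \<in> T \<Longrightarrow> c * card (level T (length w + j))
           \<le> card (level T (length w)) * card (descendants T w j)"
    and few_descendants: "w \<in> T \<Longrightarrow> c * (card (level T (length w)) * card (descendants T w j))
           \<le> card (level T (length w + j))"
begin

abbreviation F :: "nat \<Rightarrow> nat" where "F n \<equiv> card (level T n)"

definition branches :: "(nat \<Rightarrow> nat) set" where
  "branches = {d. \<forall>n. map d [0..<n] \<in> T}"

definition tree_set :: "real set" where
  "tree_set = digit_val b ` branches"

text \<open>Cylinders of one level need not be disjoint: a \<open>b\<close>-adic rational may have
  two expansions. Counting is therefore done with words and their integer values.\<close>

definition cyl :: "nat list \<Rightarrow> real set" where
  "cyl w = digit_val b ` {d \<in> branches. map d [0..<length w] = w}"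

lemma bpow_pos: "real b ^ n > 0" "real b > 0" "real b > 1"
  using b_ge2 by auto

lemma finite_level: "finite (level T n)"
proof (rule finite_subset)
  show "level T n \<subseteq> {w. set w \<subseteq> {0..<b} \<and> length w = n}" using digits by (auto simp: level_def)
  show "finite {w. set w \<subseteq> {0..<b} \<and> length w = n}" by (rule finite_lists_length_eq) simp
qed

lemma finite_descendants: "finite (descendants T w j)"
proof (rule finite_subset)
  show "descendants T w j \<subseteq> {u. set u \<subseteq> {0..<b} \<and> length u = j}"
    using digits by (force simp: descendants_def)
  show "finite {u. set u \<subseteq> {0..<b} \<and> length u = j}" by (rule finite_lists_length_eq) simp
qed

lemma branch_digit: "d \<in> branches \<Longrightarrow> d i < b"
proof -
  assume "d \<in> branches"
  then have "map d [0..<Suc i] \<in> T" unfolding branches_def by blast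
  from digits[OF this] show ?thesis by auto
qed

lemma branch_prefix: "d \<in> branches \<Longrightarrow> map d [0..<n] \<in> level T n"
  by (auto simp: branches_def level_def)

lemma take_in: "w \<in> T \<Longrightarrow> take n w \<in> T"
  using prefix_in[of "take n w" "drop n w"] by simp

text \<open>Dependent choice along the tree: proper extensions chosen one after another determine a
  branch through all of them. Koenig's lemma and the Baire category argument below are both
  instances.\<close>

lemma chain_branch:
  assumes "w0 \<in> T" "Q 0 w0"
    and step: "\<And>i w. w \<in> T \<Longrightarrow> Q i w \<Longrightarrow> \<exists>v. v \<noteq> [] \<and> w @ v \<in> T \<and> Q (Suc i) (w @ v)"
  obtains d l where "d \<in> branches" "\<And>i. l i \<ge> i" "\<And>i. Q i (map d [0..<l i])"
    "l 0 = length w0" "map d [0..<length w0] = w0"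
proof -
  have "\<exists>f. \<forall>i. (f i \<in> T \<and> Q i (f i) \<and> (i = 0 \<longrightarrow> f i = w0))
      \<and> (\<exists>v. v \<noteq> [] \<and> f (Suc i) = f i @ v)"
  proof (rule dependent_nat_choice)
    show "\<exists>x. x \<in> T \<and> Q 0 x \<and> (0 = (0::nat) \<longrightarrow> x = w0)" using assms by blast
    fix x n assume "x \<in> T \<and> Q n x \<and> (n = 0 \<longrightarrow> x = w0)"
    with step[of x n] show "\<exists>y. (y \<in> T \<and> Q (Suc n) y \<and> (Suc n = 0 \<longrightarrow> y = w0))
        \<and> (\<exists>v. v \<noteq> [] \<and> y = x @ v)" by auto
  qed
  then obtain f where f: "\<And>i. f i \<in> T" "\<And>i. Q i (f i)" "f 0 = w0"
    and ext: "\<And>i. \<exists>v. v \<noteq> [] \<and> f (Suc i) = f i @ v" by auto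
  have len: "length (f i) \<ge> i" for i
  proof (induction i)
    case (Suc i)
    obtain v where "v \<noteq> []" "f (Suc i) = f i @ v" using ext by blast
    with Suc show ?case by (cases v) auto
  qed auto
  have pre: "\<exists>v. f j = f i @ v" if "i \<le> j" for i j
    using that
  proof (induction rule: dec_induct)
    case (step n)
    then obtain v where v: "f n = f i @ v" by blast
    obtain u where "f (Suc n) = f n @ u" using ext by blast
    with v show ?case by (intro exI[of _ "v @ u"]) simp
  qed auto
  have nth: "f j ! k = f i ! k" if "i \<le> j" "k < length (f i)" for i j k
    using pre[OF that(1)] that(2) by (auto simp: nth_append)
  \<comment> \<open>Digit \<open>k\<close> is read off \<open>f (Suc k)\<close>, the first node
    certain to be longer than \<open>k\<close>; later nodes extend it and agree there.\<close>
  define d where "d = (\<lambda>k. f (Suc k) ! k)"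
  have dk: "d k = f i ! k" if "k < length (f i)" for i k
  proof (cases "Suc k \<le> i")
    case True
    then show ?thesis using nth[OF True, of k] len[of "Suc k"] by (auto simp: d_def)
  next
    case False
    then show ?thesis using nth[of i "Suc k" k] that by (auto simp: d_def)
  qed
  have md: "map d [0..<length (f i)] = f i" for i
    by (rule nth_equalityI) (auto simp: dk)
  have "map d [0..<n] = take n (f n)" for n
    by (rule nth_equalityI) (use len[of n] in \<open>auto simp: dk[of _ n]\<close>)
  then have "d \<in> branches" using f(1) take_in by (auto simp: branches_def)
  moreover have "Q i (map d [0..<length (f i)])" for i using f(2) md by simp
  moreover have "map d [0..<length w0] = w0" using md[of 0] f(3) by simp
  ultimately show ?thesis using that[of d "\<lambda>i. length (f i)"] len f(3) by blast
qed

lemma branch_through: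
  assumes "w \<in> T"
  obtains d where "d \<in> branches" "map d [0..<length w] = w"
proof (rule chain_branch[of w "\<lambda>_ _. True"])
  fix i v assume "v \<in> T"
  then show "\<exists>u. u \<noteq> [] \<and> v @ u \<in> T \<and> True" using child by blast
qed (use assms that in auto)

lemma F_pos: "F n \<ge> 1"
proof -
  obtain d where "d \<in> branches" using branch_through[OF Nil_in] by blast
  then have "level T n \<noteq> {}" using branch_prefix by blast
  then show ?thesis using finite_level by (simp add: Suc_le_eq card_gt_0_iff)
qed

section \<open>Cylinders and how many of them a small set meets\<close>

lemma cyl_nonempty: "w \<in> T \<Longrightarrow> cyl w \<noteq> {}"
  using branch_through[of w] unfolding cyl_def by blast

lemma cyl_subset: "cyl w \<subseteq> tree_set"
  by (auto simp: cyl_def tree_set_def)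

lemma cyl_append: "cyl (w @ u) \<subseteq> cyl w"
proof
  fix x assume "x \<in> cyl (w @ u)"
  then obtain d where d: "d \<in> branches" "map d [0..<length (w @ u)] = w @ u" "x = digit_val b d"
    by (auto simp: cyl_def)
  have "map d [0..<length w] = take (length w) (map d [0..<length (w @ u)])"
    by (simp add: take_map)
  with d show "x \<in> cyl w" by (auto simp: cyl_def)
qed

lemma tree_set_cyl:
  assumes "x \<in> tree_set"
  obtains w where "w \<in> level T n" "x \<in> cyl w"
proof -
  obtain d where d: "d \<in> branches" "x = digit_val b d" using assms by (auto simp: tree_set_def)
  then show ?thesis using that[of "map d [0..<n]"] branch_prefix[of d n] by (auto simp: cyl_def)
qed

lemma tree_set_nonempty: "tree_set \<noteq> {}"
  using cyl_nonempty[OF Nil_in] cyl_subset by blast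

lemma cyl_bounds:
  assumes "x \<in> cyl w"
  shows "real (word_val b w) \<le> real b ^ length w * x"
    and "real b ^ length w * x \<le> real (word_val b w) + 1"
proof -
  obtain d where d: "d \<in> branches" "map d [0..<length w] = w" "x = digit_val b d"
    using assms by (auto simp: cyl_def)
  have dn: "d i < b" "d (i + length w) < b" for i using branch_digit[OF d(1)] by auto
  show "real (word_val b w) \<le> real b ^ length w * x"
       "real b ^ length w * x \<le> real (word_val b w) + 1"
    using digit_val_split[of b d "length w", OF b_ge2 dn(1)]
      digit_val_sums(2,3)[of b "\<lambda>i. d (i + length w)", OF b_ge2 dn(2)] d by auto
qed

lemma cyl_dist:
  assumes "x \<in> cyl w" "y \<in> cyl w"
  shows "\<bar>x - y\<bar> \<le> 1 / real b ^ length w"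
proof -
  have "real b ^ length w * \<bar>x - y\<bar> = \<bar>real b ^ length w * x - real b ^ length w * y\<bar>"
    by (simp add: abs_mult right_diff_distrib[symmetric])
  also have "\<dots> \<le> 1" using cyl_bounds[OF assms(1)] cyl_bounds[OF assms(2)] by linarith
  finally show ?thesis using bpow_pos(1)[of "length w"] by (simp add: field_simps)
qed

lemma word_val_inj_level: "inj_on (word_val b) (level T n)"
proof (rule inj_onI)
  fix v w assume "v \<in> level T n" "w \<in> level T n" "word_val b v = word_val b w"
  then show "v = w" using word_val_inj[of v w b] digits by (auto simp: level_def)
qed

text \<open>Words of one level have distinct integer values, and a point of a cylinder determines
  the value up to 1 after scaling. So all values in question lie within \<open>R + 1\<close> of a
  fixed one, and there are \<open>2 * (R + 1) + 1\<close> such integers. The cases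
  \<open>R = 1\<close> and \<open>R = 2\<close> give the constants 5 and 7 below.\<close>

lemma card_meeting_cyl:
  assumes "\<And>x y. x \<in> U \<Longrightarrow> y \<in> U \<Longrightarrow> \<bar>x - y\<bar> \<le> real R / real b ^ n"
  shows "card {w \<in> level T n. cyl w \<inter> U \<noteq> {}} \<le> 2 * R + 3"
proof (cases "{w \<in> level T n. cyl w \<inter> U \<noteq> {}} = {}")
  case True
  then show ?thesis by (metis card.empty le0)
next
  case False
  let ?S = "{w \<in> level T n. cyl w \<inter> U \<noteq> {}}"
  obtain v y where v: "v \<in> level T n" "y \<in> cyl v" "y \<in> U" using False by blast
  have "word_val b ` ?S \<subseteq> {word_val b v - (R + 1)..word_val b v + (R + 1)}"
  proof clarify
    fix w assume w: "w \<in> level T n" and "cyl w \<inter> U \<noteq> {}"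
    then obtain x where x: "x \<in> cyl w" "x \<in> U" by blast
    have l: "length w = n" "length v = n" using w v by (auto simp: level_def)
    have "real b ^ n * \<bar>x - y\<bar> = \<bar>real b ^ n * x - real b ^ n * y\<bar>"
      by (simp add: abs_mult right_diff_distrib[symmetric])
    moreover have "real b ^ n * \<bar>x - y\<bar> \<le> R"
      using assms[OF x(2) v(3)] bpow_pos(1)[of n] by (simp add: field_simps)
    ultimately have "\<bar>real (word_val b w) - real (word_val b v)\<bar> \<le> R + 1"
      using cyl_bounds[OF x(1)] cyl_bounds[OF v(2)] unfolding l of_nat_add by linarith
    then show "word_val b w \<in> {word_val b v - (R + 1)..word_val b v + (R + 1)}" by auto
  qed
  from card_mono[OF _ this] have "card (word_val b ` ?S) \<le> 2 * R + 3" by simp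
  moreover have "card (word_val b ` ?S) = card ?S"
    by (rule card_image, rule inj_on_subset[OF word_val_inj_level[of n]]) auto
  ultimately show ?thesis by simp
qed

section \<open>Homogeneity and bars\<close>

lemma desc_le:
  assumes "w \<in> level T n" "n \<le> N"
  shows "card (descendants T w (N - n)) \<le> real (F N) / (c * F n)"
proof -
  have "c * (F n * card (descendants T w (N - n))) \<le> F N"
    using few_descendants[of w "N - n"] assms by (auto simp: level_def)
  then show ?thesis using c_pos F_pos[of n] by (simp add: field_simps)
qed

lemma desc_ge:
  assumes "w \<in> level T n" "n \<le> N"
  shows "card (descendants T w (N - n)) \<ge> c * real (F N) / F n"
proof -
  have "c * F N \<le> F n * card (descendants T w (N - n))"
    using many_descendants[of w "N - n"] assms by (auto simp: level_def)
  then show ?thesis using F_pos[of n] by (simp add: field_simps)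
qed

lemma card_extensions_le:
  assumes "S \<subseteq> level T n" "n \<le> N"
  shows "card {u \<in> level T N. take n u \<in> S} \<le> card S * (real (F N) / (c * F n))"
proof -
  have fS: "finite S" using assms finite_level finite_subset by blast
  have "{u \<in> level T N. take n u \<in> S} \<subseteq> (\<Union>w\<in>S. (\<lambda>v. w @ v) ` descendants T w (N - n))"
  proof clarify
    fix u assume u: "u \<in> level T N" "take n u \<in> S"
    then have "drop n u \<in> descendants T (take n u) (N - n)" "u = take n u @ drop n u"
      by (auto simp: level_def descendants_def)
    with u(2) show "u \<in> (\<Union>w\<in>S. (\<lambda>v. w @ v) ` descendants T w (N - n))" by blast
  qed
  then have "card {u \<in> level T N. take n u \<in> S}
      \<le> card (\<Union>w\<in>S. (\<lambda>v. w @ v) ` descendants T w (N - n))"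
    by (rule card_mono[rotated]) (use fS finite_descendants in auto)
  also have "\<dots> \<le> (\<Sum>w\<in>S. card ((\<lambda>v. w @ v) ` descendants T w (N - n)))"
    by (rule card_UN_le[OF fS])
  also have "\<dots> \<le> (\<Sum>w\<in>S. card (descendants T w (N - n)))"
    by (intro sum_mono card_image_le finite_descendants)
  finally have "real (card {u \<in> level T N. take n u \<in> S})
      \<le> (\<Sum>w\<in>S. real (card (descendants T w (N - n))))"
    by (simp only: of_nat_sum[symmetric] of_nat_le_iff)
  also have "\<dots> \<le> (\<Sum>w\<in>S. real (F N) / (c * F n))"
    by (intro sum_mono desc_le) (use assms in auto)
  finally show ?thesis by simp
qed

text \<open>Koenig's lemma replaces compactness here: a countable bar contains a finite one, and
  for a finite bar it suffices to count the nodes of one deep level.\<close>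

lemma bar_weight:
  fixes S :: "nat \<Rightarrow> nat list set"
  assumes S: "\<And>i. S i \<subseteq> level T (n i)" "\<And>i. card (S i) \<le> M"
    and bar: "\<And>d. d \<in> branches \<Longrightarrow> \<exists>i. map d [0..<n i] \<in> S i"
  shows "\<exists>k. 1 \<le> (\<Sum>i<k. M / (c * F (n i)))"
proof -
  \<comment> \<open>\<open>P w\<close>: finitely many of the \<open>S i\<close> catch every
    sufficiently long node below \<open>w\<close>. A node has at most \<open>b\<close> children, so
    a failure of \<open>P\<close> passes to some child, and a whole branch of failures would
    contradict \<open>bar\<close>.\<close>
  define P where "P w \<longleftrightarrow> (\<exists>k N. \<forall>v. w @ v \<in> T \<and> length (w @ v) \<ge> N \<longrightarrow>
      (\<exists>i<k. take (n i) (w @ v) \<in> S i))" for w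
  have "P []"
  proof (rule ccontr)
    assume "\<not> P []"
    have nP: "\<exists>v. v \<noteq> [] \<and> w @ v \<in> T \<and> \<not> P (w @ v)" if w: "w \<in> T" "\<not> P w" for w
    proof (rule ccontr)
      assume no: "\<not> ?thesis"
      have "P (w @ [x])" if "w @ [x] \<in> T" for x using no that by blast
      then have "\<forall>x. \<exists>k N. w @ [x] \<in> T \<longrightarrow> (\<forall>v. (w @ [x]) @ v \<in> T \<and> length ((w @ [x]) @ v) \<ge> N \<longrightarrow>
          (\<exists>i<k. take (n i) ((w @ [x]) @ v) \<in> S i))"
        unfolding P_def by blast
      then have "\<exists>k N. \<forall>x. w @ [x] \<in> T \<longrightarrow> (\<forall>v. (w @ [x]) @ v \<in> T \<and> length ((w @ [x]) @ v) \<ge> N x \<longrightarrow>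
          (\<exists>i<k x. take (n i) ((w @ [x]) @ v) \<in> S i))"
        unfolding choice_iff .
      then obtain k N where kN: "\<And>x v. w @ [x] \<in> T \<Longrightarrow> (w @ [x]) @ v \<in> T \<Longrightarrow>
          length ((w @ [x]) @ v) \<ge> N x \<Longrightarrow> \<exists>i<k x. take (n i) ((w @ [x]) @ v) \<in> S i"
        by blast
      define k' where "k' = Max (k ` {0..<b})"
      define N' where "N' = Max (N ` {0..<b}) + Suc (length w)"
      have "P w" unfolding P_def
      proof (rule exI[of _ k'], rule exI[of _ N'], intro allI impI)
        fix v assume v: "w @ v \<in> T \<and> N' \<le> length (w @ v)"
        then have "v \<noteq> []" unfolding N'_def by auto
        then obtain x v' where xv: "v = x # v'" by (cases v) auto
        then have xb: "x \<in> {0..<b}" using digits v by force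
        have "w @ [x] \<in> T" using prefix_in[of "w @ [x]" v'] v xv by simp
        moreover have "N x \<le> Max (N ` {0..<b})" using xb by (intro Max_ge) auto
        ultimately obtain i where "i < k x" "take (n i) (w @ v) \<in> S i"
          using kN[of x v'] v xv unfolding N'_def by auto
        moreover have "k x \<le> k'" unfolding k'_def using xb by (intro Max_ge) auto
        ultimately show "\<exists>i<k'. take (n i) (w @ v) \<in> S i" by (meson order.strict_trans2)
      qed
      with w(2) show False by simp
    qed
    obtain d l where d: "d \<in> branches" "\<And>i. l i \<ge> i" "\<And>i. \<not> P (map d [0..<l i])"
    proof (rule chain_branch[of "[]" "\<lambda>_ w. \<not> P w"])
      show "[] \<in> T" by (rule Nil_in)
      show "\<not> P []" by fact
      show "\<exists>v. v \<noteq> [] \<and> w @ v \<in> T \<and> \<not> P (w @ v)" if "w \<in> T" "\<not> P w" for w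
        using nP that by blast
      fix d l assume "d \<in> branches" "\<And>i. i \<le> l i" "\<And>i. \<not> P (map d [0..<l i])"
      then show thesis by (rule that)
    qed
    obtain i where i: "map d [0..<n i] \<in> S i" using bar[OF d(1)] by blast
    have "P (map d [0..<l (n i)])" unfolding P_def
    proof (rule exI[of _ "Suc i"], rule exI[of _ 0], intro allI impI)
      fix v
      have "take (n i) (map d [0..<l (n i)] @ v) = map d [0..<n i]"
        using d(2)[of "n i"] by (simp add: take_map)
      then show "\<exists>ia<Suc i. take (n ia) (map d [0..<l (n i)] @ v) \<in> S ia"
        using i by (intro exI[of _ i]) simp
    qed
    with d(3) show False by blast
  qed
  then obtain k N where kN: "\<And>v. v \<in> T \<Longrightarrow> length v \<ge> N \<Longrightarrow> \<exists>i<k. take (n i) v \<in> S i"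
    unfolding P_def by auto
  \<comment> \<open>At least \<open>N\<close> and every \<open>n i\<close> with
    \<open>i < k\<close>, so that all bar nodes can be compared on this one level.\<close>
  define N' where "N' = N + (\<Sum>i<k. n i)"
  have nN: "n i \<le> N'" if "i < k" for i
    unfolding N'_def using member_le_sum[of i "{..<k}" n] that by auto
  have "level T N' \<subseteq> (\<Union>i<k. {u \<in> level T N'. take (n i) u \<in> S i})"
  proof
    fix u assume u: "u \<in> level T N'"
    then have "u \<in> T" "length u \<ge> N" by (auto simp: level_def N'_def)
    then show "u \<in> (\<Union>i<k. {u \<in> level T N'. take (n i) u \<in> S i})" using kN[of u] u by auto
  qed
  then have "F N' \<le> card (\<Union>i<k. {u \<in> level T N'. take (n i) u \<in> S i})"
    by (rule card_mono[rotated]) (use finite_level in auto)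
  also have "\<dots> \<le> (\<Sum>i<k. card {u \<in> level T N'. take (n i) u \<in> S i})"
    by (rule card_UN_le) simp
  finally have "real (F N') \<le> (\<Sum>i<k. real (card {u \<in> level T N'. take (n i) u \<in> S i}))"
    by (simp only: of_nat_sum[symmetric] of_nat_le_iff)
  also have "\<dots> \<le> (\<Sum>i<k. M * (real (F N') / (c * F (n i))))"
  proof (rule sum_mono)
    fix i assume "i \<in> {..<k}"
    then have "real (card {u \<in> level T N'. take (n i) u \<in> S i})
        \<le> card (S i) * (real (F N') / (c * F (n i)))"
      by (intro card_extensions_le S nN) auto
    also have "\<dots> \<le> M * (real (F N') / (c * F (n i)))"
      using S(2)[of i] c_pos by (intro mult_right_mono) auto
    finally show "real (card {u \<in> level T N'. take (n i) u \<in> S i})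
        \<le> M * (real (F N') / (c * F (n i)))" .
  qed
  also have "\<dots> = F N' * (\<Sum>i<k. M / (c * F (n i)))"
    by (simp add: sum_distrib_left field_simps)
  finally have "1 \<le> (\<Sum>i<k. M / (c * F (n i)))"
    using F_pos[of N'] by (simp add: field_simps)
  then show ?thesis ..
qed

end

section \<open>Hausdorff dimension\<close>

lemma powr_decay:
  fixes B u C e :: real
  assumes "B > 1" "u > 0" "e > 0"
  obtains N where "\<And>n. n \<ge> N \<Longrightarrow> C * B powr (- u * real n) < e"
proof -
  have "B powr (- u) < 1" using assms by (simp add: powr_less_one)
  then have "(\<lambda>n. (B powr (- u)) ^ n) \<longlonglongrightarrow> 0" by (intro LIMSEQ_realpow_zero) auto
  then have "(\<lambda>n. C * (B powr (- u)) ^ n) \<longlonglongrightarrow> 0" by (rule tendsto_mult_right_zero)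
  then have "eventually (\<lambda>n. C * (B powr (- u)) ^ n < e) sequentially"
    using assms(3) by (rule order_tendstoD(2))
  then obtain N where "\<And>n. n \<ge> N \<Longrightarrow> C * (B powr (- u)) ^ n < e"
    unfolding eventually_sequentially by blast
  then show ?thesis using that[of N] assms(1) by (simp add: powr_power mult.commute)
qed

lemma mdist_le_mdiameter:
  assumes "mdiameter X U \<le> ennreal \<delta>" "x \<in> U" "y \<in> U" "U \<subseteq> mspace X"
  shows "mdist X x y \<le> enn2real (mdiameter X U)"
proof -
  have "ennreal (mdist X x y) \<le> mdiameter X U"
    unfolding mdiameter_def using assms by (intro SUP_upper2[of "(x, y)"]) auto
  moreover have "mdiameter X U < top" using assms(1) by (meson ennreal_less_top order.strict_trans1)
  ultimately have "enn2real (ennreal (mdist X x y)) \<le> enn2real (mdiameter X U)"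
    by (intro enn2real_mono) auto
  then show ?thesis by simp
qed

text \<open>Rounds the diameter of a covering set to a scale \<open>1 / B ^ n\<close>, at the cost
  of the factor \<open>B powr s\<close>. Empty and one-point sets have no best scale; they receive
  one so deep that it contributes at most \<epsilon>.\<close>

lemma dyadic_scale:
  fixes B s t \<epsilon> :: real
  assumes "B > 1" "0 \<le> t" "t < s" "mdiameter X U \<le> 1" "U \<subseteq> mspace X" "\<epsilon> > 0"
  shows "\<exists>n::nat. (\<forall>x\<in>U. \<forall>y\<in>U. mdist X x y \<le> 1 / B ^ n)
      \<and> ennreal (B powr (- s * real n)) \<le> ennreal (B powr s) * diam_pow X t U + ennreal \<epsilon>"
proof -
  define \<delta> where "\<delta> = enn2real (mdiameter X U)"
  have dist: "mdist X x y \<le> \<delta>" if "x \<in> U" "y \<in> U" for x y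
    unfolding \<delta>_def using mdist_le_mdiameter[of X U 1 x y] assms that by simp
  have \<delta>: "0 \<le> \<delta>" "\<delta> \<le> 1"
    using enn2real_mono[OF assms(4)] by (auto simp: \<delta>_def)
  show ?thesis
  proof (cases "U = {} \<or> \<delta> = 0")
    case True
    obtain N where "\<And>n. n \<ge> N \<Longrightarrow> 1 * B powr (- s * real n) < \<epsilon>"
      using powr_decay[of B s \<epsilon> 1] assms by auto
    then have "ennreal (B powr (- s * real N)) \<le> ennreal \<epsilon>"
      by (intro ennreal_leI) (use order.strict_implies_order in force)
    moreover have "mdist X x y \<le> 1 / B ^ N" if "x \<in> U" "y \<in> U" for x y
    proof -
      have "mdist X x y \<le> 0" using True dist[OF that] that by auto
      also have "0 \<le> 1 / B ^ N" using assms(1) by simp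
      finally show ?thesis .
    qed
    ultimately show ?thesis by (intro exI[of _ N]) (auto intro: add_increasing)
  next
    case False
    then have pos: "\<delta> > 0" "U \<noteq> {}" using \<delta> by auto
    \<comment> \<open>The largest \<open>n\<close> with \<delta> at most
      \<open>B powr (- n)\<close>.\<close>
    define n where "n = nat \<lfloor>- log B \<delta>\<rfloor>"
    have "- log B \<delta> \<ge> 0" using pos \<delta> assms(1) by (simp add: log_le_zero_cancel_iff)
    then have n: "real n \<le> - log B \<delta>" "- log B \<delta> < real n + 1"
      unfolding n_def by linarith+
    have \<delta>_eq: "\<delta> = B powr (log B \<delta>)" using pos assms(1) by simp
    have "\<delta> \<le> B powr (- real n)" by (subst \<delta>_eq, rule powr_mono) (use n assms(1) in auto)
    then have small: "\<delta> \<le> 1 / B ^ n" using assms(1) by (simp add: powr_minus_divide powr_realpow)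
    have "B powr (- s * real n) = B powr s * B powr (- (real n + 1) * s)"
      by (simp add: powr_add[symmetric] algebra_simps)
    also have "B powr (- (real n + 1) * s) \<le> B powr (log B \<delta> * s)"
      using n assms by (intro powr_mono mult_right_mono) auto
    also have "B powr (log B \<delta> * s) = \<delta> powr s"
      by (subst (2) \<delta>_eq) (simp add: powr_powr)
    also have "\<delta> powr s \<le> \<delta> powr t"
      using pos \<delta> assms by (intro powr_mono') auto
    finally have "B powr (- s * real n) \<le> B powr s * \<delta> powr t" by (simp add: mult_left_mono)
    moreover have "diam_pow X t U = ennreal (\<delta> powr t)"
      using pos by (auto simp: diam_pow_def \<delta>_def)
    ultimately have "ennreal (B powr (- s * real n)) \<le> ennreal (B powr s) * diam_pow X t U"
      by (simp add: ennreal_mult'[symmetric] ennreal_leI)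
    also have "\<dots> \<le> ennreal (B powr s) * diam_pow X t U + ennreal \<epsilon>" by simp
    finally have "ennreal (B powr (- s * real n)) \<le> ennreal (B powr s) * diam_pow X t U + ennreal \<epsilon>" .
    moreover have "mdist X x y \<le> 1 / B ^ n" if "x \<in> U" "y \<in> U" for x y
      using dist[OF that] small by linarith
    ultimately show ?thesis by blast
  qed
qed

text \<open>Takes the place of the mass distribution principle. Only covers at the scales
  \<open>1 / B ^ n\<close> remain, and for these it is enough to bound a finite partial sum, which
  is what \<open>bar_weight\<close> supplies. A general metric space is used because both the line
  and the space of word sequences occur.\<close>

lemma hausdorff_dim_ge:
  fixes B s \<kappa> :: real
  assumes "B > 1" "\<kappa> > 0"
    and cover: "\<And>U n. E \<subseteq> (\<Union>i::nat. U i) \<Longrightarrow> (\<And>i. U i \<subseteq> mspace X) \<Longrightarrow>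
      (\<And>i x y. x \<in> U i \<Longrightarrow> y \<in> U i \<Longrightarrow> mdist X x y \<le> 1 / B ^ n i) \<Longrightarrow>
      \<exists>k. \<kappa> \<le> (\<Sum>i<k. B powr (- s * real (n i)))"
  shows "ereal s \<le> hausdorff_dim X E"
  unfolding hausdorff_dim_def
proof (rule Inf_greatest, clarify)
  fix t assume t: "0 \<le> t" and zero: "hausdorff_measure X t E = 0"
  have "s \<le> t"
  proof (rule ccontr)
    assume "\<not> s \<le> t"
    then have st: "t < s" by simp
    \<comment> \<open>The rounded cover sum is then at most \<kappa>\<open>/ 4\<close>, and the
      errors \<epsilon>\<open>i\<close> add at most another \<kappa>\<open>/ 4\<close>, which
      together stay below \<kappa>.\<close>
    define e where "e = \<kappa> / (4 * B powr s)"
    have e: "e > 0" using assms unfolding e_def by auto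
    have "hausdorff_premeasure X t 1 E \<le> hausdorff_measure X t E"
      unfolding hausdorff_measure_def by (rule SUP_upper) simp
    then have "hausdorff_premeasure X t 1 E < ennreal e" using zero e by simp
    then obtain U where U: "\<And>i. U i \<subseteq> mspace X" "\<And>i. mdiameter X (U i) \<le> 1"
        "E \<subseteq> (\<Union>i. U i)" and small: "(\<Sum>i. diam_pow X t (U i)) < ennreal e"
      unfolding hausdorff_premeasure_def INF_less_iff by auto
    define \<epsilon> where "\<epsilon> i = \<kappa> / 4 * (1 / 2) ^ Suc i" for i
    have \<epsilon>: "\<epsilon> i > 0" for i using assms(2) by (simp add: \<epsilon>_def)
    have "\<exists>n. \<forall>i. (\<forall>x\<in>U i. \<forall>y\<in>U i. mdist X x y \<le> 1 / B ^ n i)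
        \<and> ennreal (B powr (- s * real (n i)))
           \<le> ennreal (B powr s) * diam_pow X t (U i) + ennreal (\<epsilon> i)"
      by (rule choice, rule allI, rule dyadic_scale) (use assms t st U \<epsilon> in auto)
    then obtain n where n: "\<And>i x y. x \<in> U i \<Longrightarrow> y \<in> U i \<Longrightarrow> mdist X x y \<le> 1 / B ^ n i"
      "\<And>i. ennreal (B powr (- s * real (n i)))
           \<le> ennreal (B powr s) * diam_pow X t (U i) + ennreal (\<epsilon> i)" by blast
    obtain k where k: "\<kappa> \<le> (\<Sum>i<k. B powr (- s * real (n i)))"
      using cover[of U n, OF U(3) U(1) n(1)] by blast
    have "(\<Sum>i<k. \<epsilon> i) \<le> \<kappa> / 4"
    proof -
      have "(\<Sum>i<k. (1 / 2 :: real) ^ Suc i) \<le> 1"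
        using sum_le_suminf[OF sums_summable[OF power_half_series], of "{..<k}"]
          sums_unique[OF power_half_series] by simp
      then show ?thesis unfolding \<epsilon>_def sum_distrib_left[symmetric]
        using assms(2) mult_left_mono[of _ 1 "\<kappa> / 4"] by fastforce
    qed
    then have eps: "(\<Sum>i<k. ennreal (\<epsilon> i)) \<le> ennreal (\<kappa> / 4)"
      using \<epsilon> by (subst sum_ennreal) (auto intro: ennreal_leI less_imp_le)
    have "ennreal \<kappa> \<le> (\<Sum>i<k. ennreal (B powr (- s * real (n i))))"
      using k by (subst sum_ennreal) (auto intro: ennreal_leI)
    also have "\<dots> \<le> (\<Sum>i<k. ennreal (B powr s) * diam_pow X t (U i) + ennreal (\<epsilon> i))"
      by (intro sum_mono n(2))
    also have "\<dots> = ennreal (B powr s) * (\<Sum>i<k. diam_pow X t (U i)) + (\<Sum>i<k. ennreal (\<epsilon> i))"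
      by (simp add: sum.distrib sum_distrib_left)
    also have "\<dots> \<le> ennreal (B powr s) * ennreal e + ennreal (\<kappa> / 4)"
    proof (intro add_mono mult_left_mono eps)
      have "(\<Sum>i<k. diam_pow X t (U i)) \<le> (\<Sum>i. diam_pow X t (U i))"
        by (rule sum_le_suminf) auto
      with small show "(\<Sum>i<k. diam_pow X t (U i)) \<le> ennreal e" by simp
    qed auto
    also have "\<dots> = ennreal (B powr s * e + \<kappa> / 4)"
      using e assms by (simp add: ennreal_mult'[symmetric] ennreal_plus[symmetric] del: ennreal_plus)
    also have "B powr s * e + \<kappa> / 4 = \<kappa> / 2" using assms(1) by (simp add: e_def)
    finally show False using assms(2) by simp
  qed
  then show "ereal s \<le> ereal t" by simp
qed

abbreviation dim_H :: "real set \<Rightarrow> ereal" where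
  "dim_H \<equiv> hausdorff_dim euclidean_metric"

context digit_tree
begin

text \<open>The cylinders that meet the members of a cover, each at the scale of its member, form a
  bar with at most five nodes per member.\<close>

lemma hausdorff_dim_tree_ge:
  assumes "k > 0" and F: "\<And>n. F n \<ge> k * real b powr (s * real n)"
  shows "ereal s \<le> dim_H tree_set"
proof (rule hausdorff_dim_ge[of "real b" "c * k / 5"])
  show "real b > 1" by (rule bpow_pos)
  show "c * k / 5 > 0" using assms(1) c_pos by simp
  fix U :: "nat \<Rightarrow> real set" and n :: "nat \<Rightarrow> nat"
  assume U: "tree_set \<subseteq> (\<Union>i. U i)"
    and "\<And>i x y. x \<in> U i \<Longrightarrow> y \<in> U i \<Longrightarrow> mdist euclidean_metric x y \<le> 1 / real b ^ n i"
  then have d: "\<bar>x - y\<bar> \<le> real 1 / real b ^ n i" if "x \<in> U i" "y \<in> U i" for i x y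
    using that by (simp add: dist_real_def)
  define S where "S i = {w \<in> level T (n i). cyl w \<inter> U i \<noteq> {}}" for i
  have "\<exists>j. 1 \<le> (\<Sum>i<j. 5 / (c * F (n i)))"
  proof -
    have "\<exists>j. 1 \<le> (\<Sum>i<j. real 5 / (c * F (n i)))"
    proof (rule bar_weight[of S])
      show "S i \<subseteq> level T (n i)" for i by (auto simp: S_def)
      show "card (S i) \<le> 5" for i unfolding S_def using card_meeting_cyl[of "U i" 1, OF d] by simp
      fix a assume a: "a \<in> branches"
      then have "digit_val b a \<in> tree_set" by (auto simp: tree_set_def)
      then obtain i where i: "digit_val b a \<in> U i" using U by blast
      moreover have "digit_val b a \<in> cyl (map a [0..<n i])" using a by (auto simp: cyl_def)
      ultimately have "map a [0..<n i] \<in> S i" using branch_prefix[OF a] by (auto simp: S_def)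
      then show "\<exists>i. map a [0..<n i] \<in> S i" ..
    qed
    then show ?thesis by simp
  qed
  then obtain j where j: "1 \<le> (\<Sum>i<j. 5 / (c * F (n i)))" ..
  also have "\<dots> \<le> (\<Sum>i<j. 5 / (c * k) * real b powr (- s * real (n i)))"
  proof (rule sum_mono)
    fix i
    have "5 / (c * F (n i)) \<le> 5 / (c * (k * real b powr (s * real (n i))))"
      using F[of "n i"] assms(1) c_pos bpow_pos F_pos[of "n i"]
      by (intro divide_left_mono mult_left_mono mult_pos_pos) auto
    then show "5 / (c * F (n i)) \<le> 5 / (c * k) * real b powr (- s * real (n i))"
      by (simp add: powr_minus_divide)
  qed
  also have "\<dots> = 5 / (c * k) * (\<Sum>i<j. real b powr (- s * real (n i)))"
    by (simp add: sum_distrib_left)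
  finally show "\<exists>j. c * k / 5 \<le> (\<Sum>i<j. real b powr (- s * real (n i)))"
    using assms(1) c_pos by (intro exI[of _ j]) (simp add: field_simps)
qed

lemma diam_pow_cyl_le:
  assumes "t > 0"
  shows "mdiameter euclidean_metric (cyl w) \<le> ennreal (1 / real b ^ length w)"
    and "diam_pow euclidean_metric t (cyl w) \<le> ennreal (real b powr (- t * real (length w)))"
proof -
  show d: "mdiameter euclidean_metric (cyl w) \<le> ennreal (1 / real b ^ length w)"
    unfolding mdiameter_def
    by (rule SUP_least) (auto simp: dist_real_def intro!: ennreal_leI cyl_dist)
  have "enn2real (mdiameter euclidean_metric (cyl w)) \<le> 1 / real b ^ length w"
    using enn2real_mono[OF d] by simp
  then have "enn2real (mdiameter euclidean_metric (cyl w)) powr t \<le> (1 / real b ^ length w) powr t"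
    using assms by (intro powr_mono2) auto
  also have "\<dots> = real b powr (- t * real (length w))"
    using bpow_pos by (simp add: powr_realpow[symmetric] powr_minus_divide[symmetric] powr_powr mult.commute)
  finally show "diam_pow euclidean_metric t (cyl w) \<le> ennreal (real b powr (- t * real (length w)))"
    using assms by (auto simp: diam_pow_def intro: ennreal_leI)
qed

text \<open>All cylinders of a single level form a cover, so good levels arbitrarily far out
  suffice: the lower growth exponent decides.\<close>

lemma hausdorff_dim_tree_le:
  assumes "s \<ge> 0" and F: "\<And>N. \<exists>n\<ge>N. F n \<le> C * real b powr (s * real n)"
  shows "dim_H tree_set \<le> ereal s"
proof (rule dense_ge)
  fix z assume z: "ereal s < z"
  show "dim_H tree_set \<le> z"
  proof (cases z)
    case (real t)
    then have t: "t > s" using z by simp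
    have "hausdorff_measure euclidean_metric t tree_set \<le> 0"
      unfolding hausdorff_measure_def
    proof (rule SUP_least)
      fix \<delta> :: real assume "\<delta> \<in> {0<..}"
      then have \<delta>: "\<delta> > 0" by simp
      show "hausdorff_premeasure euclidean_metric t \<delta> tree_set \<le> 0"
      proof (rule ennreal_le_epsilon)
        fix e :: real assume e: "e > 0"
        obtain N1 where N1: "\<And>n. n \<ge> N1 \<Longrightarrow> C * real b powr (- (t - s) * real n) < e"
          using powr_decay[of "real b" "t - s" e C] bpow_pos t e by auto
        obtain N2 where N2: "\<And>n. n \<ge> N2 \<Longrightarrow> 1 * real b powr (- 1 * real n) < \<delta>"
          using powr_decay[of "real b" 1 \<delta> 1] bpow_pos \<delta> by auto
        obtain n where n: "n \<ge> max N1 N2" "F n \<le> C * real b powr (s * real n)" using F by blast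
        obtain h where h: "bij_betw h {..<F n} (level T n)"
          using ex_bij_betw_nat_finite[OF finite_level, of n] by (auto simp: atLeast0LessThan)
        \<comment> \<open>Covers are infinite sequences; the finite one is padded with the empty
          set, whose \<open>diam_pow\<close> is 0.\<close>
        define U where "U i = (if i < F n then cyl (h i) else {})" for i
        have lh: "h i \<in> level T n" "length (h i) = n" if "i < F n" for i
          using bij_betwE[OF h] that by (auto simp: level_def)
        have "1 / real b ^ n \<le> \<delta>"
          using N2[of n] n(1) bpow_pos by (simp add: powr_minus_divide powr_realpow)
        then have b\<delta>: "ennreal (1 / real b ^ n) \<le> ennreal \<delta>" by (rule ennreal_leI)
        have "mdiameter euclidean_metric (U i) \<le> ennreal \<delta>" for i
          using diam_pow_cyl_le(1)[of t "h i"] t assms(1) lh[of i] order_trans[OF _ b\<delta>]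
          by (auto simp: U_def) (simp add: mdiameter_def)
        moreover have "tree_set \<subseteq> (\<Union>i. U i)"
        proof
          fix x assume "x \<in> tree_set"
          then obtain w where "w \<in> level T n" "x \<in> cyl w" by (rule tree_set_cyl)
          moreover then obtain i where "i < F n" "w = h i" using h by (auto simp: bij_betw_def)
          ultimately show "x \<in> (\<Union>i. U i)" by (auto simp: U_def intro!: exI[of _ i])
        qed
        ultimately have "hausdorff_premeasure euclidean_metric t \<delta> tree_set
            \<le> (\<Sum>i. diam_pow euclidean_metric t (U i))"
          unfolding hausdorff_premeasure_def by (intro INF_lower) auto
        also have "\<dots> = (\<Sum>i<F n. diam_pow euclidean_metric t (U i))"
          by (rule suminf_finite) (auto simp: U_def diam_pow_def)
        also have "\<dots> \<le> (\<Sum>i<F n. ennreal (real b powr (- t * real n)))"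
        proof (rule sum_mono)
          fix i assume "i \<in> {..<F n}"
          then show "diam_pow euclidean_metric t (U i) \<le> ennreal (real b powr (- t * real n))"
            using diam_pow_cyl_le(2)[of t "h i"] t assms(1) lh(2)[of i] by (simp add: U_def)
        qed
        also have "\<dots> = ennreal (F n * real b powr (- t * real n))"
          by (subst sum_ennreal) auto
        also have "\<dots> \<le> ennreal (C * real b powr (s * real n) * real b powr (- t * real n))"
          using n(2) by (intro ennreal_leI mult_right_mono) auto
        also have "C * real b powr (s * real n) * real b powr (- t * real n)
            = C * real b powr (- (t - s) * real n)"
          by (simp add: powr_add[symmetric] algebra_simps)
        also have "ennreal \<dots> \<le> ennreal e"
          using N1[of n] n(1) by (intro ennreal_leI) auto
        finally show "hausdorff_premeasure euclidean_metric t \<delta> tree_set \<le> 0 + ennreal e" by simp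
      qed
    qed
    then have "hausdorff_measure euclidean_metric t tree_set = 0" by simp
    then show ?thesis using real t assms(1) unfolding hausdorff_dim_def
      by (intro Inf_lower) auto
  qed (use z in auto)
qed

end

section \<open>Packing dimension\<close>

lemma sum_geometric_tail_le:
  fixes q :: real
  assumes "0 \<le> q" "q < 1" "finite I" "I \<subseteq> {n..}"
  shows "(\<Sum>i\<in>I. q ^ i) \<le> q ^ n / (1 - q)"
proof -
  have "(\<Sum>i\<in>I. q ^ i) = (\<Sum>i\<in>I. q ^ n * q ^ (i - n))"
    by (rule sum.cong) (use assms in \<open>auto simp: power_add[symmetric]\<close>)
  also have "\<dots> = q ^ n * (\<Sum>i\<in>(\<lambda>i. i - n) ` I. q ^ i)"
    by (subst sum.reindex) (use assms in \<open>auto simp: sum_distrib_left intro!: inj_on_diff_nat\<close>)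
  also have "\<dots> \<le> q ^ n * (\<Sum>i. q ^ i)"
    using assms by (intro mult_left_mono sum_le_suminf summable_geometric) auto
  finally show ?thesis using assms by (simp add: suminf_geometric)
qed

context digit_tree
begin

lemma scale_of:
  assumes "0 < r" "r \<le> 1"
  shows "\<exists>n. 1 / real b ^ Suc n < r \<and> r \<le> 1 / real b ^ n
    \<and> (\<forall>m. r \<le> 1 / real b ^ m \<longrightarrow> m \<le> n)"
proof -
  obtain N where "(1 / real b) ^ N < r"
    using real_arch_pow_inv[of r "1 / real b"] assms bpow_pos by auto
  then have ex: "\<exists>N. 1 / real b ^ N < r" by (auto simp: power_divide)
  define n where "n = (LEAST N. 1 / real b ^ N < r)"
  have n: "1 / real b ^ n < r" unfolding n_def using ex by (rule LeastI_ex)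
  then obtain k where k: "n = Suc k" using assms(2) by (cases n) auto
  have "\<not> 1 / real b ^ k < r" using not_less_Least[of k "\<lambda>N. 1 / real b ^ N < r"] k n_def by simp
  moreover have "m \<le> k" if "r \<le> 1 / real b ^ m" for m
  proof (rule ccontr)
    assume "\<not> m \<le> k"
    then have "real b ^ n \<le> real b ^ m" using bpow_pos k by (intro power_increasing) auto
    then have "1 / real b ^ m \<le> 1 / real b ^ n" using bpow_pos by (simp add: frac_le)
    then show False using that n by linarith
  qed
  ultimately show ?thesis using n k by (intro exI[of _ k]) auto
qed

text \<open>Disjoint balls whose radius exceeds \<open>1 / b ^ Suc n\<close> have centres in
  different cylinders of level \<open>Suc n\<close>, because two centres in one cylinder are closer
  than either radius. So at most \<open>F (Suc n)\<close> balls belong to scale \<open>n\<close>,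
  and the sum over scales is dominated by a geometric series of ratio
  \<open>b powr (s - t)\<close>.\<close>

lemma packing_sum_le:
  assumes "t > s" "t > 0" and F: "\<And>n. F n \<le> C * real b powr (s * real n)"
    and P: "finite P" "disjoint_family_on (\<lambda>(x, r). cball x r) P"
      "\<And>x r. (x, r) \<in> P \<Longrightarrow> x \<in> tree_set \<and> 0 < r \<and> r \<le> 1 / real b ^ n0"
  shows "(\<Sum>(x, r)\<in>P. (2 * r) powr t)
     \<le> C * real b powr s * 2 powr t * ((real b powr (s - t)) ^ n0 / (1 - real b powr (s - t)))"
proof -
  define q where "q = real b powr (s - t)"
  have q: "0 \<le> q" "q < 1" using assms(1) bpow_pos by (auto simp: q_def powr_less_one)
  have C: "C \<ge> 0" using order_trans[OF _ F[of 0], of 0] b_ge2 by simp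
  have "\<forall>p\<in>P. \<exists>n. 1 / real b ^ Suc n < snd p \<and> snd p \<le> 1 / real b ^ n \<and> n0 \<le> n"
  proof
    fix p assume p: "p \<in> P"
    obtain x r where xr: "p = (x, r)" by (cases p)
    have r: "0 < r" "r \<le> 1 / real b ^ n0" using P(3) p xr by auto
    have "1 / real b ^ n0 \<le> 1" using bpow_pos by (simp add: one_le_power)
    then have r1: "r \<le> 1" using r(2) by linarith
    obtain n where "1 / real b ^ Suc n < r" "r \<le> 1 / real b ^ n"
      "\<forall>m. r \<le> 1 / real b ^ m \<longrightarrow> m \<le> n"
      using scale_of[OF r(1) r1] by blast
    with r xr show "\<exists>n. 1 / real b ^ Suc n < snd p \<and> snd p \<le> 1 / real b ^ n \<and> n0 \<le> n" by auto
  qed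
  then obtain lev where lev: "\<And>p. p \<in> P \<Longrightarrow> 1 / real b ^ Suc (lev p) < snd p"
      "\<And>p. p \<in> P \<Longrightarrow> snd p \<le> 1 / real b ^ lev p" "\<And>p. p \<in> P \<Longrightarrow> n0 \<le> lev p"
    by metis
  have cnt: "card {p \<in> P. lev p = n} \<le> F (Suc n)" for n
  proof -
    have "\<forall>p\<in>P. \<exists>w. w \<in> level T (Suc n) \<and> fst p \<in> cyl w"
      using P(3) tree_set_cyl by (metis prod.collapse)
    then obtain g where g: "\<And>p. p \<in> P \<Longrightarrow> g p \<in> level T (Suc n) \<and> fst p \<in> cyl (g p)" by metis
    have "inj_on g {p \<in> P. lev p = n}"
    proof (rule inj_onI, clarify)
      fix x r y r' assume a: "(x, r) \<in> P" "(y, r') \<in> P" "g (x, r) = g (y, r')"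
        "lev (y, r') = lev (x, r)" "n = lev (x, r)"
      have "\<bar>x - y\<bar> \<le> 1 / real b ^ Suc n"
        using cyl_dist[of x "g (x, r)" y] g[OF a(1)] g[OF a(2)] a(3) by (simp add: level_def)
      also have "\<dots> < r'" using lev(1)[OF a(2)] a(4,5) by simp
      finally have "x \<in> cball x r \<inter> cball y r'"
        using P(3)[OF a(1)] by (simp add: dist_real_def abs_minus_commute)
      then show "x = y \<and> r = r'"
        using P(2) a(1,2) unfolding disjoint_family_on_def by fastforce
    qed
    then show ?thesis
      by (rule card_inj_on_le) (use g finite_level in auto)
  qed
  have "(\<Sum>(x, r)\<in>P. (2 * r) powr t) = (\<Sum>p\<in>P. (2 * snd p) powr t)"
    by (simp add: case_prod_beta)
  also have "\<dots> = (\<Sum>n\<in>lev ` P. \<Sum>p\<in>{p \<in> P. lev p = n}. (2 * snd p) powr t)"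
    by (rule sum.image_gen[OF P(1)])
  also have "\<dots> \<le> (\<Sum>n\<in>lev ` P. C * real b powr s * 2 powr t * q ^ n)"
  proof (rule sum_mono)
    fix n assume "n \<in> lev ` P"
    have "(\<Sum>p\<in>{p \<in> P. lev p = n}. (2 * snd p) powr t)
        \<le> (\<Sum>p\<in>{p \<in> P. lev p = n}. (2 * (1 / real b ^ n)) powr t)"
    proof (rule sum_mono)
      fix p assume p: "p \<in> {p \<in> P. lev p = n}"
      then have "0 < snd p" using P(3)[of "fst p" "snd p"] by auto
      then show "(2 * snd p) powr t \<le> (2 * (1 / real b ^ n)) powr t"
        using lev(2)[of p] p assms(2) by (intro powr_mono2) auto
    qed
    also have "\<dots> = card {p \<in> P. lev p = n} * (2 * (1 / real b ^ n)) powr t" by simp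
    also have "\<dots> \<le> (C * real b powr (s * real (Suc n))) * (2 * (1 / real b ^ n)) powr t"
      using cnt[of n] F[of "Suc n"] by (intro mult_right_mono) auto
    also have "(2 * (1 / real b ^ n)) powr t = 2 powr t * real b powr (- t * real n)"
      using bpow_pos by (simp add: powr_mult powr_realpow[symmetric] powr_minus_divide[symmetric]
          powr_powr mult.commute del: of_nat_Suc)
    also have "(C * real b powr (s * real (Suc n))) * (2 powr t * real b powr (- t * real n))
        = C * real b powr s * 2 powr t * q ^ n"
      using bpow_pos by (simp add: q_def powr_power powr_add[symmetric] algebra_simps)
    finally show "(\<Sum>p\<in>{p \<in> P. lev p = n}. (2 * snd p) powr t)
        \<le> C * real b powr s * 2 powr t * q ^ n" .
  qed
  also have "\<dots> = C * real b powr s * 2 powr t * (\<Sum>n\<in>lev ` P. q ^ n)"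
    by (simp add: sum_distrib_left)
  also have "\<dots> \<le> C * real b powr s * 2 powr t * (q ^ n0 / (1 - q))"
    using C q P(1) lev(3) by (intro mult_left_mono sum_geometric_tail_le) auto
  finally show ?thesis by (simp add: q_def)
qed

lemma packing_dim_tree_le:
  assumes "s \<ge> 0" and F: "\<And>n. F n \<le> C * real b powr (s * real n)"
  shows "packing_dim tree_set \<le> ereal s"
proof (rule dense_ge)
  fix z assume z: "ereal s < z"
  show "packing_dim tree_set \<le> z"
  proof (cases z)
    case (real t)
    then have t: "t > s" "t > 0" using z assms(1) by simp_all
    \<comment> \<open>Needed to pad the one-element cover of \<open>tree_set\<close> to a sequence:
      the packing premeasure of the set itself already bounds its packing measure.\<close>
    have empty: "packing_premeasure t ({} :: real set) \<le> 0"
      unfolding packing_premeasure_def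
    proof (rule INF_lower2[of 1])
      show "packing_sup t 1 ({} :: real set) \<le> 0"
        unfolding packing_sup_def
      proof (rule SUP_least, clarify)
        fix P :: "(real \<times> real) set" assume "\<forall>(x, r)\<in>P. x \<in> {} \<and> 0 < r \<and> r \<le> 1"
        then have "P = {}" by auto
        then show "(\<Sum>(x, r)\<in>P. ennreal ((2 * r) powr t)) \<le> 0" by simp
      qed
    qed simp
    define D where "D = C * real b powr s * 2 powr t / (1 - real b powr (s - t))"
    have "packing_premeasure t tree_set \<le> 0"
    proof (rule ennreal_le_epsilon)
      fix e :: real assume e: "e > 0"
      obtain N where N: "\<And>n. n \<ge> N \<Longrightarrow> D * real b powr (- (t - s) * real n) < e"
        using powr_decay[of "real b" "t - s" e D] bpow_pos t e by auto
      have "packing_premeasure t tree_set \<le> packing_sup t (1 / real b ^ N) tree_set"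
        unfolding packing_premeasure_def using bpow_pos by (intro INF_lower) auto
      also have "\<dots> \<le> ennreal e"
        unfolding packing_sup_def
      proof (rule SUP_least, clarify)
        fix P :: "(real \<times> real) set"
        assume P: "finite P" "\<forall>(x, r)\<in>P. x \<in> tree_set \<and> 0 < r \<and> r \<le> 1 / real b ^ N"
          "disjoint_family_on (\<lambda>(x, r). cball x r) P"
        have "(\<Sum>(x, r)\<in>P. (2 * r) powr t) \<le> D * (real b powr (s - t)) ^ N"
          using packing_sum_le[OF t F P(1,3), of N] P(2) by (auto simp: D_def)
        also have "\<dots> = D * real b powr (- (t - s) * real N)"
          using bpow_pos by (simp add: powr_power mult.commute)
        also have "\<dots> \<le> e" using N[of N] by simp
        finally have "ennreal (\<Sum>(x, r)\<in>P. (2 * r) powr t) \<le> ennreal e" by (rule ennreal_leI)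
        moreover have "(\<Sum>(x, r)\<in>P. ennreal ((2 * r) powr t)) = ennreal (\<Sum>(x, r)\<in>P. (2 * r) powr t)"
          by (simp add: case_prod_beta sum_ennreal)
        ultimately show "(\<Sum>(x, r)\<in>P. ennreal ((2 * r) powr t)) \<le> ennreal e" by simp
      qed
      finally show "packing_premeasure t tree_set \<le> 0 + ennreal e" by simp
    qed
    moreover have "packing_measure t tree_set
        \<le> (\<Sum>i. packing_premeasure t ((\<lambda>i. if i = 0 then tree_set else {}) (i :: nat)))"
      unfolding packing_measure_def by (rule INF_lower) auto
    ultimately have "packing_measure t tree_set \<le> (\<Sum>i::nat. 0)"
      using empty by (elim order_trans) (intro suminf_le, auto)
    then have "packing_measure t tree_set = 0" by simp
    then show ?thesis using real t unfolding packing_dim_def by (intro Inf_lower) auto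
  qed (use z in auto)
qed

text \<open>A set dense below \<open>w\<close> has a point in every cylinder below \<open>w\<close>.
  Those points on one deep level, suitably thinned out, are centres of disjoint balls, and the
  packing sum grows like \<open>b powr ((s - t) * n)\<close>.\<close>

lemma packing_premeasure_dense:
  assumes "s > t" "k > 0" and F: "\<And>N. \<exists>n\<ge>N. F n \<ge> k * real b powr (s * real n)"
    and "w \<in> T" and dense: "\<And>v. w @ v \<in> T \<Longrightarrow> A \<inter> cyl (w @ v) \<noteq> {}"
  shows "packing_premeasure t A = top"
proof -
  have "packing_sup t \<delta> A = top" if \<delta>: "\<delta> > 0" for \<delta>
  proof (rule ccontr)
    assume "packing_sup t \<delta> A \<noteq> top"
    then obtain M where M: "packing_sup t \<delta> A = ennreal M" "M \<ge> 0"
      by (cases "packing_sup t \<delta> A") auto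
    \<comment> \<open>The factor of \<open>b powr ((s - t) * n)\<close> in the packing sum:
      \<open>c / F (length w)\<close> is the share of level \<open>n\<close> below \<open>w\<close>,
      the 4 counts residue classes, and \<open>2 powr t\<close> comes from diameters in place of
      radii.\<close>
    define K where "K = c * k * 2 powr t / (4 * F (length w))"
    have K: "K > 0" using assms(2) c_pos F_pos[of "length w"] by (simp add: K_def)
    obtain N1 where N1: "\<And>n. n \<ge> N1 \<Longrightarrow> (M + 1) * real b powr (- (s - t) * real n) < K"
      using powr_decay[of "real b" "s - t" K "M + 1"] bpow_pos assms(1) K by auto
    obtain N2 where N2: "\<And>n. n \<ge> N2 \<Longrightarrow> 1 * real b powr (- 1 * real n) < \<delta>"
      using powr_decay[of "real b" 1 \<delta> 1] bpow_pos \<delta> by auto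
    obtain n where n: "n \<ge> N1 + N2 + length w" "F n \<ge> k * real b powr (s * real n)" using F by blast
    define V where "V = (\<lambda>v. w @ v) ` descendants T w (n - length w)"
    have VT: "v \<in> level T n" "\<exists>u. v = w @ u" "v \<in> T" if "v \<in> V" for v
      using that n by (auto simp: V_def level_def descendants_def)
    have fV: "finite V" using finite_descendants by (simp add: V_def)
    have cV: "card V \<ge> c * F n / F (length w)"
      using desc_ge[of w "length w" n] n assms(4)
      by (subst V_def, subst card_image) (auto simp: inj_on_def level_def)
    \<comment> \<open>By pigeonhole some residue class modulo 4 keeps a quarter of \<open>V\<close>.
      Inside it the values differ by at least 4, so points of two cylinders are at least
      \<open>3 / b ^ n\<close> apart, more than two radii.\<close>
    have "V = (\<Union>i<4. {v \<in> V. word_val b v mod 4 = i})" by auto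
    then have "card V \<le> (\<Sum>i<4. card {v \<in> V. word_val b v mod 4 = i})"
      using card_UN_le[of "{..<4::nat}" "\<lambda>i. {v \<in> V. word_val b v mod 4 = i}"] by simp
    moreover have "\<exists>i. card V \<le> 4 * card {v \<in> V. word_val b v mod 4 = i}"
    proof (rule ccontr)
      assume "\<nexists>i. card V \<le> 4 * card {v \<in> V. word_val b v mod 4 = i}"
      then have "4 * card {v \<in> V. word_val b v mod 4 = i} < card V" for i by (simp add: not_le)
      then have "(\<Sum>i<4. 4 * card {v \<in> V. word_val b v mod 4 = i}) < (\<Sum>i<(4::nat). card V)"
        by (intro sum_strict_mono) (auto simp: lessThan_empty_iff)
      then show False using calculation by (simp flip: sum_distrib_left)
    qed
    then obtain i where i: "card V \<le> 4 * card {v \<in> V. word_val b v mod 4 = i}" by blast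
    define W where "W = {v \<in> V. word_val b v mod 4 = i}"
    have "\<forall>v\<in>W. \<exists>x. x \<in> A \<inter> cyl v" using dense VT by (force simp: W_def)
    then obtain g where g: "\<And>v. v \<in> W \<Longrightarrow> g v \<in> A \<and> g v \<in> cyl v" by (metis IntD1 IntD2)
    have far: "\<bar>g v - g v'\<bar> * real b ^ n \<ge> 3" if "v \<in> W" "v' \<in> W" "v \<noteq> v'" for v v'
    proof -
      have l: "v \<in> level T n" "v' \<in> level T n" "length v = n" "length v' = n"
        using VT that by (auto simp: W_def level_def)
      have "word_val b v \<noteq> word_val b v'"
        using inj_onD[OF word_val_inj_level[of n]] l that(3) by blast
      moreover have "int (word_val b v) mod int 4 = int (word_val b v') mod int 4"
        using that by (simp only: W_def zmod_int[symmetric] mem_Collect_eq)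
      then have "4 dvd int (word_val b v) - int (word_val b v')" by (simp add: mod_eq_dvd_iff)
      ultimately have "\<bar>int (word_val b v) - int (word_val b v')\<bar> \<ge> 4"
        using dvd_imp_le_int[of "int (word_val b v) - int (word_val b v')" 4] by simp
      then have "\<bar>real (word_val b v) - real (word_val b v')\<bar> \<ge> 4" by linarith
      then have "\<bar>real b ^ n * g v - real b ^ n * g v'\<bar> \<ge> 3"
        using cyl_bounds[of "g v" v] cyl_bounds[of "g v'" v'] g[OF that(1)] g[OF that(2)]
        unfolding l by linarith
      moreover have "\<bar>real b ^ n * g v - real b ^ n * g v'\<bar> = \<bar>g v - g v'\<bar> * real b ^ n"
        by (simp add: abs_mult right_diff_distrib[symmetric])
      ultimately show ?thesis by simp
    qed
    have injg: "inj_on (\<lambda>v. (g v, 1 / real b ^ n)) W"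
    proof (rule inj_onI)
      fix v v' assume "v \<in> W" "v' \<in> W" "(g v, 1 / real b ^ n) = (g v', 1 / real b ^ n)"
      then show "v = v'" using far[of v v'] by auto
    qed
    define P where "P = (\<lambda>v. (g v, 1 / real b ^ n)) ` W"
    have "1 / real b ^ n \<le> \<delta>"
      using N2[of n] n(1) bpow_pos by (simp add: powr_minus_divide powr_realpow)
    moreover have "finite P" using fV by (simp add: P_def W_def)
    moreover have "disjoint_family_on (\<lambda>(x, r). cball x r) P"
      unfolding disjoint_family_on_def
    proof (intro ballI impI)
      fix p p' assume p: "p \<in> P" "p' \<in> P" "p \<noteq> p'"
      then obtain v v' where v: "v \<in> W" "v' \<in> W" "p = (g v, 1 / real b ^ n)" "p' = (g v', 1 / real b ^ n)"
        by (auto simp: P_def)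
      then have "\<bar>g v - g v'\<bar> * real b ^ n \<ge> 3" using far p by auto
      then have "\<bar>g v - g v'\<bar> \<ge> 3 * (1 / real b ^ n)" using bpow_pos(1)[of n] by (simp add: field_simps)
      moreover have "1 / real b ^ n > 0" using bpow_pos by simp
      ultimately have "\<not> (\<bar>g v - y\<bar> \<le> 1 / real b ^ n \<and> \<bar>g v' - y\<bar> \<le> 1 / real b ^ n)" for y
        by linarith
      then show "(case p of (x, r) \<Rightarrow> cball x r) \<inter> (case p' of (x, r) \<Rightarrow> cball x r) = {}"
        by (auto simp: v dist_real_def)
    qed
    ultimately have "(\<Sum>(x, r)\<in>P. ennreal ((2 * r) powr t)) \<le> packing_sup t \<delta> A"
      unfolding packing_sup_def using g bpow_pos by (intro SUP_upper) (auto simp: P_def)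
    also have "(\<Sum>(x, r)\<in>P. ennreal ((2 * r) powr t)) = (\<Sum>v\<in>W. ennreal ((2 * (1 / real b ^ n)) powr t))"
      unfolding P_def by (subst sum.reindex[OF injg]) simp
    also have "\<dots> = ennreal (card W * (2 * (1 / real b ^ n)) powr t)"
      by (simp add: ennreal_of_nat_eq_real_of_nat ennreal_mult')
    also have "(2 * (1 / real b ^ n)) powr t = 2 powr t * real b powr (- t * real n)"
      using bpow_pos by (simp add: powr_mult powr_realpow[symmetric] powr_minus_divide[symmetric]
          powr_powr mult.commute)
    finally have "card W * (2 powr t * real b powr (- t * real n)) \<le> M"
      using M by simp
    moreover have "K * real b powr ((s - t) * real n) \<le> card W * (2 powr t * real b powr (- t * real n))"
    proof -
      have "K * real b powr ((s - t) * real n)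
          = (c * (k * real b powr (s * real n)) / F (length w) / 4) * (2 powr t * real b powr (- t * real n))"
        unfolding K_def by (simp add: powr_add[symmetric] algebra_simps)
      also have "\<dots> \<le> (c * F n / F (length w) / 4) * (2 powr t * real b powr (- t * real n))"
        using n(2) c_pos by (intro mult_right_mono divide_right_mono mult_left_mono) auto
      also have "\<dots> \<le> card W * (2 powr t * real b powr (- t * real n))"
        using cV i by (intro mult_right_mono) (auto simp: W_def)
      finally show ?thesis .
    qed
    ultimately have "K * real b powr ((s - t) * real n) \<le> M" by linarith
    moreover have "M + 1 < K * real b powr ((s - t) * real n)"
    proof -
      have "(M + 1) * real b powr (- (s - t) * real n) * real b powr ((s - t) * real n)
          < K * real b powr ((s - t) * real n)"
        using N1[of n] n(1) bpow_pos by (intro mult_strict_right_mono) auto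
      moreover have "real b powr (- (s - t) * real n) * real b powr ((s - t) * real n) = 1"
        using b_ge2 by (simp add: powr_add[symmetric] flip: distrib_right)
      ultimately show ?thesis by (simp only: mult.assoc mult_1_right)
    qed
    ultimately show False by linarith
  qed
  then show ?thesis unfolding packing_premeasure_def by simp
qed

text \<open>The Baire category argument: if every \<open>A i\<close> has finite packing premeasure, then below each
  node there is a node whose cylinder misses \<open>A i\<close>.\<close>

lemma packing_dim_tree_ge:
  assumes "k > 0" and F: "\<And>N. \<exists>n\<ge>N. F n \<ge> k * real b powr (s * real n)"
  shows "ereal s \<le> packing_dim tree_set"
  unfolding packing_dim_def
proof (rule Inf_greatest, clarify)
  fix t assume t: "0 \<le> t" and zero: "packing_measure t tree_set = 0"
  have "s \<le> t"
  proof (rule ccontr)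
    assume "\<not> s \<le> t"
    then have st: "s > t" by simp
    have "packing_measure t tree_set < 1" using zero by simp
    then obtain A where A: "tree_set \<subseteq> (\<Union>i::nat. A i)" "(\<Sum>i. packing_premeasure t (A i)) < 1"
      unfolding packing_measure_def INF_less_iff by auto
    have fin: "packing_premeasure t (A i) \<noteq> top" for i
    proof -
      have "packing_premeasure t (A i) \<le> (\<Sum>i. packing_premeasure t (A i))"
        using sum_le_suminf[of "\<lambda>i. packing_premeasure t (A i)" "{i}"] by simp
      with A(2) have "packing_premeasure t (A i) < 1" by simp
      then show ?thesis by auto
    qed
    have avoid: "\<exists>v. v \<noteq> [] \<and> w @ v \<in> T \<and> A i \<inter> cyl (w @ v) = {}" if w: "w \<in> T" for i w
    proof -
      obtain v where v: "w @ v \<in> T" "A i \<inter> cyl (w @ v) = {}"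
        using packing_premeasure_dense[OF st assms(1) F w, of "A i"] fin by blast
      \<comment> \<open>\<open>v\<close> may be empty; one more digit makes the extension proper,
        and the smaller cylinder still misses \<open>A i\<close>.\<close>
      obtain x where "(w @ v) @ [x] \<in> T" using child[OF v(1)] by blast
      then show ?thesis using v cyl_append[of "w @ v" "[x]"] by (intro exI[of _ "v @ [x]"]) auto
    qed
    define Q where "Q i w \<longleftrightarrow> (\<forall>j<i. A j \<inter> cyl w = {})" for i :: nat and w
    obtain d l where d: "d \<in> branches" "\<And>i. Q i (map d [0..<l i])"
    proof (rule chain_branch[of "[]" Q])
      show "[] \<in> T" by (rule Nil_in)
      show "Q 0 []" by (simp add: Q_def)
      fix i w assume w: "w \<in> T" "Q i w"
      obtain v where v: "v \<noteq> []" "w @ v \<in> T" "A i \<inter> cyl (w @ v) = {}" using avoid[OF w(1)] by blast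
      have "Q (Suc i) (w @ v)"
        using w(2) v(3) cyl_append[of w v] by (auto simp: Q_def less_Suc_eq)
      with v show "\<exists>v. v \<noteq> [] \<and> w @ v \<in> T \<and> Q (Suc i) (w @ v)" by blast
    next
      fix d l assume "d \<in> branches" "\<And>i. Q i (map d [0..<l i])"
      then show thesis by (rule that)
    qed
    have "digit_val b d \<in> tree_set" using d(1) by (auto simp: tree_set_def)
    then obtain i where i: "digit_val b d \<in> A i" using A(1) by blast
    have "digit_val b d \<in> cyl (map d [0..<l (Suc i)])" using d(1) by (auto simp: cyl_def)
    with i d(2)[of "Suc i"] show False by (auto simp: Q_def)
  qed
  then show "ereal s \<le> ereal t" by simp
qed

end

section \<open>Assouad and lower dimension\<close>

lemma covering_number_le:
  assumes "finite C" "A \<subseteq> (\<Union>c\<in>C. cball c (r / 2))"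
  shows "covering_number r A \<le> card C"
  unfolding covering_number_def using assms by (intro Least_le) blast

context digit_tree
begin

abbreviation N_cov :: "real \<Rightarrow> real \<Rightarrow> real \<Rightarrow> nat" where
  "N_cov r R x \<equiv> covering_number r (cball x R \<inter> tree_set)"

text \<open>The midpoint of the \<open>b\<close>-adic interval of \<open>u\<close>.\<close>

definition centre :: "nat list \<Rightarrow> real" where
  "centre u = (real (word_val b u) + 1 / 2) / real b ^ length u"

lemma cyl_subset_cball:
  assumes "1 / real b ^ length u \<le> r"
  shows "cyl u \<subseteq> cball (centre u) (r / 2)"
proof
  fix y assume y: "y \<in> cyl u"
  have e: "centre u * real b ^ length u = real (word_val b u) + 1 / 2"
    using bpow_pos(1)[of "length u"] by (simp add: centre_def)
  have "\<bar>centre u - y\<bar> * real b ^ length u = \<bar>centre u * real b ^ length u - real b ^ length u * y\<bar>"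
    by (simp add: abs_mult left_diff_distrib[symmetric] mult.commute[of _ y])
  also have "\<dots> \<le> 1 / 2" unfolding e using cyl_bounds[OF y] by linarith
  finally have "\<bar>centre u - y\<bar> \<le> (1 / real b ^ length u) / 2"
    using bpow_pos(1)[of "length u"] by (simp add: field_simps)
  with assms show "y \<in> cball (centre u) (r / 2)" by (simp add: dist_real_def)
qed

text \<open>A ball of radius \<open>R\<close> has diameter at most \<open>2 / b ^ n\<close> and
  meets at most \<open>2 * 2 + 3\<close> cylinders of level \<open>n\<close>; homogeneity bounds the
  nodes of level \<open>N\<close> below each of them.\<close>

lemma covering_number_tree_le:
  assumes "R \<le> 1 / real b ^ n" "1 / real b ^ N \<le> r" "n \<le> N"
  shows "N_cov r R x \<le> 7 / c * (real (F N) / F n)"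
proof -
  define S where "S = {w \<in> level T n. cyl w \<inter> cball x R \<noteq> {}}"
  define V where "V = {u \<in> level T N. take n u \<in> S}"
  have "card S \<le> 2 * 2 + 3"
    unfolding S_def
  proof (rule card_meeting_cyl)
    fix y z assume "y \<in> cball x R" "z \<in> cball x R"
    then have "\<bar>y - z\<bar> \<le> 2 * R" by (simp add: dist_real_def)
    then show "\<bar>y - z\<bar> \<le> real 2 / real b ^ n" using assms(1) by simp
  qed
  then have S: "S \<subseteq> level T n" "card S \<le> 7" by (auto simp: S_def)
  have fV: "finite V" using finite_level by (simp add: V_def)
  have "cball x R \<inter> tree_set \<subseteq> (\<Union>a\<in>centre ` V. cball a (r / 2))"
  proof
    fix y assume y: "y \<in> cball x R \<inter> tree_set"
    then obtain u where u: "u \<in> level T N" "y \<in> cyl u" using tree_set_cyl by blast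
    then have lu: "u \<in> T" "length u = N" by (auto simp: level_def)
    have "cyl u \<subseteq> cyl (take n u)" using cyl_append[of "take n u" "drop n u"] by simp
    then have "take n u \<in> S"
      using u y lu take_in[of u n] assms(3) by (auto simp: S_def level_def)
    then have "u \<in> V" using u by (simp add: V_def)
    moreover have "y \<in> cball (centre u) (r / 2)"
      using cyl_subset_cball[of u r] u lu assms(2) by auto
    ultimately show "y \<in> (\<Union>a\<in>centre ` V. cball a (r / 2))" by blast
  qed
  then have "N_cov r R x \<le> card (centre ` V)"
    using fV by (intro covering_number_le) auto
  also have "\<dots> \<le> card V" using fV by (rule card_image_le)
  finally have "real (N_cov r R x) \<le> real (card V)" by simp
  also have "\<dots> \<le> card S * (real (F N) / (c * F n))"
    unfolding V_def by (rule card_extensions_le[OF S(1) assms(3)])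
  also have "\<dots> \<le> 7 * (real (F N) / (c * F n))"
    using S(2) c_pos by (intro mult_right_mono) auto
  finally show ?thesis by simp
qed

text \<open>A \<open>LEAST\<close> says something only once a witness exists; the midpoints of a
  deep level provide a finite cover.\<close>

lemma covering_number_attained:
  assumes "r > 0" "A \<subseteq> tree_set"
  obtains C where "finite C" "card C = covering_number r A" "A \<subseteq> (\<Union>c\<in>C. cball c (r / 2))"
proof -
  obtain N where N: "(1 / real b) ^ N < r"
    using real_arch_pow_inv[of r "1 / real b"] assms bpow_pos by auto
  have "A \<subseteq> (\<Union>a\<in>centre ` level T N. cball a (r / 2))"
  proof
    fix y assume "y \<in> A"
    then obtain u where u: "u \<in> level T N" "y \<in> cyl u" using tree_set_cyl assms(2) by blast
    then have "y \<in> cball (centre u) (r / 2)"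
      using cyl_subset_cball[of u r] N by (auto simp: level_def power_divide)
    then show "y \<in> (\<Union>a\<in>centre ` level T N. cball a (r / 2))" using u by blast
  qed
  then have "\<exists>C. finite C \<and> card C = card (centre ` level T N)
      \<and> A \<subseteq> (\<Union>c\<in>C. cball c (r / 2))"
    using finite_level by (intro exI[of _ "centre ` level T N"]) auto
  then have "\<exists>C. finite C \<and> card C = covering_number r A \<and> A \<subseteq> (\<Union>c\<in>C. cball c (r / 2))"
    unfolding covering_number_def by (rule LeastI)
  then show ?thesis using that by auto
qed

lemma covering_number_tree_ge_1:
  assumes "r > 0" "R \<ge> 0" "x \<in> tree_set"
  shows "N_cov r R x \<ge> 1"
proof -
  obtain C where C: "finite C" "card C = N_cov r R x"
    "cball x R \<inter> tree_set \<subseteq> (\<Union>c\<in>C. cball c (r / 2))"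
    using covering_number_attained[of r "cball x R \<inter> tree_set"] assms by blast
  have "x \<in> cball x R \<inter> tree_set" using assms by simp
  then have "C \<noteq> {}" using C(3) by blast
  with C(1,2) show ?thesis by (metis One_nat_def Suc_leI card_gt_0_iff)
qed

text \<open>The ball around \<open>x\<close> contains the whole level \<open>n\<close> cylinder of
  \<open>x\<close>, and one covering ball of diameter \<open>r\<close> meets at most five cylinders
  of level \<open>N\<close>.\<close>

lemma covering_number_tree_ge:
  assumes "x \<in> tree_set" "1 / real b ^ n \<le> R" "0 < r" "r \<le> 1 / real b ^ N" "n \<le> N"
  shows "c / 5 * (real (F N) / F n) \<le> N_cov r R x"
proof -
  obtain C where C: "finite C" "card C = N_cov r R x"
    "cball x R \<inter> tree_set \<subseteq> (\<Union>c\<in>C. cball c (r / 2))"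
    using covering_number_attained[of r "cball x R \<inter> tree_set"] assms(3) by blast
  obtain w where w: "w \<in> level T n" "x \<in> cyl w" using tree_set_cyl[OF assms(1)] by blast
  have lw: "w \<in> T" "length w = n" using w by (auto simp: level_def)
  define D where "D = descendants T w (N - n)"
  define M where "M a = {v \<in> level T N. cyl v \<inter> cball a (r / 2) \<noteq> {}}" for a
  have "(\<lambda>u. w @ u) ` D \<subseteq> (\<Union>a\<in>C. M a)"
  proof clarify
    fix u assume "u \<in> D"
    then have u: "w @ u \<in> level T N" using lw assms(5) by (auto simp: D_def descendants_def level_def)
    then obtain y where y: "y \<in> cyl (w @ u)" using cyl_nonempty[of "w @ u"] by (auto simp: level_def)
    then have "y \<in> cyl w" using cyl_append by blast
    then have "\<bar>x - y\<bar> \<le> 1 / real b ^ n" using cyl_dist[OF w(2)] lw by simp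
    then have "y \<in> cball x R \<inter> tree_set" using y cyl_subset assms(2) by (auto simp: dist_real_def)
    then obtain a where a: "a \<in> C" "y \<in> cball a (r / 2)" using C(3) by blast
    then have "cyl (w @ u) \<inter> cball a (r / 2) \<noteq> {}" using y by blast
    with a show "w @ u \<in> (\<Union>a\<in>C. M a)" using u by (auto simp: M_def)
  qed
  then have "card ((\<lambda>u. w @ u) ` D) \<le> card (\<Union>a\<in>C. M a)"
    by (rule card_mono[rotated]) (use C(1) finite_level in \<open>auto simp: M_def\<close>)
  also have "\<dots> \<le> (\<Sum>a\<in>C. card (M a))" by (rule card_UN_le[OF C(1)])
  also have "\<dots> \<le> (\<Sum>a\<in>C. 5)"
  proof (rule sum_mono)
    fix a
    have "card (M a) \<le> 2 * 1 + 3"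
      unfolding M_def
    proof (rule card_meeting_cyl)
      fix y z assume "y \<in> cball a (r / 2)" "z \<in> cball a (r / 2)"
      then have "\<bar>y - z\<bar> \<le> r" unfolding mem_cball dist_real_def by linarith
      then show "\<bar>y - z\<bar> \<le> real 1 / real b ^ N" using assms(4) by simp
    qed
    then show "card (M a) \<le> 5" by simp
  qed
  also have "card ((\<lambda>u. w @ u) ` D) = card D" by (intro card_image) (auto simp: inj_on_def)
  finally have "real (card D) \<le> 5 * real (card C)" by simp
  moreover have "c * real (F N) / F n \<le> card D" unfolding D_def by (rule desc_ge[OF w(1) assms(5)])
  ultimately show ?thesis using C(2) by simp
qed

lemma scale_ratio:
  assumes "1 / real b ^ Suc n < R" "R \<le> 1 / real b ^ n" "1 / real b ^ Suc N < r" "r \<le> 1 / real b ^ N"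
  shows "R / r \<le> real b powr (real N - real n + 1)" "real b powr (real N - real n - 1) \<le> R / r"
proof -
  have pos: "R > 0" "r > 0" using assms(1,3) bpow_pos
    by (meson less_trans zero_less_divide_1_iff)+
  have p: "real b powr (real N - real n + 1) = real b ^ Suc N / real b ^ n"
    "real b powr (real N - real n - 1) = real b ^ N / real b ^ Suc n"
    using bpow_pos by (simp_all add: powr_diff powr_add powr_realpow)
  have "R * real b ^ n \<le> 1" "1 \<le> r * real b ^ Suc N" "1 \<le> R * real b ^ Suc n" "r * real b ^ N \<le> 1"
    using assms bpow_pos(1)[of n] bpow_pos(1)[of "Suc n"] bpow_pos(1)[of N] bpow_pos(1)[of "Suc N"]
    by (simp_all add: field_simps del: power_Suc)
  then have "R * real b ^ n \<le> r * real b ^ Suc N" "r * real b ^ N \<le> R * real b ^ Suc n" by linarith+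
  then show "R / r \<le> real b powr (real N - real n + 1)" "real b powr (real N - real n - 1) \<le> R / r"
    unfolding p using pos bpow_pos(1)[of n] bpow_pos(1)[of "Suc n"]
    by (simp_all add: field_simps del: power_Suc)
qed

lemma assouad_dim_tree_le:
  assumes "s \<ge> 0" and F: "\<And>n j. F (n + j) \<le> C * real b powr (s * real j) * F n"
  shows "assouad_dim tree_set \<le> ereal s"
  unfolding assouad_dim_def
proof (rule Inf_lower, clarify)
  have "1 \<le> C"
    using F[of 0 0] F_pos[of 0] b_ge2 by simp
  \<comment> \<open>Rounding both radii costs two levels: the count is made over
    \<open>Suc N - n\<close> levels, while \<open>R / r\<close> is only known to be at least
    \<open>b powr (N - n - 1)\<close>. Hence \<open>2 * s\<close>.\<close>
  define K where "K = 7 / c * C * real b powr (2 * s)"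
  have K: "K > 0" using \<open>1 \<le> C\<close> c_pos bpow_pos by (simp add: K_def)
  have "(SUP x\<in>tree_set. ereal (real (N_cov r R x)))
      \<le> ereal (K * (R / r) powr s)" if r: "0 < r" "r < R" "R < 1" for r R
  proof (rule SUP_least)
    fix x
    obtain n where n: "1 / real b ^ Suc n < R" "R \<le> 1 / real b ^ n"
      using scale_of[of R] r by auto
    obtain N where N: "1 / real b ^ Suc N < r" "r \<le> 1 / real b ^ N"
      "\<forall>m. r \<le> 1 / real b ^ m \<longrightarrow> m \<le> N"
      using scale_of[of r] r by auto
    have nN: "n \<le> N" using N(3) n(2) r by simp
    have "real (N_cov r R x) \<le> 7 / c * (real (F (Suc N)) / F n)"
      using n N nN by (intro covering_number_tree_le) auto
    also have "\<dots> \<le> 7 / c * (C * real b powr (s * real (Suc N - n)))"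
    proof (rule mult_left_mono)
      show "real (F (Suc N)) / F n \<le> C * real b powr (s * real (Suc N - n))"
        using F[of n "Suc N - n"] nN F_pos[of n] by (simp add: pos_divide_le_eq)
    qed (use c_pos in auto)
    also have "real b powr (s * real (Suc N - n))
        = real b powr (2 * s) * (real b powr (real N - real n - 1)) powr s"
      using nN by (simp add: powr_powr powr_add[symmetric] of_nat_diff algebra_simps)
    also have "7 / c * (C * \<dots>) \<le> K * (R / r) powr s"
      unfolding K_def mult.assoc
      using scale_ratio(2)[OF n N(1,2)] assms(1) \<open>1 \<le> C\<close> c_pos
      by (intro mult_left_mono powr_mono2) auto
    finally show "ereal (real (N_cov r R x))
        \<le> ereal (K * (R / r) powr s)" by simp
  qed
  then show "\<exists>sa. ereal s = ereal sa \<and> 0 \<le> sa \<and> (\<exists>C>0. \<exists>\<rho>>0. \<forall>r R. 0 < r \<and> r < R \<and> R < \<rho> \<longrightarrow>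
      (SUP x\<in>tree_set. ereal (real (N_cov r R x)))
         \<le> ereal (C * (R / r) powr sa))"
    using assms(1) K by (intro exI[of _ s] conjI exI[of _ K] exI[of _ "1::real"]) auto
qed

lemma lower_dim_tree_ge:
  assumes "s \<ge> 0" "k > 0" and F: "\<And>n j. F (n + j) \<ge> k * real b powr (s * real j) * F n"
  shows "ereal s \<le> lower_dim tree_set"
  unfolding lower_dim_def
proof (rule Sup_upper, clarify)
  \<comment> \<open>The first term serves scales at least one level apart, where rounding again
    costs two levels; the second serves \<open>N = n\<close>, where the covering number is merely
    bounded below by 1.\<close>
  define K where "K = min (c / 5 * k * real b powr (- 2 * s)) (real b powr (- s))"
  have K: "K > 0" using assms(2) c_pos bpow_pos by (simp add: K_def)
  have "ereal (K * (R / r) powr s)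
      \<le> (INF x\<in>tree_set. ereal (real (N_cov r R x)))"
    if r: "0 < r" "r < R" "R < 1" for r R
  proof (rule INF_greatest)
    fix x assume x: "x \<in> tree_set"
    obtain n where n: "1 / real b ^ Suc n < R" "R \<le> 1 / real b ^ n"
      using scale_of[of R] r by auto
    obtain N where N: "1 / real b ^ Suc N < r" "r \<le> 1 / real b ^ N"
      "\<forall>m. r \<le> 1 / real b ^ m \<longrightarrow> m \<le> N"
      using scale_of[of r] r by auto
    have nN: "n \<le> N" using N(3) n(2) r by simp
    have R: "(R / r) powr s \<le> (real b powr (real N - real n + 1)) powr s"
      using scale_ratio(1)[OF n N(1,2)] r assms(1) by (intro powr_mono2) auto
    show "ereal (K * (R / r) powr s) \<le> ereal (real (N_cov r R x))"
    proof (cases "Suc n \<le> N")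
      case True
      have "K * (R / r) powr s \<le> c / 5 * k * real b powr (- 2 * s) * (real b powr (real N - real n + 1)) powr s"
        using R K by (intro mult_mono) (auto simp: K_def)
      also have "\<dots> = c / 5 * (k * (real b powr (- 2 * s) * (real b powr (real N - real n + 1)) powr s))"
        by simp
      also have "real b powr (- 2 * s) * (real b powr (real N - real n + 1)) powr s
          = real b powr (s * real (N - Suc n))"
        using True by (simp add: powr_powr powr_add[symmetric] of_nat_diff algebra_simps)
      also have "c / 5 * (k * \<dots>) \<le> c / 5 * (real (F N) / F (Suc n))"
        using F[where n = "Suc n" and j = "N - Suc n"] True F_pos[of "Suc n"] c_pos
        by (intro mult_left_mono) (auto simp: pos_le_divide_eq)
      also have "\<dots> \<le> real (N_cov r R x)"
        using n N True x r by (intro covering_number_tree_ge) auto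
      finally show ?thesis by simp
    next
      case False
      then have "N = n" using nN by simp
      have "K * (R / r) powr s \<le> real b powr (- s) * (real b powr (real N - real n + 1)) powr s"
        using R K by (intro mult_mono) (auto simp: K_def)
      also have "\<dots> = 1" using \<open>N = n\<close> bpow_pos by (simp add: powr_add[symmetric])
      also have "1 \<le> real (N_cov r R x)"
        using covering_number_tree_ge_1[of r R x] r x by simp
      finally show ?thesis by simp
    qed
  qed
  then show "\<exists>sa. ereal s = ereal sa \<and> 0 \<le> sa \<and> (\<exists>C>0. \<exists>\<rho>>0. \<forall>r R. 0 < r \<and> r < R \<and> R < \<rho> \<longrightarrow>
      ereal (C * (R / r) powr sa)
         \<le> (INF x\<in>tree_set. ereal (real (N_cov r R x))))"
    using assms(1) K by (intro exI[of _ s] conjI exI[of _ K] exI[of _ "1::real"]) auto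
qed

section \<open>From admissible exponents back to the growth of the tree\<close>

lemma power_scale:
  assumes "j \<noteq> 0"
  shows "0 < 1 / real b ^ (n + j)" "1 / real b ^ (n + j) < 1 / real b ^ n"
    "((1 / real b ^ n) / (1 / real b ^ (n + j))) powr s = real b powr (s * real j)"
proof -
  have "real b ^ n < real b ^ (n + j)" using assms bpow_pos by (intro power_strict_increasing) auto
  then show "0 < 1 / real b ^ (n + j)" "1 / real b ^ (n + j) < 1 / real b ^ n"
    using bpow_pos by (auto simp: frac_less2)
  have "(1 / real b ^ n) / (1 / real b ^ (n + j)) = real b powr real j"
    using bpow_pos by (simp add: power_add powr_realpow)
  then show "((1 / real b ^ n) / (1 / real b ^ (n + j))) powr s = real b powr (s * real j)"
    by (simp add: powr_powr mult.commute)
qed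

lemma eventually_small_scale:
  assumes "\<rho> > 0"
  obtains n0 where "\<And>n. n \<ge> n0 \<Longrightarrow> 1 / real b ^ n < \<rho>"
proof -
  obtain N where "\<And>n. n \<ge> N \<Longrightarrow> 1 * real b powr (- 1 * real n) < \<rho>"
    using powr_decay[of "real b" 1 \<rho> 1] bpow_pos assms by auto
  then show ?thesis using that[of N] bpow_pos by (simp add: powr_minus_divide powr_realpow)
qed

text \<open>Testing an admissible exponent at radii that are powers of \<open>b\<close> turns
  covering numbers back into quotients of level sizes. The restriction \<open>R < \<rho>\<close> is
  the reason for the threshold \<open>n0\<close>.\<close>

lemma assouad_growth:
  assumes "\<rho> > 0"
    and adm: "\<And>r R. 0 < r \<Longrightarrow> r < R \<Longrightarrow> R < \<rho> \<Longrightarrow>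
      (SUP x\<in>tree_set. ereal (real (N_cov r R x)))
         \<le> ereal (C * (R / r) powr s)"
  shows "\<exists>K n0. K > 0 \<and> (\<forall>n j. n \<ge> n0 \<longrightarrow> F (n + j) \<le> K * real b powr (s * real j) * F n)"
proof -
  obtain n0 where n0: "\<And>n. n \<ge> n0 \<Longrightarrow> 1 / real b ^ n < \<rho>"
    using eventually_small_scale[OF assms(1)] by blast
  \<comment> \<open>The 1 takes care of \<open>j = 0\<close>, where the two radii would
    coincide.\<close>
  define K where "K = max 1 (5 / c * C)"
  have "F (n + j) \<le> K * real b powr (s * real j) * F n" if n: "n \<ge> n0" for n j
  proof (cases "j = 0")
    case True
    have "1 * real (F n) \<le> K * real (F n)" by (rule mult_right_mono) (auto simp: K_def)
    then show ?thesis using True b_ge2 by simp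
  next
    case False
    obtain x where x: "x \<in> tree_set" using tree_set_nonempty by blast
    define R where "R = 1 / real b ^ n"
    define r where "r = 1 / real b ^ (n + j)"
    have rR: "0 < r" "r < R" and pw: "(R / r) powr s = real b powr (s * real j)"
      using power_scale[of j n] False by (auto simp: r_def R_def)
    have "c / 5 * (real (F (n + j)) / F n) \<le> real (N_cov r R x)"
      using x rR(1) by (intro covering_number_tree_ge) (auto simp: R_def r_def)
    also have "ereal \<dots> \<le> (SUP x\<in>tree_set. ereal (real (N_cov r R x)))"
      using x by (rule SUP_upper)
    also have "\<dots> \<le> ereal (C * (R / r) powr s)"
      by (rule adm) (use rR n0[OF n] in \<open>auto simp: R_def\<close>)
    finally have "c / 5 * (real (F (n + j)) / F n) \<le> C * (R / r) powr s" by simp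
    then have "c / 5 * (real (F (n + j)) / F n) \<le> C * real b powr (s * real j)" by (simp only: pw)
    then have "real (F (n + j)) \<le> (5 / c * C) * real b powr (s * real j) * F n"
      using c_pos F_pos[of n] by (simp add: field_simps)
    also have "\<dots> \<le> K * real b powr (s * real j) * F n"
      by (intro mult_right_mono) (auto simp: K_def)
    finally show ?thesis .
  qed
  then show ?thesis by (intro exI[of _ K] exI[of _ n0]) (auto simp: K_def)
qed

lemma lower_growth:
  assumes "\<rho> > 0" "C > 0"
    and adm: "\<And>r R. 0 < r \<Longrightarrow> r < R \<Longrightarrow> R < \<rho> \<Longrightarrow> ereal (C * (R / r) powr s)
         \<le> (INF x\<in>tree_set. ereal (real (N_cov r R x)))"
  shows "\<exists>K n0. K > 0 \<and> (\<forall>n j. n \<ge> n0 \<longrightarrow> F (n + j) \<ge> K * real b powr (s * real j) * F n)"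
proof -
  obtain n0 where n0: "\<And>n. n \<ge> n0 \<Longrightarrow> 1 / real b ^ n < \<rho>"
    using eventually_small_scale[OF assms(1)] by blast
  define K where "K = min 1 (c / 7 * C)"
  have "F (n + j) \<ge> K * real b powr (s * real j) * F n" if n: "n \<ge> n0" for n j
  proof (cases "j = 0")
    case True
    have "K * real (F n) \<le> 1 * real (F n)" by (rule mult_right_mono) (auto simp: K_def)
    then show ?thesis using True b_ge2 by simp
  next
    case False
    obtain x where x: "x \<in> tree_set" using tree_set_nonempty by blast
    define R where "R = 1 / real b ^ n"
    define r where "r = 1 / real b ^ (n + j)"
    have rR: "0 < r" "r < R" and pw: "(R / r) powr s = real b powr (s * real j)"
      using power_scale[of j n] False by (auto simp: r_def R_def)
    have "ereal (C * (R / r) powr s)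
        \<le> (INF x\<in>tree_set. ereal (real (N_cov r R x)))"
      by (rule adm) (use rR n0[OF n] in \<open>auto simp: R_def\<close>)
    also have "\<dots> \<le> ereal (real (N_cov r R x))"
      using x by (rule INF_lower)
    also have "\<dots> \<le> ereal (7 / c * (real (F (n + j)) / F n))"
      unfolding ereal_less_eq by (rule covering_number_tree_le) (auto simp: R_def r_def)
    finally have "C * (R / r) powr s \<le> 7 / c * (real (F (n + j)) / F n)" by simp
    then have "C * real b powr (s * real j) \<le> 7 / c * (real (F (n + j)) / F n)" by (simp only: pw)
    then have "(c / 7 * C) * real b powr (s * real j) * F n \<le> real (F (n + j))"
      using c_pos F_pos[of n] by (simp add: field_simps)
    moreover have "K * real b powr (s * real j) * F n \<le> (c / 7 * C) * real b powr (s * real j) * F n"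
      by (intro mult_right_mono) (auto simp: K_def)
    ultimately show ?thesis by linarith
  qed
  then show ?thesis using c_pos assms(2) by (intro exI[of _ K] exI[of _ n0]) (auto simp: K_def)
qed

lemma assouad_admissible_growth:
  assumes "assouad_dim tree_set < ereal u"
  shows "\<exists>s K n0. 0 \<le> s \<and> s < u \<and> K > 0
    \<and> (\<forall>n j. n \<ge> n0 \<longrightarrow> F (n + j) \<le> K * real b powr (s * real j) * F n)"
proof -
  obtain s C \<rho> where s: "s < u" "0 \<le> s" "\<rho> > 0" and
    adm: "\<forall>r R. 0 < r \<and> r < R \<and> R < \<rho> \<longrightarrow>
      (SUP x\<in>tree_set. ereal (real (N_cov r R x)))
         \<le> ereal (C * (R / r) powr s)"
    using assms unfolding assouad_dim_def Inf_less_iff by auto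
  have "\<exists>K n0. K > 0 \<and> (\<forall>n j. n \<ge> n0 \<longrightarrow> F (n + j) \<le> K * real b powr (s * real j) * F n)"
    by (rule assouad_growth[OF s(3), of C s]) (use adm in auto)
  with s show ?thesis by blast
qed

lemma lower_admissible_growth:
  assumes "ereal u < lower_dim tree_set"
  shows "\<exists>s K n0. 0 \<le> s \<and> u < s \<and> K > 0
    \<and> (\<forall>n j. n \<ge> n0 \<longrightarrow> F (n + j) \<ge> K * real b powr (s * real j) * F n)"
proof -
  obtain s C \<rho> where s: "u < s" "0 \<le> s" "\<rho> > 0" "C > 0" and
    adm: "\<forall>r R. 0 < r \<and> r < R \<and> R < \<rho> \<longrightarrow> ereal (C * (R / r) powr s)
      \<le> (INF x\<in>tree_set. ereal (real (N_cov r R x)))"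
    using assms unfolding lower_dim_def less_Sup_iff by auto
  have "\<exists>K n0. K > 0 \<and> (\<forall>n j. n \<ge> n0 \<longrightarrow> F (n + j) \<ge> K * real b powr (s * real j) * F n)"
    by (rule lower_growth[OF s(3,4), of s]) (use adm in auto)
  with s show ?thesis by blast
qed

section \<open>Comparison of the dimensions\<close>

lemma le_ereal_dense: "(\<And>u. x < ereal u \<Longrightarrow> y \<le> ereal u) \<Longrightarrow> y \<le> (x :: ereal)"
proof (rule dense_ge)
  fix z assume *: "\<And>u. x < ereal u \<Longrightarrow> y \<le> ereal u" "x < z"
  obtain u where "x < ereal u" "ereal u < z" using ereal_dense2[OF *(2)] by blast
  with *(1)[of u] show "y \<le> z" by simp
qed

text \<open>Growth that is uniform over all starting levels \<open>n \<ge> n0\<close> is in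
  particular growth from the fixed level \<open>n0\<close>, as the Hausdorff bound demands.\<close>

lemma lower_dim_le_hausdorff_dim: "lower_dim tree_set \<le> dim_H tree_set"
proof (rule ccontr)
  assume "\<not> ?thesis"
  then obtain u where u: "dim_H tree_set < ereal u"
      "ereal u < lower_dim tree_set"
    using ereal_dense2 not_le by metis
  obtain s K n0 where s: "0 \<le> s" "u < s" "K > 0"
    "\<And>n j. n \<ge> n0 \<Longrightarrow> F (n + j) \<ge> K * real b powr (s * real j) * F n"
    using lower_admissible_growth[OF u(2)] by blast
  \<comment> \<open>Small enough that the bound also holds at the levels before \<open>n0\<close>,
    where only \<open>F n \<ge> 1\<close> is available.\<close>
  define k where "k = min 1 K * real b powr (- s * real n0)"
  have "F n \<ge> k * real b powr (s * real n)" for n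
  proof (cases "n \<ge> n0")
    case True
    have "k * real b powr (s * real n) = min 1 K * real b powr (s * real (n - n0)) * 1"
      using True by (simp add: k_def powr_add[symmetric] of_nat_diff algebra_simps)
    also have "\<dots> \<le> K * real b powr (s * real (n - n0)) * F n0"
      using F_pos[of n0] s(3) by (intro mult_mono) auto
    also have "\<dots> \<le> F n" using s(4)[of n0 "n - n0"] True by simp
    finally show ?thesis .
  next
    case False
    have "k * real b powr (s * real n) = min 1 K * real b powr (s * (real n - real n0))"
      by (simp add: k_def powr_add[symmetric] algebra_simps)
    also have "\<dots> \<le> 1 * 1"
    proof (rule mult_mono)
      have "s * (real n - real n0) \<le> 0" using False s(1) by (simp add: mult_nonneg_nonpos)
      then show "real b powr (s * (real n - real n0)) \<le> 1"
        using bpow_pos powr_mono[of "s * (real n - real n0)" 0 "real b"] by simp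
    qed auto
    also have "\<dots> \<le> F n" using F_pos[of n] by simp
    finally show ?thesis .
  qed
  then have "ereal s \<le> dim_H tree_set"
    using s(3) bpow_pos by (intro hausdorff_dim_tree_ge[of k]) (auto simp: k_def)
  with u(1) s(2) show False by (metis ereal_less_eq(3) leD le_less_trans less_imp_le)
qed

text \<open>Above the packing dimension, \<open>F n\<close> eventually stays below
  \<open>b powr (u * n)\<close>, by the contrapositive of \<open>packing_dim_tree_ge\<close>; the
  Hausdorff bound asks for this only at infinitely many levels. So no comparison of the two measures
  enters.\<close>

lemma hausdorff_dim_le_packing_dim: "dim_H tree_set \<le> packing_dim tree_set"
proof (rule le_ereal_dense)
  fix u assume u: "packing_dim tree_set < ereal u"
  have "0 \<le> packing_dim tree_set" unfolding packing_dim_def by (rule Inf_greatest) auto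
  then have "u \<ge> 0" using u by (metis ereal_less_eq(5) le_less_trans less_imp_le)
  have "\<exists>N. \<forall>n\<ge>N. F n < 1 * real b powr (u * real n)"
  proof (rule ccontr)
    assume "\<not> ?thesis"
    then have "ereal u \<le> packing_dim tree_set"
      by (intro packing_dim_tree_ge[of 1]) (auto simp: not_less)
    with u show False by simp
  qed
  then obtain N where N: "\<And>n. n \<ge> N \<Longrightarrow> F n < 1 * real b powr (u * real n)" by blast
  show "dim_H tree_set \<le> ereal u"
  proof (rule hausdorff_dim_tree_le[OF \<open>u \<ge> 0\<close>])
    fix M show "\<exists>n\<ge>M. F n \<le> 1 * real b powr (u * real n)"
      using N[of "M + N"] by (intro exI[of _ "M + N"]) auto
  qed
qed

lemma packing_dim_le_assouad_dim: "packing_dim tree_set \<le> assouad_dim tree_set"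
proof (rule le_ereal_dense)
  fix u assume "assouad_dim tree_set < ereal u"
  then obtain s K n0 where s: "0 \<le> s" "s < u" "K > 0"
    "\<And>n j. n \<ge> n0 \<Longrightarrow> F (n + j) \<le> K * real b powr (s * real j) * F n"
    using assouad_admissible_growth by blast
  define C where "C = max (K * F n0) (Max (F ` {..n0}))"
  have "F n \<le> C * real b powr (s * real n)" for n
  proof (cases "n \<ge> n0")
    case True
    have "F n \<le> K * F n0 * real b powr (s * real (n - n0))" using s(4)[of n0 "n - n0"] True
      by (simp add: mult_ac)
    also have "\<dots> \<le> C * real b powr (s * real n)"
      using s bpow_pos by (intro mult_mono powr_mono) (auto simp: C_def mult_left_mono le_max_iff_disj)
    finally show ?thesis .
  next
    case False
    then have "F n \<le> Max (F ` {..n0})" by (intro Max_ge) auto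
    then have "real (F n) \<le> C * 1" by (simp add: C_def le_max_iff_disj)
    also have "\<dots> \<le> C * real b powr (s * real n)"
      using s bpow_pos by (intro mult_left_mono ge_one_powr_ge_zero) (auto simp: C_def le_max_iff_disj)
    finally show ?thesis .
  qed
  then have "packing_dim tree_set \<le> ereal s" by (rule packing_dim_tree_le[OF s(1)])
  then show "packing_dim tree_set \<le> ereal u" using s(2) by (metis ereal_less_eq(3) less_imp_le order.trans)
qed

end

section \<open>Counting words that avoid one word at each position\<close>

definition avoiding :: "nat \<Rightarrow> (nat \<Rightarrow> nat list) \<Rightarrow> nat list \<Rightarrow> bool" where
  "avoiding m \<omega> u \<longleftrightarrow> (\<forall>i. i + m \<le> length u \<longrightarrow> take m (drop i u) \<noteq> \<omega> i)"

definition avoiding_words :: "nat \<Rightarrow> nat \<Rightarrow> (nat \<Rightarrow> nat list) \<Rightarrow> nat \<Rightarrow> nat list set" where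
  "avoiding_words b m \<omega> j = {u \<in> words b j. avoiding m \<omega> u}"

definition shift :: "nat \<Rightarrow> (nat \<Rightarrow> 'a) \<Rightarrow> nat \<Rightarrow> 'a" where
  "shift n \<omega> = (\<lambda>i. \<omega> (i + n))"

lemma shift_shift [simp]: "shift k (shift n \<omega>) = shift (n + k) \<omega>"
  by (simp add: shift_def add_ac)

lemma shift_0 [simp]: "shift 0 \<omega> = \<omega>"
  by (simp add: shift_def)

lemma finite_words: "finite (words b n)" "card (words b n) = b ^ n"
proof -
  have e: "words b n = {w. set w \<subseteq> {0..<b} \<and> length w = n}" by (auto simp: words_def)
  show "finite (words b n)" unfolding e by (rule finite_lists_length_eq) simp
  show "card (words b n) = b ^ n" unfolding e by (subst card_lists_length_eq) auto
qed

lemma finite_avoiding_words: "finite (avoiding_words b m \<omega> j)"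
  using finite_words(1) by (auto simp: avoiding_words_def)

lemma avoiding_prefix: "avoiding m \<omega> (u @ v) \<Longrightarrow> avoiding m \<omega> u"
proof -
  assume a: "avoiding m \<omega> (u @ v)"
  have "take m (drop i u) \<noteq> \<omega> i" if "i + m \<le> length u" for i
  proof -
    have "i + m \<le> length (u @ v)" using that by simp
    with a have "take m (drop i (u @ v)) \<noteq> \<omega> i" unfolding avoiding_def by blast
    then show ?thesis using that by simp
  qed
  then show ?thesis by (simp add: avoiding_def)
qed

lemma avoiding_drop:
  "avoiding m \<omega> u \<Longrightarrow> n \<le> length u \<Longrightarrow> avoiding m (shift n \<omega>) (drop n u)"
  by (auto simp: avoiding_def shift_def add_ac)

lemma avoiding_Cons:
  "avoiding m \<omega> (x # u) \<longleftrightarrow>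
     avoiding m (shift 1 \<omega>) u \<and> (m \<le> Suc (length u) \<longrightarrow> take m (x # u) \<noteq> \<omega> 0)"
proof
  assume a: "avoiding m \<omega> (x # u)"
  then show "avoiding m (shift 1 \<omega>) u \<and> (m \<le> Suc (length u) \<longrightarrow> take m (x # u) \<noteq> \<omega> 0)"
    using avoiding_drop[of m \<omega> "x # u" 1] by (auto simp: avoiding_def dest: spec[of _ 0])
next
  assume a: "avoiding m (shift 1 \<omega>) u \<and> (m \<le> Suc (length u) \<longrightarrow> take m (x # u) \<noteq> \<omega> 0)"
  show "avoiding m \<omega> (x # u)"
    unfolding avoiding_def
  proof (intro allI impI)
    fix i assume i: "i + m \<le> length (x # u)"
    show "take m (drop i (x # u)) \<noteq> \<omega> i"
    proof (cases i)
      case 0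
      then show ?thesis using a i by simp
    next
      case (Suc k)
      then show ?thesis using a i by (auto simp: avoiding_def shift_def)
    qed
  qed
qed

locale avoidance =
  fixes b m :: nat
  assumes b_ge3: "b \<ge> 3" and m_ge2: "m \<ge> 2"
begin

abbreviation AW :: "(nat \<Rightarrow> nat list) \<Rightarrow> nat \<Rightarrow> nat list set" where
  "AW \<equiv> avoiding_words b m"

abbreviation f :: "(nat \<Rightarrow> nat list) \<Rightarrow> nat \<Rightarrow> nat" where
  "f \<omega> j \<equiv> card (AW \<omega> j)"

lemma f_short: "j < m \<Longrightarrow> f \<omega> j = b ^ j"
proof -
  assume "j < m"
  then have "AW \<omega> j = words b j"
    by (auto simp: avoiding_words_def avoiding_def words_def)
  then show ?thesis by (simp add: finite_words)
qed

lemma Cons_in_avoiding_words: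
  "x # u \<in> AW \<omega> (Suc j) \<longleftrightarrow> x < b \<and> u \<in> AW (shift 1 \<omega>) j
     \<and> (m \<le> Suc j \<longrightarrow> take m (x # u) \<noteq> \<omega> 0)"
  by (auto simp: avoiding_words_def words_def avoiding_Cons)

lemma card_Cons_image:
  "card ((\<lambda>(x, u). x # u) ` (A \<times> AW \<omega> j)) = card A * f \<omega> j"
  by (subst card_image) (auto simp: inj_on_def card_cartesian_product)

text \<open>A first digit different from that of the word forbidden at position 0 is safe whatever
  follows, which leaves at least \<open>b - 1\<close> choices.\<close>

lemma f_Suc_ge_pred: "f \<omega> (Suc j) \<ge> (b - 1) * f (shift 1 \<omega>) j"
proof -
  have "(\<lambda>(x, u). x # u) ` (({0..<b} - {hd (\<omega> 0)}) \<times> AW (shift 1 \<omega>) j)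
      \<subseteq> AW \<omega> (Suc j)"
  proof
    fix v assume "v \<in> (\<lambda>(x, u). x # u) ` (({0..<b} - {hd (\<omega> 0)}) \<times> AW (shift 1 \<omega>) j)"
    then obtain p where "p \<in> ({0..<b} - {hd (\<omega> 0)}) \<times> AW (shift 1 \<omega>) j"
      "v = (case p of (x, u) \<Rightarrow> x # u)" by blast
    moreover obtain x u where "p = (x, u)" by (cases p)
    ultimately have x: "v = x # u" "x < b" "x \<noteq> hd (\<omega> 0)" "u \<in> AW (shift 1 \<omega>) j"
      by auto
    have "hd (take m (x # u)) = x" using m_ge2 by (cases m) auto
    with x show "v \<in> AW \<omega> (Suc j)" by (auto simp: Cons_in_avoiding_words)
  qed
  from card_mono[OF finite_avoiding_words this]
  have "card ({0..<b} - {hd (\<omega> 0)}) * f (shift 1 \<omega>) j \<le> f \<omega> (Suc j)" by (simp only: card_Cons_image)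
  moreover have "b - 1 \<le> card ({0..<b} - {hd (\<omega> 0)})" by (simp add: card_Diff_singleton_if)
  ultimately show ?thesis by (meson mult_le_mono1 order_trans)
qed

lemma f_ge_power_mult: "l \<le> j \<Longrightarrow> f \<omega> j \<ge> (b - 1) ^ l * f (shift l \<omega>) (j - l)"
proof (induction l)
  case (Suc l)
  have "(b - 1) ^ Suc l * f (shift (Suc l) \<omega>) (j - Suc l)
      = (b - 1) ^ l * ((b - 1) * f (shift 1 (shift l \<omega>)) (j - Suc l))"
    by simp
  also have "\<dots> \<le> (b - 1) ^ l * f (shift l \<omega>) (Suc (j - Suc l))"
    by (intro mult_left_mono f_Suc_ge_pred) simp
  also have "\<dots> \<le> f \<omega> j" using Suc by (simp add: Suc_diff_Suc)
  finally show ?case .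
qed simp

lemma f_pos: "f \<omega> j \<ge> 1"
proof -
  have "1 \<le> (b - 1) ^ j * f (shift j \<omega>) 0" using f_short[of 0] m_ge2 b_ge3 by simp
  also have "\<dots> \<le> f \<omega> j" using f_ge_power_mult[of j j \<omega>] by simp
  finally show ?thesis .
qed

section \<open>The recursion at the left end and the rate \<eta>\<close>

lemma mult_f_le_short:
  assumes "Suc j < m"
  shows "b * f (shift 1 \<omega>) j \<le> f \<omega> (Suc j)"
  using assms by (simp add: f_short)

text \<open>Prepending a digit to a word that avoids the shifted sequence can only fail by
  completing \<open>\<omega> 0\<close>. The digits after it then form a word avoiding
  \<open>shift m \<omega>\<close>, so such failures are counted by the last term.\<close>

lemma mult_f_le:
  assumes "m \<le> Suc j"
  shows "b * f (shift 1 \<omega>) j \<le> f \<omega> (Suc j) + f (shift m \<omega>) (Suc j - m)"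
proof -
  let ?M = "(\<lambda>y. \<omega> 0 @ y) ` AW (shift m \<omega>) (Suc j - m)"
  have "(\<lambda>(x, u). x # u) ` ({0..<b} \<times> AW (shift 1 \<omega>) j)
      \<subseteq> AW \<omega> (Suc j) \<union> ?M"
  proof clarify
    fix x u assume x: "x \<in> {0..<b}" "u \<in> AW (shift 1 \<omega>) j" "x # u \<notin> ?M"
    have "take m (x # u) \<noteq> \<omega> 0"
    proof
      assume e: "take m (x # u) = \<omega> 0"
      have d: "drop m (x # u) = drop (m - 1) u" using m_ge2 by (cases m) auto
      have "avoiding m (shift (1 + (m - 1)) \<omega>) (drop (m - 1) u)"
        using avoiding_drop[of m "shift 1 \<omega>" u "m - 1"] x(2) assms
        by (auto simp: avoiding_words_def words_def)
      moreover have "drop (m - 1) u \<in> words b (Suc j - m)"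
        using x(2) m_ge2 set_drop_subset[of "m - 1" u] by (auto simp: avoiding_words_def words_def)
      ultimately have "drop (m - 1) u \<in> AW (shift m \<omega>) (Suc j - m)"
        using m_ge2 by (simp add: avoiding_words_def)
      moreover have "x # u = \<omega> 0 @ drop (m - 1) u"
        using e d by (metis append_take_drop_id)
      ultimately show False using x(3) by blast
    qed
    then show "x # u \<in> AW \<omega> (Suc j)" using x by (simp add: Cons_in_avoiding_words)
  qed
  then have "card ((\<lambda>(x, u). x # u) ` ({0..<b} \<times> AW (shift 1 \<omega>) j))
      \<le> card (AW \<omega> (Suc j) \<union> ?M)"
    by (rule card_mono[rotated]) (simp add: finite_avoiding_words)
  also have "\<dots> \<le> f \<omega> (Suc j) + card ?M" by (rule card_Un_le)
  also have "card ?M \<le> f (shift m \<omega>) (Suc j - m)" by (rule card_image_le[OF finite_avoiding_words])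
  finally show ?thesis by (simp add: card_Cons_image)
qed

text \<open>Since \<open>b - \<eta> = 1 / \<eta> ^ (m - 1)\<close>, the growth factor \<open>\<eta>\<close> reproduces itself in \<open>mult_f_le\<close>.\<close>

lemma f_Suc_ge_eta:
  fixes \<eta> :: real
  assumes eta: "0 < \<eta>" "\<eta> \<le> b" "\<eta> ^ m - real b * \<eta> ^ (m - 1) + 1 = 0"
  shows "f \<omega> (Suc j) \<ge> \<eta> * f (shift 1 \<omega>) j"
proof (induction j arbitrary: \<omega> rule: less_induct)
  case (less j)
  show ?case
  proof (cases "Suc j < m")
    case True
    have "\<eta> * f (shift 1 \<omega>) j \<le> real b * f (shift 1 \<omega>) j"
      by (rule mult_right_mono) (use eta in auto)
    also have "\<dots> \<le> f \<omega> (Suc j)"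
      using mult_f_le_short[OF True, of \<omega>] by (metis of_nat_le_iff of_nat_mult)
    finally show ?thesis .
  next
    case False
    \<comment> \<open>Used with \<open>l = m - 1\<close>, the iterated induction hypothesis bounds
      the last term of \<open>mult_f_le\<close> by
      \<open>f (shift 1 \<omega>) j / \<eta> ^ (m - 1)\<close>.\<close>
    have iter: "\<eta> ^ l * f (shift l (shift 1 \<omega>)) (j - l) \<le> f (shift 1 \<omega>) j" if "l \<le> j" for l
      using that
    proof (induction l)
      case (Suc l)
      have "\<eta> ^ Suc l * f (shift (Suc l) (shift 1 \<omega>)) (j - Suc l)
          = \<eta> ^ l * (\<eta> * f (shift 1 (shift l (shift 1 \<omega>))) (j - Suc l))"
        by (simp add: mult_ac)
      also have "\<dots> \<le> \<eta> ^ l * f (shift l (shift 1 \<omega>)) (Suc (j - Suc l))"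
        using Suc.prems eta by (intro mult_left_mono less.IH) auto
      also have "\<dots> \<le> f (shift 1 \<omega>) j" using Suc by (simp add: Suc_diff_Suc)
      finally show ?case .
    qed simp
    have mm: "Suc (m - 1) = m" using m_ge2 by simp
    have "\<eta> ^ (m - 1) * f (shift m \<omega>) (Suc j - m) \<le> f (shift 1 \<omega>) j"
      using iter[of "m - 1"] False m_ge2 by (simp add: mm)
    then have "real (f (shift m \<omega>) (Suc j - m)) \<le> f (shift 1 \<omega>) j / \<eta> ^ (m - 1)"
      using eta(1) by (simp add: pos_le_divide_eq mult.commute)
    moreover have "real b * f (shift 1 \<omega>) j \<le> real (f \<omega> (Suc j)) + f (shift m \<omega>) (Suc j - m)"
      using mult_f_le[of j \<omega>] False by (metis not_less of_nat_add of_nat_le_iff of_nat_mult)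
    moreover have "\<eta> = real b - 1 / \<eta> ^ (m - 1)"
    proof -
      have "\<eta> ^ m = \<eta> * \<eta> ^ (m - 1)" using mm by (metis power_Suc)
      then show ?thesis using eta by (simp add: field_simps)
    qed
    then have "\<eta> * f (shift 1 \<omega>) j = real b * f (shift 1 \<omega>) j - f (shift 1 \<omega>) j / \<eta> ^ (m - 1)"
      by (metis left_diff_distrib mult_1 times_divide_eq_left)
    ultimately show ?thesis by linarith
  qed
qed

lemma f_ge_eta_power:
  fixes \<eta> :: real
  assumes "0 < \<eta>" "\<eta> \<le> b" "\<eta> ^ m - real b * \<eta> ^ (m - 1) + 1 = 0"
  shows "f \<omega> j \<ge> \<eta> ^ j"
proof (induction j arbitrary: \<omega>)
  case 0
  then show ?case using f_short[of 0] m_ge2 by simp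
next
  case (Suc j)
  have "\<eta> ^ Suc j \<le> \<eta> * f (shift 1 \<omega>) j" using Suc assms(1) by simp
  also have "\<dots> \<le> f \<omega> (Suc j)" by (rule f_Suc_ge_eta[OF assms])
  finally show ?case .
qed

text \<open>Classify the words by the last position at which they differ from the final forbidden word.\<close>

lemma f_le_sum:
  assumes "m \<le> j" "\<omega> (j - m) \<in> words b m"
  shows "f \<omega> j \<le> (b - 1) * (\<Sum>i<m. f \<omega> (j - 1 - i))"
proof -
  define y where "y = \<omega> (j - m)"
  have y: "length y = m" "set y \<subseteq> {0..<b}" using assms(2) by (auto simp: y_def words_def)
  \<comment> \<open>\<open>W i\<close>: the last \<open>i\<close> digits are those of
    \<open>y\<close> and the digit before them is not, so that this digit has \<open>b - 1\<close>
    values and everything before it is an avoiding word.\<close>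
  define W where "W i = (\<lambda>(x, u). u @ [x] @ drop (m - i) y) `
      (({0..<b} - {y ! (m - 1 - i)}) \<times> AW \<omega> (j - 1 - i))" for i
  have "AW \<omega> j \<subseteq> (\<Union>i<m. W i)"
  proof
    fix v assume v: "v \<in> AW \<omega> j"
    then have lv: "length v = j" "set v \<subseteq> {0..<b}" "avoiding m \<omega> v"
      by (auto simp: avoiding_words_def words_def)
    define t where "t = drop (j - m) v"
    have lt: "length t = m" using lv assms(1) by (simp add: t_def)
    have "take m (drop (j - m) v) \<noteq> y"
      using lv(1,3) assms(1) unfolding avoiding_def y_def by (metis le_add_diff_inverse2 order_refl)
    then have "t \<noteq> y" using lt by (simp add: t_def)
    then have ex: "{p. p < m \<and> t ! p \<noteq> y ! p} \<noteq> {}" using lt y nth_equalityI[of t y] by auto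
    define p where "p = Max {p. p < m \<and> t ! p \<noteq> y ! p}"
    have p: "p < m" "t ! p \<noteq> y ! p" using Max_in[OF _ ex] by (auto simp: p_def)
    have eq: "t ! q = y ! q" if "p < q" "q < m" for q
      using Max_ge[of "{p. p < m \<and> t ! p \<noteq> y ! p}" q] that unfolding p_def by fastforce
    have "drop (Suc p) t = drop (Suc p) y"
      by (rule nth_equalityI) (use lt y eq in auto)
    moreover have "v = take (j - m) v @ t" by (simp add: t_def)
    moreover have "t = take p t @ t ! p # drop (Suc p) t" using p lt by (simp add: id_take_nth_drop)
    ultimately have ve: "v = (take (j - m) v @ take p t) @ [t ! p] @ drop (Suc p) y"
      by (metis append.assoc append_Cons append_Nil)
    define i where "i = m - 1 - p"
    have i: "i < m" "m - i = Suc p" "m - 1 - i = p" using p by (auto simp: i_def)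
    have l: "length (take (j - m) v @ take p t) = j - 1 - i"
      using lv lt p assms(1) by (simp add: i_def)
    have "avoiding m \<omega> (take (j - m) v @ take p t)"
      using lv(3) ve avoiding_prefix by metis
    moreover have "set (take (j - m) v @ take p t) \<subseteq> {0..<b}"
      using lv(2) unfolding t_def by (auto dest: in_set_takeD in_set_dropD)
    ultimately have "take (j - m) v @ take p t \<in> AW \<omega> (j - 1 - i)"
      using l by (simp add: avoiding_words_def words_def)
    moreover have "t ! p \<in> {0..<b} - {y ! (m - 1 - i)}"
      using p i lv lt nth_mem[of p t] set_drop_subset[of "j - m" v] by (auto simp: t_def)
    ultimately have "v \<in> W i" unfolding W_def i(2) using ve by (intro image_eqI[of _ _ "(t ! p, _)"]) auto
    then show "v \<in> (\<Union>i<m. W i)" using i by blast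
  qed
  then have "f \<omega> j \<le> card (\<Union>i<m. W i)"
    by (rule card_mono[rotated]) (simp add: W_def finite_avoiding_words)
  also have "\<dots> \<le> (\<Sum>i<m. card (W i))" by (rule card_UN_le) simp
  also have "\<dots> \<le> (\<Sum>i<m. (b - 1) * f \<omega> (j - 1 - i))"
  proof (rule sum_mono)
    fix i assume "i \<in> {..<m}"
    then have "m - 1 - i < length y" using y(1) by auto
    then have "y ! (m - 1 - i) \<in> {0..<b}" using y(2) nth_mem by blast
    then have "card ({0..<b} - {y ! (m - 1 - i)}) = b - 1" by simp
    moreover have "card (W i) \<le> card (({0..<b} - {y ! (m - 1 - i)}) \<times> AW \<omega> (j - 1 - i))"
      unfolding W_def by (rule card_image_le) (simp add: finite_avoiding_words)
    ultimately show "card (W i) \<le> (b - 1) * f \<omega> (j - 1 - i)" by (simp add: card_cartesian_product)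
  qed
  finally show ?thesis by (simp add: sum_distrib_left)
qed

lemma lambda_recursion:
  fixes lam :: real
  assumes "lam ^ m - (real b - 1) * (\<Sum>i<m. lam ^ i) = 0" "m \<le> j"
  shows "(real b - 1) * (\<Sum>i<m. lam ^ (j - 1 - i)) = lam ^ j"
proof -
  have "(\<Sum>i<m. lam ^ (j - 1 - i)) = (\<Sum>i<m. lam ^ (j - m) * lam ^ (m - Suc i))"
  proof (rule sum.cong)
    fix i assume "i \<in> {..<m}"
    then have "j - 1 - i = (j - m) + (m - Suc i)" using assms(2) by auto
    then show "lam ^ (j - 1 - i) = lam ^ (j - m) * lam ^ (m - Suc i)" by (simp add: power_add)
  qed simp
  also have "\<dots> = lam ^ (j - m) * (\<Sum>i<m. lam ^ i)"
    unfolding sum_distrib_left[symmetric]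
    by (simp only: sum.nat_diff_reindex[of "\<lambda>i. lam ^ i"])
  finally have "(real b - 1) * (\<Sum>i<m. lam ^ (j - 1 - i))
      = lam ^ (j - m) * ((real b - 1) * (\<Sum>i<m. lam ^ i))" by (simp add: mult_ac)
  also have "\<dots> = lam ^ (j - m) * lam ^ m" using assms(1) by simp
  also have "\<dots> = lam ^ j" using assms(2) by (simp add: power_add[symmetric])
  finally show ?thesis .
qed

text \<open>By \<open>lambda_recursion\<close> the powers of \<open>lam\<close> solve with equality
  the recursion that \<open>f_le_sum\<close> states as an inequality; the factor
  \<open>b ^ m\<close> covers the initial values \<open>j < m\<close>.\<close>

lemma f_le_lambda_power:
  fixes lam :: real
  assumes lam: "1 \<le> lam" "lam ^ m - (real b - 1) * (\<Sum>i<m. lam ^ i) = 0"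
    and \<omega>: "\<And>k. \<omega> k \<in> words b m"
  shows "f \<omega> j \<le> real b ^ m * lam ^ j"
proof (induction j rule: less_induct)
  case (less j)
  show ?case
  proof (cases "j < m")
    case True
    have "real (f \<omega> j) = real b ^ j * 1" using f_short[OF True] by simp
    also have "\<dots> \<le> real b ^ m * lam ^ j"
      using True b_ge3 lam(1) by (intro mult_mono power_increasing one_le_power) auto
    finally show ?thesis .
  next
    case False
    then have "f \<omega> j \<le> (b - 1) * (\<Sum>i<m. f \<omega> (j - 1 - i))" by (intro f_le_sum \<omega>) auto
    then have "real (f \<omega> j) \<le> real (b - 1) * (\<Sum>i<m. real (f \<omega> (j - 1 - i)))"
      by (metis of_nat_le_iff of_nat_mult of_nat_sum)
    also have "\<dots> \<le> real (b - 1) * (\<Sum>i<m. real b ^ m * lam ^ (j - 1 - i))"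
      using False m_ge2 by (intro mult_left_mono sum_mono less.IH) auto
    also have "\<dots> = real b ^ m * ((real b - 1) * (\<Sum>i<m. lam ^ (j - 1 - i)))"
      using b_ge3 by (simp add: sum_distrib_left[symmetric] of_nat_diff mult_ac)
    also have "\<dots> = real b ^ m * lam ^ j" using False by (subst lambda_recursion[OF lam(2)]) auto
    finally show ?thesis .
  qed
qed

section \<open>Extremal forbidden words\<close>

text \<open>The equality case of \<open>f_le_sum\<close>. Take an avoiding word, a digit that
  deviates from \<open>a\<close>, and then \<open>i < m\<close> digits of \<open>a\<close>. Every
  window not contained in the first piece covers the deviating position, and the word forbidden
  there is the factor of \<open>a\<close>, so it is avoided.\<close>

lemma sum_le_f:
  assumes "m \<le> j" and \<omega>: "\<And>k. k + m \<le> j \<Longrightarrow> \<omega> k = map a [k..<k + m]" and a: "\<And>k. a k < b"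
  shows "(b - 1) * (\<Sum>i<m. f \<omega> (j - 1 - i)) \<le> f \<omega> j"
proof -
  define W where "W i = ({0..<b} - {a (j - 1 - i)}) \<times> AW \<omega> (j - 1 - i)" for i
  define \<phi> where "\<phi> = (\<lambda>(i, x :: nat, u). u @ [x] @ map a [j - i..<j])"
  have nth: "\<phi> (i, x, u) ! k = (if k < j - 1 - i then u ! k else if k = j - 1 - i then x else a k)"
    "length (\<phi> (i, x, u)) = j"
    if "i < m" "(x, u) \<in> W i" "k < j" for i x u k
  proof -
    have "length u = j - 1 - i" using that by (auto simp: W_def avoiding_words_def words_def)
    then show "\<phi> (i, x, u) ! k = (if k < j - 1 - i then u ! k else if k = j - 1 - i then x else a k)"
      "length (\<phi> (i, x, u)) = j"
      using that assms(1) by (auto simp: \<phi>_def nth_append nth_Cons')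
  qed
  \<comment> \<open>\<open>i\<close> is recovered as the number of final digits that agree with
    \<open>a\<close>.\<close>
  have inj: "inj_on \<phi> (Sigma {..<m} W)"
  proof (rule inj_onI)
    fix p p' assume p: "p \<in> Sigma {..<m} W" "p' \<in> Sigma {..<m} W" "\<phi> p = \<phi> p'"
    obtain i x u i' x' u' where pp: "p = (i, x, u)" "p' = (i', x', u')" by (cases p, cases p') auto
    with p have i: "i < m" "i' < m" and W: "(x, u) \<in> W i" "(x', u') \<in> W i'"
      and e: "\<phi> (i, x, u) = \<phi> (i', x', u')" by auto
    have ne: "x \<noteq> a (j - 1 - i)" "x' \<noteq> a (j - 1 - i')" using W by (auto simp: W_def)
    have "i = i'"
    proof (rule linorder_cases[of i i'])
      assume "i < i'"
      then show ?thesis using e nth(1)[OF i(1) W(1), of "j - 1 - i"] nth(1)[OF i(2) W(2), of "j - 1 - i"]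
          ne i assms(1) m_ge2 by (auto split: if_splits)
    next
      assume "i' < i"
      then show ?thesis using e nth(1)[OF i(1) W(1), of "j - 1 - i'"] nth(1)[OF i(2) W(2), of "j - 1 - i'"]
          ne i assms(1) m_ge2 by (auto split: if_splits)
    qed auto
    moreover have "length u = j - 1 - i" "length u' = j - 1 - i'"
      using W by (auto simp: W_def avoiding_words_def words_def)
    ultimately show "p = p'" using e by (auto simp: \<phi>_def pp)
  qed
  have "\<phi> ` Sigma {..<m} W \<subseteq> AW \<omega> j"
  proof
    fix v assume "v \<in> \<phi> ` Sigma {..<m} W"
    then obtain i p where "i < m" "p \<in> W i" "v = \<phi> (i, p)" by blast
    moreover obtain x u where "p = (x, u)" by (cases p)
    ultimately have i: "i < m" and W: "(x, u) \<in> W i" and v: "v = \<phi> (i, x, u)" by auto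
    have u: "length u = j - 1 - i" "set u \<subseteq> {0..<b}" "avoiding m \<omega> u" "x < b" "x \<noteq> a (j - 1 - i)"
      using W by (auto simp: W_def avoiding_words_def words_def)
    have len: "length (\<phi> (i, x, u)) = j" using nth(2)[OF i W, of 0] assms(1) m_ge2 by simp
    have "take m (drop k (\<phi> (i, x, u))) \<noteq> \<omega> k" if k: "k + m \<le> j" for k
    proof (cases "k + m \<le> j - 1 - i")
      case True
      then have "take m (drop k (\<phi> (i, x, u))) = take m (drop k u)" using u(1) by (simp add: \<phi>_def)
      then show ?thesis using u True by (simp add: avoiding_def)
    next
      case False
      define q where "q = j - 1 - i - k"
      have q: "q < m" "k + q = j - 1 - i" using False k i by (auto simp: q_def)
      have "take m (drop k (\<phi> (i, x, u))) ! q = \<phi> (i, x, u) ! (k + q)" using q k len by simp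
      also have "\<dots> = x" unfolding q(2) using nth(1)[OF i W, of "j - 1 - i"] i assms(1) by simp
      finally have "take m (drop k (\<phi> (i, x, u))) ! q \<noteq> map a [k..<k + m] ! q" using u q by simp
      then show ?thesis using \<omega>[OF k] by auto
    qed
    then have "avoiding m \<omega> (\<phi> (i, x, u))" unfolding avoiding_def len by blast
    moreover have "\<phi> (i, x, u) \<in> words b j" using len u a by (auto simp: \<phi>_def words_def)
    ultimately show "v \<in> AW \<omega> j" unfolding v by (simp add: avoiding_words_def)
  qed
  from card_mono[OF finite_avoiding_words this]
  have "card (Sigma {..<m} W) \<le> f \<omega> j" by (simp add: card_image[OF inj])
  moreover have "card (Sigma {..<m} W) = (\<Sum>i<m. (b - 1) * f \<omega> (j - 1 - i))"
    using a by (subst card_SigmaI) (auto simp: W_def card_cartesian_product finite_avoiding_words)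
  ultimately show ?thesis by (simp add: sum_distrib_left)
qed

lemma f_ge_lambda_power:
  fixes lam :: real
  assumes lam: "0 < lam" "lam \<le> b" "lam ^ m - (real b - 1) * (\<Sum>i<m. lam ^ i) = 0"
    and \<omega>: "\<And>k. k + m \<le> j \<Longrightarrow> \<omega> k = map a [k..<k + m]" and a: "\<And>k. a k < b"
  shows "f \<omega> j \<ge> lam ^ j"
  using \<omega>
proof (induction j rule: less_induct)
  case (less j)
  show ?case
  proof (cases "j < m")
    case True
    then show ?thesis using f_short[OF True] lam by (simp add: power_mono)
  next
    case False
    have "lam ^ j = (real b - 1) * (\<Sum>i<m. lam ^ (j - 1 - i))"
      using False by (subst lambda_recursion[OF lam(3)]) auto
    also have "\<dots> \<le> (real b - 1) * (\<Sum>i<m. real (f \<omega> (j - 1 - i)))"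
      using b_ge3 False m_ge2 less.prems by (intro mult_left_mono sum_mono less.IH) auto
    also have "\<dots> = real ((b - 1) * (\<Sum>i<m. f \<omega> (j - 1 - i)))" using b_ge3 by (simp add: of_nat_diff)
    also have "\<dots> \<le> f \<omega> j"
      using sum_le_f[of j \<omega> a] less.prems a False by (subst of_nat_le_iff) auto
    finally show ?thesis .
  qed
qed

text \<open>The equality case of \<open>mult_f_le\<close>. An occurrence of
  \<open>\<omega> 0\<close> puts \<open>a' (m - 1)\<close> at position \<open>m - 1\<close>, where
  each \<open>\<omega> k\<close> with \<open>0 < k < m\<close> requires \<open>a (m - 1)\<close>. So
  no other forbidden word can overlap it, and every avoiding continuation \<open>y\<close> is
  possible.\<close>

lemma f_add_le_mult:
  assumes "m \<le> Suc j"
    and \<omega>: "\<And>k. k + m \<le> Suc j \<Longrightarrow> \<omega> k = map a [k..<k + m - 1] @ [a' (k + m - 1)]"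
    and a: "\<And>k. a k < b" "\<And>k. a' k < b" "\<And>k. a' k \<noteq> a k"
  shows "f \<omega> (Suc j) + f (shift m \<omega>) (Suc j - m) \<le> b * f (shift 1 \<omega>) j"
proof -
  let ?M = "(\<lambda>y. \<omega> 0 @ y) ` AW (shift m \<omega>) (Suc j - m)"
  let ?R = "(\<lambda>(x, u). x # u) ` ({0..<b} \<times> AW (shift 1 \<omega>) j)"
  have \<omega>0: "\<omega> 0 = map a [0..<m - 1] @ [a' (m - 1)]" using \<omega>[of 0] assms(1) by simp
  have l0: "length (\<omega> 0) = m" using \<omega>0 m_ge2 by simp
  have "AW \<omega> (Suc j) \<subseteq> ?R"
  proof
    fix v assume v: "v \<in> AW \<omega> (Suc j)"
    then obtain x u where xu: "v = x # u" by (cases v) (auto simp: avoiding_words_def words_def)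
    with v show "v \<in> ?R" unfolding xu by (intro image_eqI[of _ _ "(x, u)"]) (auto simp: Cons_in_avoiding_words)
  qed
  moreover have "?M \<subseteq> ?R"
  proof clarify
    fix y assume y: "y \<in> AW (shift m \<omega>) (Suc j - m)"
    obtain x z where xz: "\<omega> 0 = x # z" using l0 m_ge2 by (cases "\<omega> 0") auto
    have lz: "length z = m - 1" using xz l0 by simp
    have ly: "length y = Suc j - m" "set y \<subseteq> {0..<b}" "avoiding m (shift m \<omega>) y"
      using y by (auto simp: avoiding_words_def words_def)
    have "set (\<omega> 0) \<subseteq> {0..<b}" using a unfolding \<omega>0 by auto
    then have dig: "x < b" "set z \<subseteq> {0..<b}" using xz by auto
    have "take m (drop k (z @ y)) \<noteq> shift 1 \<omega> k" if k: "k + m \<le> length (z @ y)" for k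
    proof (cases "k + 1 < m")
      case False
      then have "k - (m - 1) = k + 1 - m" "length z \<le> k" using lz m_ge2 by linarith+
      then have "drop k (z @ y) = drop (k + 1 - m) y" using lz by simp
      moreover have "shift m \<omega> (k + 1 - m) = shift 1 \<omega> k" using False by (simp add: shift_def)
      moreover have "k + 1 - m + m \<le> length y" using k lz False ly m_ge2 by simp
      ultimately show ?thesis using ly(3) by (metis avoiding_def)
    next
      case True
      \<comment> \<open>Position \<open>m - 1\<close> of \<open>\<omega> 0 @ y\<close> has index
        \<open>m - 2\<close> in \<open>z @ y\<close>, hence index \<open>q\<close> in the window
        starting at \<open>k\<close>.\<close>
      define q where "q = m - 2 - k"
      have q: "q < m - 1" "k + q = m - 2" using True by (auto simp: q_def)
      have kj: "Suc k + m \<le> Suc j" using k lz ly assms(1) m_ge2 by simp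
      have "take m (drop k (z @ y)) ! q = (z @ y) ! (m - 2)"
        using q k by (simp del: take_append drop_append)
      also have "\<dots> = \<omega> 0 ! (m - 1)"
      proof -
        have "m - 1 = Suc (m - 2)" "m - 2 < length z" using lz m_ge2 by auto
        then show ?thesis by (simp add: nth_append xz)
      qed
      also have "\<dots> = a' (m - 1)" unfolding \<omega>0 by (simp add: nth_append)
      finally have 1: "take m (drop k (z @ y)) ! q = a' (m - 1)" .
      have "shift 1 \<omega> k ! q = a (Suc k + q)"
        using \<omega>[OF kj] q by (simp add: shift_def nth_append)
      also have "Suc k + q = m - 1" using q m_ge2 by simp
      finally have "shift 1 \<omega> k ! q = a (m - 1)" .
      with 1 a(3) show ?thesis by metis
    qed
    then have "avoiding m (shift 1 \<omega>) (z @ y)" by (simp add: avoiding_def)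
    moreover have "z @ y \<in> words b j" using ly lz dig assms(1) m_ge2 by (auto simp: words_def)
    ultimately show "\<omega> 0 @ y \<in> ?R" unfolding xz using dig
      by (intro image_eqI[of _ _ "(x, z @ y)"]) (auto simp: avoiding_words_def)
  qed
  moreover have "AW \<omega> (Suc j) \<inter> ?M = {}"
  proof -
    have "\<not> avoiding m \<omega> (\<omega> 0 @ y)" for y
      unfolding avoiding_def using l0 by (auto intro!: exI[of _ 0])
    then show ?thesis by (auto simp: avoiding_words_def)
  qed
  moreover have "finite ?R" by (simp add: finite_avoiding_words)
  ultimately have "card (AW \<omega> (Suc j)) + card ?M \<le> card ?R"
    using card_Un_disjoint[of "AW \<omega> (Suc j)" ?M] finite_avoiding_words
      card_mono[of ?R "AW \<omega> (Suc j) \<union> ?M"] by auto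
  moreover have "card ?M = f (shift m \<omega>) (Suc j - m)" by (rule card_image) (auto simp: inj_on_def)
  ultimately show ?thesis by (simp add: card_Cons_image)
qed

end

text \<open>The quantity \<open>w j - \<theta> * (w (j - 1) + \<dots> + w (j - m + 1))\<close> does not increase.\<close>

lemma delayed_increment_bounded:
  fixes w :: "nat \<Rightarrow> real"
  assumes \<theta>: "0 \<le> \<theta>" "real (m - 1) * \<theta> < 1" and "m \<ge> 1"
    and nonneg: "\<And>j. j \<le> e \<Longrightarrow> 0 \<le> w j"
    and mono: "\<And>i j. i \<le> j \<Longrightarrow> j \<le> e \<Longrightarrow> w i \<le> w j"
    and incr: "\<And>j. m \<le> j \<Longrightarrow> j \<le> e \<Longrightarrow> w j \<le> w (j - 1) + \<theta> * (w (j - 1) - w (j - m))"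
    and j: "m - 1 \<le> j" "j \<le> e"
  shows "w j * (1 - real (m - 1) * \<theta>) \<le> w (m - 1)"
proof -
  define P where "P j = w j - \<theta> * (\<Sum>i\<in>{j - (m - 1)..<j}. w i)" for j
  have "P j \<le> w (m - 1)" using j
  proof (induction j rule: dec_induct)
    case base
    have "0 \<le> (\<Sum>i\<in>{m - 1 - (m - 1)..<m - 1}. w i)" using nonneg base by (intro sum_nonneg) auto
    then show ?case using \<theta> by (simp add: P_def)
  next
    case (step n)
    have mn: "m \<le> Suc n" using step assms(3) by linarith
    have eq: "(\<Sum>i\<in>{Suc n - (m - 1)..<Suc n}. w i) + w (Suc n - m) = (\<Sum>i\<in>{n - (m - 1)..<n}. w i) + w n"
    proof (cases "m = 1")
      case True
      then show ?thesis by simp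
    next
      case False
      have 1: "(\<Sum>i\<in>{Suc n - (m - 1)..<Suc n}. w i) = (\<Sum>i\<in>{Suc n - (m - 1)..<n}. w i) + w n"
        using mn False assms(3) by (subst sum.atLeastLessThan_Suc) auto
      have "Suc n - (m - 1) = Suc (Suc n - m)" "n - (m - 1) = Suc n - m" "Suc n - m < n"
        using mn False assms(3) by auto
      then show ?thesis using 1 sum.atLeast_Suc_lessThan[of "Suc n - m" n w] by simp
    qed
    have i: "w (Suc n) \<le> w n + \<theta> * (w n - w (Suc n - m))" using incr[OF mn] step by simp
    have "(\<Sum>i\<in>{Suc n - (m - 1)..<Suc n}. w i)
        = (\<Sum>i\<in>{n - (m - 1)..<n}. w i) + (w n - w (Suc n - m))" using eq by linarith
    then have "P (Suc n) \<le> P n" unfolding P_def using i by (simp add: distrib_left)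
    then show ?case using step by simp
  qed
  \<comment> \<open>Monotonicity bounds each of the \<open>m - 1\<close> summands by
    \<open>w j\<close>, which turns the bound on \<open>P j\<close> into one on
    \<open>w j\<close>.\<close>
  moreover have "(\<Sum>i\<in>{j - (m - 1)..<j}. w i) \<le> (\<Sum>i\<in>{j - (m - 1)..<j}. w j)"
    using j by (intro sum_mono mono) auto
  then have "(\<Sum>i\<in>{j - (m - 1)..<j}. w i) \<le> real (m - 1) * w j" using j(1) by simp
  then have "\<theta> * (\<Sum>i\<in>{j - (m - 1)..<j}. w i) \<le> \<theta> * (real (m - 1) * w j)"
    by (rule mult_left_mono[OF _ \<theta>(1)])
  ultimately show ?thesis unfolding P_def by (simp add: algebra_simps)
qed

context avoidance
begin

text \<open>Without overlaps the normalised counts satisfy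
  \<open>w i \<le> (1 + \<theta>) * w (i - 1) - \<theta> * w (i - m)\<close>: each increment is
  \<theta> times an earlier, delayed increase. Such increments stay bounded in total when
  \<open>(m - 1) * \<theta> < 1\<close>.\<close>

lemma f_le_eta_power:
  fixes \<eta> :: real
  assumes eta: "2 \<le> \<eta>" "\<eta> \<le> b" "\<eta> ^ m - real b * \<eta> ^ (m - 1) + 1 = 0"
    and \<omega>: "\<And>k. k + m \<le> j \<Longrightarrow> \<omega> k = map a [k..<k + m - 1] @ [a' (k + m - 1)]"
    and a: "\<And>k. a k < b" "\<And>k. a' k < b" "\<And>k. a' k \<noteq> a k"
  shows "f \<omega> j \<le> real b ^ m / (1 - real (m - 1) / \<eta> ^ m) * \<eta> ^ j"
proof -
  \<comment> \<open>The equation for \<eta> reads \<open>b / \<eta> = 1 + 1 / \<eta> ^ m\<close>,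
    and \<open>m < 2 ^ m \<le> \<eta> ^ m\<close> makes \<open>(m - 1) * \<theta>\<close> less than
    1.\<close>
  define \<theta> where "\<theta> = 1 / \<eta> ^ m"
  have "real m < 2 ^ m" by (rule of_nat_less_two_power)
  also have "\<dots> \<le> \<eta> ^ m" using eta by (intro power_mono) auto
  finally have \<theta>: "0 \<le> \<theta>" "real (m - 1) * \<theta> < 1" "real (m - 1) / \<eta> ^ m < 1"
    using eta m_ge2 by (auto simp: \<theta>_def of_nat_diff)
  have den: "0 < 1 - real (m - 1) / \<eta> ^ m" "1 - real (m - 1) / \<eta> ^ m \<le> 1"
    using \<theta> eta by auto
  then have C: "real b ^ m \<le> real b ^ m / (1 - real (m - 1) / \<eta> ^ m)"
    by (simp add: pos_le_divide_eq mult_left_le)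
  show ?thesis
  proof (cases "j < m - 1")
    case True
    have "real (f \<omega> j) = real b ^ j * 1" using f_short[of j] True by simp
    also have "\<dots> \<le> real b ^ m * \<eta> ^ j"
      using True b_ge3 eta by (intro mult_mono power_increasing one_le_power) auto
    also have "\<dots> \<le> real b ^ m / (1 - real (m - 1) / \<eta> ^ m) * \<eta> ^ j"
      using C eta by (intro mult_right_mono) auto
    finally show ?thesis .
  next
    case False
    \<comment> \<open>The recursion prepends digits, so the right end \<open>j\<close> stays fixed
      and \<open>w i\<close> counts words on the last \<open>i\<close> positions.\<close>
    define w where "w i = f (shift (j - i) \<omega>) i / \<eta> ^ i" for i
    have w_Suc: "w i \<le> w (Suc i)" if "Suc i \<le> j" for i
    proof -
      have "\<eta> * f (shift 1 (shift (j - Suc i) \<omega>)) i \<le> f (shift (j - Suc i) \<omega>) (Suc i)"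
        by (rule f_Suc_ge_eta) (use eta in auto)
      moreover have "j - Suc i + 1 = j - i" using that by simp
      ultimately have "\<eta> * f (shift (j - i) \<omega>) i \<le> f (shift (j - Suc i) \<omega>) (Suc i)"
        by (simp only: shift_shift)
      then show ?thesis using eta by (simp add: w_def field_simps)
    qed
    have mono: "w i \<le> w k" if "i \<le> k" "k \<le> j" for i k
      using that
    proof (induction k rule: dec_induct)
      case (step k)
      then show ?case using w_Suc[of k] by simp
    qed simp
    have incr: "w i \<le> w (i - 1) + \<theta> * (w (i - 1) - w (i - m))" if i: "m \<le> i" "i \<le> j" for i
    proof -
      have i1: "Suc (i - 1) = i" using i m_ge2 by simp
      have "f (shift (j - i) \<omega>) (Suc (i - 1)) + f (shift m (shift (j - i) \<omega>)) (Suc (i - 1) - m)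
          \<le> b * f (shift 1 (shift (j - i) \<omega>)) (i - 1)"
      proof (rule f_add_le_mult[of _ _ "shift (j - i) a" "shift (j - i) a'"])
        fix k assume k: "k + m \<le> Suc (i - 1)"
        then have "k + (j - i) + m \<le> j" using i i1 by simp
        from \<omega>[OF this] show "shift (j - i) \<omega> k
            = map (shift (j - i) a) [k..<k + m - 1] @ [shift (j - i) a' (k + m - 1)]"
          using m_ge2 by (auto simp: shift_def add_ac intro!: nth_equalityI)
      qed (use i i1 a in \<open>auto simp: shift_def\<close>)
      moreover have "j - i + m = j - (i - m)" "j - i + 1 = j - (i - 1)" using i m_ge2 by auto
      ultimately have "f (shift (j - i) \<omega>) i + f (shift (j - (i - m)) \<omega>) (i - m)
          \<le> b * f (shift (j - (i - 1)) \<omega>) (i - 1)"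
        by (simp only: shift_shift i1)
      then have "real (f (shift (j - i) \<omega>) i) + real (f (shift (j - (i - m)) \<omega>) (i - m))
          \<le> real b * real (f (shift (j - (i - 1)) \<omega>) (i - 1))"
        by (metis of_nat_add of_nat_le_iff of_nat_mult)
      then have "(real (f (shift (j - i) \<omega>) i) + real (f (shift (j - (i - m)) \<omega>) (i - m))) / \<eta> ^ i
          \<le> real b * real (f (shift (j - (i - 1)) \<omega>) (i - 1)) / \<eta> ^ i"
        using eta by (intro divide_right_mono) auto
      moreover have "\<eta> ^ i = \<eta> ^ m * \<eta> ^ (i - m)" using i by (simp add: power_add[symmetric])
      then have "real (f (shift (j - (i - m)) \<omega>) (i - m)) / \<eta> ^ i = \<theta> * w (i - m)"
        by (simp add: w_def \<theta>_def)
      moreover have "real b * real (f (shift (j - (i - 1)) \<omega>) (i - 1)) / \<eta> ^ i = real b / \<eta> * w (i - 1)"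
        using i1 by (metis (no_types) power_Suc times_divide_times_eq w_def)
      moreover have "real b / \<eta> = 1 + \<theta>"
      proof -
        have e: "\<eta> ^ m = \<eta> * \<eta> ^ (m - 1)" using m_ge2 by (metis Suc_diff_1 less_le_trans pos2 power_Suc)
        have "real b * \<eta> ^ (m - 1) = \<eta> ^ m + 1" using eta(3) by simp
        then have "real b * \<eta> ^ m = \<eta> * (\<eta> ^ m + 1)" unfolding e by (simp add: algebra_simps)
        then have "real b / \<eta> = (\<eta> ^ m + 1) / \<eta> ^ m"
          using eta by (subst frac_eq_eq) (auto simp: mult.commute)
        then show ?thesis using eta by (simp add: \<theta>_def add_divide_distrib)
      qed
      ultimately have "w i + \<theta> * w (i - m) \<le> (1 + \<theta>) * w (i - 1)"
        by (simp add: add_divide_distrib w_def)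
      then show ?thesis by (simp add: algebra_simps)
    qed
    have "w j * (1 - real (m - 1) * \<theta>) \<le> w (m - 1)"
      by (rule delayed_increment_bounded[OF \<theta>(1,2), of j])
        (use m_ge2 eta mono incr False in \<open>auto simp: w_def\<close>)
    also have "w (m - 1) \<le> real b ^ m"
    proof -
      have "w (m - 1) = real b ^ (m - 1) / \<eta> ^ (m - 1)" using f_short[of "m - 1"] m_ge2 by (simp add: w_def)
      also have "\<dots> \<le> real b ^ (m - 1) / 1" using eta by (intro divide_left_mono one_le_power) auto
      also have "\<dots> \<le> real b ^ m" using b_ge3 by (simp add: power_increasing)
      finally show ?thesis .
    qed
    finally have "w j \<le> real b ^ m / (1 - real (m - 1) / \<eta> ^ m)"
      using den by (simp add: pos_le_divide_eq \<theta>_def)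
    then show ?thesis using eta by (simp add: w_def pos_divide_le_eq)
  qed
qed

section \<open>The tree of avoiding words\<close>

definition avoiding_tree :: "(nat \<Rightarrow> nat list) \<Rightarrow> nat list set" where
  "avoiding_tree \<omega> = {u. set u \<subseteq> {0..<b} \<and> avoiding m \<omega> u}"

abbreviation D :: "(nat \<Rightarrow> nat list) \<Rightarrow> nat list \<Rightarrow> nat \<Rightarrow> nat list set" where
  "D \<omega> \<equiv> descendants (avoiding_tree \<omega>)"

lemma level_avoiding_tree: "level (avoiding_tree \<omega>) n = AW \<omega> n"
  by (auto simp: level_def avoiding_tree_def avoiding_words_def words_def)

lemma descendants_avoiding_tree:
  "D \<omega> w j \<subseteq> AW (shift (length w) \<omega>) j"
proof
  fix u assume "u \<in> D \<omega> w j"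
  then show "u \<in> AW (shift (length w) \<omega>) j"
    using avoiding_drop[of m \<omega> "w @ u" "length w"]
    by (auto simp: descendants_def avoiding_tree_def avoiding_words_def words_def)
qed

lemma card_descendants_le: "card (D \<omega> w j) \<le> f (shift (length w) \<omega>) j"
  by (rule card_mono[OF finite_avoiding_words descendants_avoiding_tree])

text \<open>A continuation is bad only if its first \<open>l\<close> digits complete one of the at most \<open>m - 1\<close>
  forbidden words that are already begun; at most a \<open>2\<^sup>-\<^sup>l\<close>-th part does so.\<close>

lemma card_descendants_ge:
  assumes w: "w \<in> avoiding_tree \<omega>"
  shows "(1 / 2) ^ (m - 1) * f (shift (length w) \<omega>) j \<le> card (D \<omega> w j)"
proof -
  define n where "n = length w"
  \<comment> \<open>\<open>B l\<close>: the first \<open>l\<close> digits complete the forbidden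
    word that begins at \<open>n + l - m\<close>. Where this subtraction truncates,
    \<open>B l\<close> merely enlarges the union and obeys the same bound.\<close>
  define B where "B l = (\<lambda>v. drop (m - l) (\<omega> (n + l - m)) @ v) `
      AW (shift (n + l) \<omega>) (j - l)" for l
  have "AW (shift n \<omega>) j
      \<subseteq> D \<omega> w j \<union> (\<Union>l\<in>{1..<m} \<inter> {..j}. B l)"
  proof
    fix u assume u: "u \<in> AW (shift n \<omega>) j"
    then have u': "length u = j" "set u \<subseteq> {0..<b}" "avoiding m (shift n \<omega>) u"
      by (auto simp: avoiding_words_def words_def)
    show "u \<in> D \<omega> w j \<union> (\<Union>l\<in>{1..<m} \<inter> {..j}. B l)"
    proof (cases "avoiding m \<omega> (w @ u)")
      case True
      then show ?thesis using u' w by (auto simp: descendants_def avoiding_tree_def)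
    next
      case False
      then obtain i where i: "i + m \<le> n + j" "take m (drop i (w @ u)) = \<omega> i"
        using u' by (auto simp: avoiding_def n_def)
      have "i < n"
      proof (rule ccontr)
        assume "\<not> i < n"
        then have "(i - n) + m \<le> length u" "take m (drop (i - n) u) = shift n \<omega> (i - n)"
          using i u' by (auto simp: n_def shift_def)
        then show False using u'(3) by (auto simp: avoiding_def)
      qed
      have "n < i + m"
      proof (rule ccontr)
        assume "\<not> n < i + m"
        then have "i + m \<le> length w" "take m (drop i w) = \<omega> i" using i by (auto simp: n_def)
        then show False using w by (auto simp: avoiding_def avoiding_tree_def)
      qed
      define l where "l = i + m - n"
      have l: "1 \<le> l" "l < m" "l \<le> j" "n + l - m = i" "n - i = m - l"
        using i \<open>i < n\<close> \<open>n < i + m\<close> by (auto simp: l_def)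
      have "\<omega> i = drop i w @ take l u"
        using i(2) \<open>i < n\<close> l by (simp add: n_def)
      then have "take l u = drop (m - l) (\<omega> (n + l - m))" using l by (simp add: n_def)
      then have "u = drop (m - l) (\<omega> (n + l - m)) @ drop l u" by (metis append_take_drop_id)
      moreover have "drop l u \<in> AW (shift (n + l) \<omega>) (j - l)"
        using avoiding_drop[OF u'(3), of l] u' l set_drop_subset[of l u]
        by (auto simp: avoiding_words_def words_def)
      ultimately have "u \<in> B l" by (auto simp: B_def)
      then show ?thesis using l by auto
    qed
  qed
  then have "f (shift n \<omega>) j \<le> card (D \<omega> w j \<union> (\<Union>l\<in>{1..<m} \<inter> {..j}. B l))"
    using finite_subset[OF descendants_avoiding_tree finite_avoiding_words]
    by (intro card_mono) (auto simp: B_def finite_avoiding_words)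
  also have "\<dots> \<le> card (D \<omega> w j) + card (\<Union>l\<in>{1..<m} \<inter> {..j}. B l)"
    by (rule card_Un_le)
  also have "card (\<Union>l\<in>{1..<m} \<inter> {..j}. B l) \<le> (\<Sum>l\<in>{1..<m} \<inter> {..j}. card (B l))"
    by (rule card_UN_le) simp
  finally have "real (f (shift n \<omega>) j) \<le> card (D \<omega> w j)
      + (\<Sum>l\<in>{1..<m} \<inter> {..j}. real (card (B l)))"
    by (simp flip: of_nat_sum of_nat_add)
  also have "(\<Sum>l\<in>{1..<m} \<inter> {..j}. real (card (B l)))
      \<le> (\<Sum>l\<in>{1..<m} \<inter> {..j}. (1 / 2) ^ l * real (f (shift n \<omega>) j))"
  proof (rule sum_mono)
    fix l assume l: "l \<in> {1..<m} \<inter> {..j}"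
    have "card (B l) \<le> f (shift (n + l) \<omega>) (j - l)"
      unfolding B_def by (rule card_image_le[OF finite_avoiding_words])
    then have "2 ^ l * card (B l) \<le> (b - 1) ^ l * f (shift l (shift n \<omega>)) (j - l)"
      using b_ge3 by (intro mult_mono power_mono) auto
    also have "\<dots> \<le> f (shift n \<omega>) j" using l by (intro f_ge_power_mult) simp
    finally have "real (2 ^ l * card (B l)) \<le> f (shift n \<omega>) j" by (simp only: of_nat_le_iff)
    then show "real (card (B l)) \<le> (1 / 2) ^ l * real (f (shift n \<omega>) j)"
      by (simp add: power_divide field_simps)
  qed
  also have "\<dots> \<le> (\<Sum>l\<in>{1..<m}. (1 / 2) ^ l * real (f (shift n \<omega>) j))"
    by (rule sum_mono2) auto
  also have "\<dots> = (\<Sum>l\<in>{1..<m}. (1 / 2) ^ l) * real (f (shift n \<omega>) j)"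
    by (simp add: sum_distrib_right)
  \<comment> \<open>The missing tail of the geometric series is the surviving share, and hence the
    constant of the tree. The ratio \<open>1 / 2\<close> stems from
    \<open>b - 1 \<ge> 2\<close>.\<close>
  also have "(\<Sum>l\<in>{1..<m}. (1 / 2 :: real) ^ l) = 1 - (1 / 2) ^ (m - 1)"
  proof -
    have "(\<Sum>l\<in>{1..<Suc k}. (1 / 2 :: real) ^ l) = 1 - (1 / 2) ^ k" for k
      by (induction k) (auto simp: field_simps)
    from this[of "m - 1"] show ?thesis using m_ge2 by simp
  qed
  finally show ?thesis by (simp add: n_def algebra_simps)
qed

section \<open>The counts are multiplicative up to a constant\<close>

lemma f_add_eq:
  "f \<omega> (n + j) = (\<Sum>w\<in>AW \<omega> n. card (D \<omega> w j))"
proof -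
  let ?S = "Sigma (AW \<omega> n) (\<lambda>w. D \<omega> w j)"
  have "AW \<omega> (n + j) = (\<lambda>(w, u). w @ u) ` ?S"
  proof (intro equalityI subsetI)
    fix v assume v: "v \<in> AW \<omega> (n + j)"
    then have v': "length v = n + j" "set v \<subseteq> {0..<b}" "avoiding m \<omega> (take n v @ drop n v)"
      by (auto simp: avoiding_words_def words_def)
    have "take n v \<in> AW \<omega> n"
      using v' avoiding_prefix[OF v'(3)] set_take_subset[of n v]
      by (auto simp: avoiding_words_def words_def)
    moreover have "drop n v \<in> D \<omega> (take n v) j"
      using v' by (auto simp: descendants_def avoiding_tree_def dest: in_set_takeD in_set_dropD)
    ultimately show "v \<in> (\<lambda>(w, u). w @ u) ` ?S"
      by (intro image_eqI[of _ _ "(take n v, drop n v)"]) auto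
  qed (auto simp: descendants_def avoiding_tree_def avoiding_words_def words_def subset_iff)
  moreover have "inj_on (\<lambda>(w, u). w @ u) ?S"
    by (auto simp: inj_on_def avoiding_words_def words_def)
  ultimately have "f \<omega> (n + j) = card ?S" by (simp add: card_image)
  also have "\<dots> = (\<Sum>w\<in>AW \<omega> n. card (D \<omega> w j))"
    using finite_subset[OF descendants_avoiding_tree finite_avoiding_words] finite_avoiding_words
    by (intro card_SigmaI) auto
  finally show ?thesis .
qed

lemma f_add_le: "f \<omega> (n + j) \<le> f \<omega> n * f (shift n \<omega>) j"
proof -
  have "f \<omega> (n + j) \<le> (\<Sum>w\<in>AW \<omega> n. f (shift n \<omega>) j)"
    unfolding f_add_eq
  proof (rule sum_mono)
    fix w assume "w \<in> AW \<omega> n"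
    then show "card (D \<omega> w j) \<le> f (shift n \<omega>) j"
      using card_descendants_le[of \<omega> w j] by (simp add: avoiding_words_def words_def)
  qed
  then show ?thesis by simp
qed

text \<open>Together with \<open>f_add_le\<close> this lets growth over consecutive stretches be
  multiplied, with one constant lost at each junction.\<close>

lemma f_add_ge: "(1 / 2) ^ (m - 1) * (f \<omega> n * f (shift n \<omega>) j) \<le> f \<omega> (n + j)"
proof -
  have "(\<Sum>w\<in>AW \<omega> n. (1 / 2) ^ (m - 1) * real (f (shift n \<omega>) j))
      \<le> (\<Sum>w\<in>AW \<omega> n. real (card (D \<omega> w j)))"
  proof (rule sum_mono)
    fix w assume "w \<in> AW \<omega> n"
    then have "w \<in> avoiding_tree \<omega>" "length w = n"
      by (auto simp: avoiding_words_def words_def avoiding_tree_def)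
    then show "(1 / 2) ^ (m - 1) * real (f (shift n \<omega>) j)
        \<le> real (card (D \<omega> w j))"
      using card_descendants_ge[of w \<omega> j] by simp
  qed
  then show ?thesis unfolding f_add_eq by (simp add: mult_ac)
qed

lemma digit_tree_avoiding_tree: "digit_tree b (avoiding_tree \<omega>) ((1 / 2) ^ (m - 1))"
proof
  fix w u v j
  show "b \<ge> 2" using b_ge3 by simp
  show "[] \<in> avoiding_tree \<omega>" using m_ge2 by (auto simp: avoiding_tree_def avoiding_def)
  show "(1 / 2 :: real) ^ (m - 1) > 0" by simp
  show "u @ v \<in> avoiding_tree \<omega> \<Longrightarrow> u \<in> avoiding_tree \<omega>"
    using avoiding_prefix by (auto simp: avoiding_tree_def)
  assume w: "w \<in> avoiding_tree \<omega>"
  then show "set w \<subseteq> {0..<b}" by (simp add: avoiding_tree_def)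
  \<comment> \<open>Homogeneity itself yields a child: the number of descendants at depth 1 has a
    positive lower bound.\<close>
  have "1 \<le> real (f (shift (length w) \<omega>) 1)" using f_pos[of "shift (length w) \<omega>" 1] by simp
  then have "0 < (1 / 2) ^ (m - 1) * real (f (shift (length w) \<omega>) 1)" by (intro mult_pos_pos) auto
  then have "0 < real (card (D \<omega> w 1))"
    using card_descendants_ge[OF w, of 1] by linarith
  then obtain z where "z \<in> D \<omega> w 1" by (auto simp: card_gt_0_iff)
  then show "\<exists>x. w @ [x] \<in> avoiding_tree \<omega>" by (auto simp: descendants_def length_Suc_conv)
  have "(1 / 2) ^ (m - 1) * real (f \<omega> (length w + j))
      \<le> (1 / 2) ^ (m - 1) * (real (f \<omega> (length w)) * real (f (shift (length w) \<omega>) j))"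
    using f_add_le[of \<omega> "length w" j] by (intro mult_left_mono) (simp_all flip: of_nat_mult)
  also have "\<dots> = real (f \<omega> (length w)) * ((1 / 2) ^ (m - 1) * real (f (shift (length w) \<omega>) j))" by simp
  also have "\<dots> \<le> real (f \<omega> (length w)) * real (card (D \<omega> w j))"
    by (intro mult_left_mono card_descendants_ge[OF w]) auto
  finally show "(1 / 2) ^ (m - 1) * real (card (level (avoiding_tree \<omega>) (length w + j)))
      \<le> real (card (level (avoiding_tree \<omega>) (length w)) * card (D \<omega> w j))"
    by (simp add: level_avoiding_tree)
  have "(1 / 2) ^ (m - 1) * (real (f \<omega> (length w)) * real (card (D \<omega> w j)))
      \<le> (1 / 2) ^ (m - 1) * (real (f \<omega> (length w)) * real (f (shift (length w) \<omega>) j))"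
    using card_descendants_le[of \<omega> w j] by (intro mult_left_mono) auto
  also have "\<dots> \<le> f \<omega> (length w + j)" using f_add_ge[of \<omega> "length w" j] by simp
  finally show "(1 / 2) ^ (m - 1) * real (card (level (avoiding_tree \<omega>) (length w))
        * card (D \<omega> w j))
      \<le> real (card (level (avoiding_tree \<omega>) (length w + j)))"
    by (simp add: level_avoiding_tree)
qed

lemma K_set_eq_tree_set: "K_set b m \<omega> = digit_tree.tree_set b (avoiding_tree \<omega>)"
proof -
  interpret digit_tree b "avoiding_tree \<omega>" "(1 / 2) ^ (m - 1)" by (rule digit_tree_avoiding_tree)
  have branch: "e \<in> branches \<longleftrightarrow> (\<forall>i. e i < b) \<and> (\<forall>k. map e [k..<k + m] \<noteq> \<omega> k)" for e
  proof
    assume e: "e \<in> branches"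
    have "map e [k..<k + m] \<noteq> \<omega> k" for k
    proof -
      have "map e [0..<k + m] \<in> avoiding_tree \<omega>" using e by (auto simp: branches_def)
      then have "avoiding m \<omega> (map e [0..<k + m])" by (simp add: avoiding_tree_def)
      then have "take m (drop k (map e [0..<k + m])) \<noteq> \<omega> k"
        unfolding avoiding_def by (elim allE[of _ k]) auto
      then show ?thesis by (simp add: drop_map take_map)
    qed
    with branch_digit[OF e] show "(\<forall>i. e i < b) \<and> (\<forall>k. map e [k..<k + m] \<noteq> \<omega> k)" by blast
  next
    assume e: "(\<forall>i. e i < b) \<and> (\<forall>k. map e [k..<k + m] \<noteq> \<omega> k)"
    have "take m (drop k (map e [0..<n])) = map e [k..<k + m]" if "k + m \<le> n" for k n
      using that by (simp add: drop_map take_map)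
    then have "avoiding m \<omega> (map e [0..<n])" for n using e by (simp add: avoiding_def)
    then have "\<forall>n. map e [0..<n] \<in> avoiding_tree \<omega>" using e by (auto simp: avoiding_tree_def)
    then show "e \<in> branches" by (simp add: branches_def)
  qed
  \<comment> \<open>The digits in \<open>K_set\<close> start at index 1, those of
    \<open>branches\<close> at index 0.\<close>
  have shift1: "map d [k + 1..<k + m + 1] = map (\<lambda>i. d (Suc i)) [k..<k + m]" for d :: "nat \<Rightarrow> nat" and k
    by (simp add: map_Suc_upt[symmetric] comp_def del: upt_Suc)
  show ?thesis
  proof (intro equalityI subsetI)
    fix x assume "x \<in> K_set b m \<omega>"
    then obtain d where d: "x = (\<Sum>i. real (d (Suc i)) / real b ^ Suc i)"
      "\<forall>i\<ge>1. d i \<in> {0..<b}" "\<forall>k. map d [k + 1..<k + m + 1] \<noteq> \<omega> k"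
      unfolding K_set_def by blast
    then have "(\<lambda>i. d (Suc i)) \<in> branches" unfolding branch shift1 by simp
    then show "x \<in> tree_set" unfolding tree_set_def d(1) digit_val_def
      by (intro image_eqI[of _ _ "\<lambda>i. d (Suc i)"]) auto
  next
    fix x assume "x \<in> tree_set"
    then obtain e where e: "e \<in> branches" "x = digit_val b e" by (auto simp: tree_set_def)
    define d where "d i = e (i - 1)" for i
    have "(\<lambda>i. d (Suc i)) = e" by (simp add: d_def)
    then have "\<forall>k. map d [k + 1..<k + m + 1] \<noteq> \<omega> k" using e(1) unfolding branch shift1 by simp
    moreover have "\<forall>i\<ge>1. d i \<in> {0..<b}" using e(1) unfolding branch by (simp add: d_def)
    moreover have "x = (\<Sum>i. real (d (Suc i)) / real b ^ Suc i)"
      unfolding e(2) digit_val_def by (simp add: d_def)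
    ultimately show "x \<in> K_set b m \<omega>" unfolding K_set_def by blast
  qed
qed

end

section \<open>Prescribing the growth of the trees\<close>

lemma sum_odd: "(\<Sum>k<K. 2 * real k + 1) = (real K)\<^sup>2"
  by (induction K) (auto simp: power2_eq_square algebra_simps)

text \<open>Mixing the rates \<open>p\<close> and \<open>q\<close> with weight
  \<open>(s k - q) / (p - q)\<close> on \<open>p\<close> gives the mean rate \<open>s k\<close> on
  the \<open>2 * k + 1\<close> positions of block \<open>k\<close>.\<close>

definition block_len :: "real \<Rightarrow> real \<Rightarrow> (nat \<Rightarrow> real) \<Rightarrow> nat \<Rightarrow> nat" where
  "block_len q p s k = nat \<lfloor>(s k - q) / (p - q) * (2 * real k + 1)\<rfloor>"

text \<open>The block \<open>{k\<^sup>2..<(k + 1)\<^sup>2}\<close> starts with \<open>block_len q p s k\<close> positions of fast growth.\<close>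

definition block_type :: "real \<Rightarrow> real \<Rightarrow> (nat \<Rightarrow> real) \<Rightarrow> nat \<Rightarrow> bool" where
  "block_type q p s i \<longleftrightarrow> i - (floor_sqrt i)\<^sup>2 < block_len q p s (floor_sqrt i)"

lemma block_len_bounds:
  fixes p q :: real
  assumes "q < p" "q \<le> s k" "s k \<le> p"
  shows "block_len q p s k \<le> 2 * k + 1"
    and "(p - q) * block_len q p s k \<le> (s k - q) * (2 * real k + 1)"
    and "(p - q) * block_len q p s k \<ge> (s k - q) * (2 * real k + 1) - (p - q)"
    and "block_len q p s k \<ge> (s k - q) / (p - q) * (2 * real k + 1) - 1"
proof -
  define x where "x = (s k - q) / (p - q) * (2 * real k + 1)"
  have t: "0 \<le> (s k - q) / (p - q)" "(s k - q) / (p - q) \<le> 1" using assms by auto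
  have "0 \<le> x" unfolding x_def using t by (intro mult_nonneg_nonneg) auto
  moreover have "x \<le> 1 * (2 * real k + 1)" unfolding x_def using t by (intro mult_right_mono) auto
  then have "x \<le> 2 * real k + 1" by simp
  ultimately have len: "real (block_len q p s k) \<le> x" "real (block_len q p s k) > x - 1"
      "real (block_len q p s k) \<le> 2 * real k + 1"
    unfolding block_len_def x_def[symmetric] by linarith+
  then show "block_len q p s k \<le> 2 * k + 1" by linarith
  show "real (block_len q p s k) \<ge> (s k - q) / (p - q) * (2 * real k + 1) - 1"
    using len(2) by (simp add: x_def)
  have px: "(p - q) * x = (s k - q) * (2 * real k + 1)" using assms(1) by (simp add: x_def)
  show "(p - q) * block_len q p s k \<le> (s k - q) * (2 * real k + 1)"
    unfolding px[symmetric] using len(1) assms(1) by (intro mult_left_mono) auto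
  have "(p - q) * (x - 1) \<le> (p - q) * real (block_len q p s k)"
    using len(2) assms(1) by (intro mult_left_mono) auto
  then show "(p - q) * block_len q p s k \<ge> (s k - q) * (2 * real k + 1) - (p - q)"
    using px by (simp add: algebra_simps)
qed

lemma block_type_iff:
  assumes "i < 2 * k + 1"
  shows "block_type q p s (k\<^sup>2 + i) \<longleftrightarrow> i < block_len q p s k"
proof -
  have "floor_sqrt (k\<^sup>2 + i) = k"
    using assms by (intro floor_sqrt_unique) (auto simp: power2_eq_square)
  then show ?thesis by (simp add: block_type_def)
qed

text \<open>The iterated logarithm keeps the value constant from \<open>2 ^ 2 ^ j\<close> up to its
  square, with the parity of \<open>j\<close> choosing between \<alpha> and \<beta>.\<close>

definition oscillate :: "real \<Rightarrow> real \<Rightarrow> nat \<Rightarrow> real" where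
  "oscillate \<alpha> \<beta> k = (if even (floor_log (floor_log k)) then \<alpha> else \<beta>)"

lemma floor_log_floor_log:
  assumes "2 ^ (2 ^ j) \<le> k" "k < (2 ^ (2 ^ j))\<^sup>2"
  shows "floor_log (floor_log k) = j"
proof -
  have k: "k > 0" using assms(1) by (metis gr0I le_zero_eq power_not_zero zero_neq_numeral)
  have 1: "2 ^ j \<le> floor_log k" using floor_log_le_iff[OF assms(1)] by simp
  have 2: "floor_log k < 2 * 2 ^ j"
  proof (rule ccontr)
    assume "\<not> ?thesis"
    then have "(2::nat) ^ (2 * 2 ^ j) \<le> 2 ^ floor_log k" by (intro power_increasing) auto
    also have "\<dots> \<le> k" by (rule floor_log_exp2_le[OF k])
    also have "\<dots> < (2 ^ (2 ^ j))\<^sup>2" by (rule assms(2))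
    finally show False by (simp add: power_mult[symmetric] mult.commute)
  qed
  show ?thesis using 1 2 by (intro floor_log_eqI) (auto intro: less_le_trans[of 0 "2 ^ j"])
qed

lemma oscillate_sum_bounds:
  fixes \<alpha> \<beta> :: real
  assumes "\<alpha> \<le> \<beta>"
  shows "(\<Sum>k<K. (2 * real k + 1) * oscillate \<alpha> \<beta> k) \<ge> \<alpha> * (real K)\<^sup>2"
    and "(\<Sum>k<K. (2 * real k + 1) * oscillate \<alpha> \<beta> k) \<le> \<beta> * (real K)\<^sup>2"
  unfolding sum_odd[symmetric] sum_distrib_left
  using assms by (auto intro!: sum_mono simp: oscillate_def mult.commute[of \<alpha>] mult.commute[of \<beta>] mult_left_mono)

text \<open>For \<open>K = (2 ^ 2 ^ j)\<^sup>2\<close> the stretch of constancy \<open>{2 ^ 2 ^ j..<K}\<close> outweighs everything before it,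
  which contributes only \<open>O(K)\<close>.\<close>

lemma oscillate_sum_extreme:
  fixes \<alpha> \<beta> :: real
  assumes "\<alpha> \<le> \<beta>"
  shows "\<exists>K\<ge>N. (\<Sum>k<K. (2 * real k + 1) * oscillate \<alpha> \<beta> k) \<le> \<alpha> * (real K)\<^sup>2 + (\<beta> - \<alpha>) * K"
    and "\<exists>K\<ge>N. (\<Sum>k<K. (2 * real k + 1) * oscillate \<alpha> \<beta> k) \<ge> \<beta> * (real K)\<^sup>2 - (\<beta> - \<alpha>) * K"
proof -
  have split: "(\<Sum>k<M\<^sup>2. g k) = (\<Sum>k<M. g k) + (\<Sum>k\<in>{M..<M\<^sup>2}. g k)" if "M \<ge> 1"
    for g :: "nat \<Rightarrow> real" and M :: nat
  proof -
    have "{..<M\<^sup>2} = {..<M} \<union> {M..<M\<^sup>2}" using self_le_power[OF that, of 2] by auto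
    then show ?thesis by (simp add: sum.union_disjoint ivl_disj_int)
  qed
  have large: "N \<le> (2 ^ (2 ^ j))\<^sup>2" if "N \<le> j" for j :: nat
  proof -
    have "j < 2 ^ j" "(2::nat) ^ j < 2 ^ (2 ^ j)" by simp_all
    moreover have "(2::nat) ^ (2 ^ j) \<le> (2 ^ (2 ^ j))\<^sup>2" by (intro self_le_power) auto
    ultimately show ?thesis using that by linarith
  qed
  have tail: "(\<Sum>k\<in>{M..<M\<^sup>2}. (2 * real k + 1) * oscillate \<alpha> \<beta> k) = x * ((real (M\<^sup>2))\<^sup>2 - (real M)\<^sup>2)"
    if "M = 2 ^ (2 ^ j)" "x = (if even j then \<alpha> else \<beta>)" for M j x
  proof -
    have "(\<Sum>k\<in>{M..<M\<^sup>2}. (2 * real k + 1) * oscillate \<alpha> \<beta> k) = (\<Sum>k\<in>{M..<M\<^sup>2}. x * (2 * real k + 1))"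
      by (rule sum.cong) (use that floor_log_floor_log in \<open>auto simp: oscillate_def mult.commute\<close>)
    also have "\<dots> = x * ((\<Sum>k<M\<^sup>2. 2 * real k + 1) - (\<Sum>k<M. 2 * real k + 1))"
      using split[of M "\<lambda>k. 2 * real k + 1"] that by (simp add: sum_distrib_left[symmetric])
    finally show ?thesis by (simp only: sum_odd)
  qed
  \<comment> \<open>Even exponents select \<alpha>, odd ones \<beta>; taking them at least
    \<open>N\<close> makes the square of \<open>M\<close> at least \<open>N\<close>.\<close>
  define j where "j = 2 * N"
  define M :: nat where "M = 2 ^ (2 ^ j)"
  have "(\<Sum>k<M\<^sup>2. (2 * real k + 1) * oscillate \<alpha> \<beta> k)
      \<le> \<beta> * (real M)\<^sup>2 + \<alpha> * ((real (M\<^sup>2))\<^sup>2 - (real M)\<^sup>2)"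
    using split[of M] tail[of M j \<alpha>] oscillate_sum_bounds(2)[OF assms, of M] by (simp add: M_def j_def)
  also have "\<dots> = \<alpha> * (real (M\<^sup>2))\<^sup>2 + (\<beta> - \<alpha>) * real (M\<^sup>2)" by (simp add: algebra_simps)
  finally show "\<exists>K\<ge>N. (\<Sum>k<K. (2 * real k + 1) * oscillate \<alpha> \<beta> k) \<le> \<alpha> * (real K)\<^sup>2 + (\<beta> - \<alpha>) * K"
    using large[of j] by (intro exI[of _ "M\<^sup>2"]) (auto simp: M_def j_def)
  define j' where "j' = 2 * N + 1"
  define M' :: nat where "M' = 2 ^ (2 ^ j')"
  have "\<beta> * (real (M'\<^sup>2))\<^sup>2 - (\<beta> - \<alpha>) * real (M'\<^sup>2)
      = \<alpha> * (real M')\<^sup>2 + \<beta> * ((real (M'\<^sup>2))\<^sup>2 - (real M')\<^sup>2)" by (simp add: algebra_simps)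
  also have "\<dots> \<le> (\<Sum>k<M'\<^sup>2. (2 * real k + 1) * oscillate \<alpha> \<beta> k)"
    using split[of M'] tail[of M' j' \<beta>] oscillate_sum_bounds(1)[OF assms, of M'] by (simp add: M'_def j'_def)
  finally show "\<exists>K\<ge>N. (\<Sum>k<K. (2 * real k + 1) * oscillate \<alpha> \<beta> k) \<ge> \<beta> * (real K)\<^sup>2 - (\<beta> - \<alpha>) * K"
    using large[of j'] by (intro exI[of _ "M'\<^sup>2"]) (auto simp: M'_def j'_def)
qed

text \<open>Here \<open>L\<close> is the logarithm of the number of nodes of a level.\<close>

lemma block_growth:
  fixes L :: "nat \<Rightarrow> real" and p q D :: real
  assumes "q < p" "D \<ge> 0" "L 0 = 0" and s: "\<And>k. q \<le> s k" "\<And>k. s k \<le> p"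
    and slow: "\<And>n j. L (n + j) \<ge> L n + q * j - D"
    and fast: "\<And>n j. L (n + j) \<le> L n + p * j + D"
    and fast_run: "\<And>n j. (\<And>i. n \<le> i \<Longrightarrow> i < n + j \<Longrightarrow> block_type q p s i) \<Longrightarrow> L (n + j) \<ge> L n + p * j - D"
    and slow_run: "\<And>n j. (\<And>i. n \<le> i \<Longrightarrow> i < n + j \<Longrightarrow> \<not> block_type q p s i) \<Longrightarrow> L (n + j) \<le> L n + q * j + D"
  shows "\<bar>L (K\<^sup>2) - (\<Sum>k<K. (2 * real k + 1) * s k)\<bar> \<le> (2 * D + (p - q)) * K"
proof (induction K)
  case 0
  then show ?case using assms(3) by simp
next
  case (Suc k)
  \<comment> \<open>One block is a fast run of length \<open>c\<close> followed by a slow run: each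
    run costs \<open>D\<close>, and rounding \<open>c\<close> down costs at most
    \<open>p - q\<close>.\<close>
  define c where "c = block_len q p s k"
  note len = block_len_bounds[of q p s k, OF assms(1) s, folded c_def]
  have sq: "k\<^sup>2 + c + (2 * k + 1 - c) = (Suc k)\<^sup>2" using len(1) by (simp add: power2_eq_square)
  have r: "real (2 * k + 1 - c) = 2 * real k + 1 - real c" using len(1) by (simp add: of_nat_diff)
  have "L (k\<^sup>2 + c) \<ge> L (k\<^sup>2) + p * c - D"
  proof (rule fast_run)
    fix i assume "k\<^sup>2 \<le> i" "i < k\<^sup>2 + c"
    then show "block_type q p s i" using block_type_iff[of "i - k\<^sup>2" k q p s] len(1) by (simp add: c_def)
  qed
  moreover have "L (k\<^sup>2 + c + (2 * k + 1 - c)) \<le> L (k\<^sup>2 + c) + q * real (2 * k + 1 - c) + D"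
  proof (rule slow_run)
    fix i assume "k\<^sup>2 + c \<le> i" "i < k\<^sup>2 + c + (2 * k + 1 - c)"
    then show "\<not> block_type q p s i" using block_type_iff[of "i - k\<^sup>2" k q p s] len(1) by (simp add: c_def)
  qed
  moreover note fast[of "k\<^sup>2" c] slow[of "k\<^sup>2 + c" "2 * k + 1 - c"]
  ultimately have "L ((Suc k)\<^sup>2) \<le> L (k\<^sup>2) + (p * c + q * (2 * real k + 1 - c)) + 2 * D"
    "L ((Suc k)\<^sup>2) \<ge> L (k\<^sup>2) + (p * c + q * (2 * real k + 1 - c)) - 2 * D"
    unfolding sq r by linarith+
  moreover have "p * c + q * (2 * real k + 1 - c) = q * (2 * real k + 1) + (p - q) * c"
    by (simp add: algebra_simps)
  moreover have "(2 * real k + 1) * s k = q * (2 * real k + 1) + (s k - q) * (2 * real k + 1)"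
    by (simp add: algebra_simps)
  ultimately have "\<bar>L ((Suc k)\<^sup>2) - L (k\<^sup>2) - (2 * real k + 1) * s k\<bar> \<le> 2 * D + (p - q)"
    using len(2,3) assms(1) by linarith
  moreover have "(2 * D + (p - q)) * real (Suc k) = (2 * D + (p - q)) * real k + (2 * D + (p - q))"
    by (simp add: algebra_simps)
  ultimately show ?case using Suc by simp
qed

text \<open>Completing the square: an error of order \<open>sqrt n\<close>, such as that of
  \<open>block_growth\<close>, is swallowed by \<epsilon>\<open>* n\<close> and a constant.\<close>

lemma sqrt_error_absorbed:
  fixes G \<epsilon> :: real
  assumes "\<epsilon> > 0" "K\<^sup>2 \<le> n"
  shows "G * real K \<le> \<epsilon> * real n + G\<^sup>2 / (4 * \<epsilon>)"
proof -
  have "0 \<le> (2 * \<epsilon> * real K - G)\<^sup>2" by simp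
  then have "G * real K \<le> \<epsilon> * (real K)\<^sup>2 + G\<^sup>2 / (4 * \<epsilon>)"
    using assms(1) by (simp add: power2_eq_square field_simps)
  also have "\<epsilon> * (real K)\<^sup>2 \<le> \<epsilon> * real n"
    using assms by (intro mult_left_mono) (metis of_nat_le_iff of_nat_power, simp)
  finally show ?thesis by simp
qed

text \<open>In order, the clauses are what the tree bounds require for the Hausdorff dimension from
  below, packing from above, Hausdorff from above and packing from below.\<close>

lemma oscillating_growth:
  fixes L :: "nat \<Rightarrow> real" and p q D \<alpha> \<beta> \<epsilon> :: real
  assumes "q < p" "D \<ge> 0" "L 0 = 0" and \<alpha>: "0 \<le> q" "q \<le> \<alpha>" "\<alpha> \<le> \<beta>" "\<beta> \<le> p"
    and slow: "\<And>n j. L (n + j) \<ge> L n + q * j - D"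
    and fast: "\<And>n j. L (n + j) \<le> L n + p * j + D"
    and fast_run: "\<And>n j. (\<And>i. n \<le> i \<Longrightarrow> i < n + j \<Longrightarrow> block_type q p (oscillate \<alpha> \<beta>) i)
      \<Longrightarrow> L (n + j) \<ge> L n + p * j - D"
    and slow_run: "\<And>n j. (\<And>i. n \<le> i \<Longrightarrow> i < n + j \<Longrightarrow> \<not> block_type q p (oscillate \<alpha> \<beta>) i)
      \<Longrightarrow> L (n + j) \<le> L n + q * j + D"
    and "\<epsilon> > 0"
  shows "\<exists>H. (\<forall>n. L n \<ge> (\<alpha> - \<epsilon>) * n - H) \<and> (\<forall>n. L n \<le> (\<beta> + \<epsilon>) * n + H)
     \<and> (\<forall>N. \<exists>n\<ge>N. L n \<le> (\<alpha> + \<epsilon>) * n + H) \<and> (\<forall>N. \<exists>n\<ge>N. L n \<ge> (\<beta> - \<epsilon>) * n - H)"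
proof -
  define E where "E = 2 * D + (p - q)"
  define S where "S K = (\<Sum>k<K. (2 * real k + 1) * oscillate \<alpha> \<beta> k)" for K
  have osc: "q \<le> oscillate \<alpha> \<beta> k" "oscillate \<alpha> \<beta> k \<le> p" for k
    using \<alpha> by (auto simp: oscillate_def)
  have LS: "\<bar>L (K\<^sup>2) - S K\<bar> \<le> E * K" for K
    unfolding E_def S_def
    by (rule block_growth[OF assms(1-3) osc slow fast fast_run slow_run])
  \<comment> \<open>\<open>E\<close> collects the errors per block, \<open>2 * p\<close> the
    unfinished last block, and \<beta>\<open>-\<close>\<alpha> the error of
    \<open>oscillate_sum_extreme\<close>.\<close>
  define G where "G = E + 2 * p + (\<beta> - \<alpha>)"
  define H where "H = G\<^sup>2 / (4 * \<epsilon>) + D"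
  have E0: "E \<ge> 0" "p \<ge> 0" "0 \<le> \<alpha>" "0 \<le> \<beta>" using assms by (auto simp: E_def)
  have absorb: "G * real K + D \<le> \<epsilon> * real n + H" if "K\<^sup>2 \<le> n" for K n
    using sqrt_error_absorbed[OF assms(12) that, of G] by (simp add: H_def)
  have dist: "x * (real K)\<^sup>2 \<le> x * real n \<and> x * real n \<le> x * (real K)\<^sup>2 + 2 * x * real K"
    if "x \<ge> 0" "K = floor_sqrt n" for x :: real and K n
  proof -
    have "K\<^sup>2 \<le> n" "n < (Suc K)\<^sup>2" using that Suc_floor_sqrt_power2_gt[of n] by auto
    then have "n \<le> K\<^sup>2 + 2 * K" by (simp add: power2_eq_square)
    then have "real n \<le> real (K\<^sup>2 + 2 * K)" "real (K\<^sup>2) \<le> real n"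
      using \<open>K\<^sup>2 \<le> n\<close> by (simp_all only: of_nat_le_iff)
    then have "real n \<le> (real K)\<^sup>2 + 2 * real K" "(real K)\<^sup>2 \<le> real n" by simp_all
    from mult_left_mono[OF this(1) that(1)] mult_left_mono[OF this(2) that(1)]
    show ?thesis by (simp add: distrib_left mult_ac)
  qed
  have part: "L (K\<^sup>2) - D \<le> L n \<and> L n \<le> L (K\<^sup>2) + 2 * p * real K + D"
    if K: "K = floor_sqrt n" for K n
  proof -
    have "K\<^sup>2 \<le> n" using K by simp
    then have n: "K\<^sup>2 + (n - K\<^sup>2) = n" by simp
    have "p * real (n - K\<^sup>2) \<le> 2 * p * real K"
      using dist[OF E0(2) K] \<open>K\<^sup>2 \<le> n\<close> by (simp add: of_nat_diff algebra_simps)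
    moreover have "0 \<le> q * real (n - K\<^sup>2)" using \<alpha>(1) by simp
    ultimately show ?thesis using slow[of "K\<^sup>2" "n - K\<^sup>2"] fast[of "K\<^sup>2" "n - K\<^sup>2"] unfolding n by linarith
  qed
  have GK: "G * real K = E * real K + 2 * p * real K + (\<beta> - \<alpha>) * real K" for K :: nat
    by (simp add: G_def algebra_simps)
  have "L n \<ge> (\<alpha> - \<epsilon>) * n - H" for n
  proof -
    define K where "K = floor_sqrt n"
    have "S K \<ge> \<alpha> * (real K)\<^sup>2" unfolding S_def by (rule oscillate_sum_bounds(1)[OF \<alpha>(3)])
    moreover have "2 * \<alpha> * real K \<le> 2 * p * real K" using \<alpha> by (intro mult_right_mono) auto
    moreover have "0 \<le> (\<beta> - \<alpha>) * real K" using \<alpha> by simp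
    ultimately have "L n \<ge> \<alpha> * real n - (\<epsilon> * real n + H)"
      using LS[of K] part[OF K_def] dist[OF E0(3) K_def] absorb[of K n] GK[of K] by (auto simp: K_def)
    then show ?thesis by (simp add: algebra_simps)
  qed
  moreover have "L n \<le> (\<beta> + \<epsilon>) * n + H" for n
  proof -
    define K where "K = floor_sqrt n"
    have "S K \<le> \<beta> * (real K)\<^sup>2" unfolding S_def by (rule oscillate_sum_bounds(2)[OF \<alpha>(3)])
    moreover have "0 \<le> (\<beta> - \<alpha>) * real K" using \<alpha> by simp
    ultimately have "L n \<le> \<beta> * real n + (\<epsilon> * real n + H)"
      using LS[of K] part[OF K_def] dist[OF E0(4) K_def] absorb[of K n] GK[of K] by (auto simp: K_def)
    then show ?thesis by (simp add: algebra_simps)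
  qed
  moreover have "\<exists>n\<ge>N. L n \<le> (\<alpha> + \<epsilon>) * n + H" for N
  proof -
    obtain K where K: "K \<ge> N" "S K \<le> \<alpha> * (real K)\<^sup>2 + (\<beta> - \<alpha>) * K"
      using oscillate_sum_extreme(1)[OF \<alpha>(3), of N] unfolding S_def by blast
    have "N \<le> K\<^sup>2" using K(1) by (simp add: power2_eq_square) (metis le_square le_trans)
    moreover have "0 \<le> 2 * p * real K" using E0 by simp
    then have "L (K\<^sup>2) \<le> \<alpha> * (real K)\<^sup>2 + (\<epsilon> * real (K\<^sup>2) + H)"
      using LS[of K] K(2) absorb[of K "K\<^sup>2"] GK[of K] assms(2) by linarith
    ultimately show ?thesis by (intro exI[of _ "K\<^sup>2"]) (simp add: algebra_simps)
  qed
  moreover have "\<exists>n\<ge>N. L n \<ge> (\<beta> - \<epsilon>) * n - H" for N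
  proof -
    obtain K where K: "K \<ge> N" "S K \<ge> \<beta> * (real K)\<^sup>2 - (\<beta> - \<alpha>) * K"
      using oscillate_sum_extreme(2)[OF \<alpha>(3), of N] unfolding S_def by blast
    have "N \<le> K\<^sup>2" using K(1) by (simp add: power2_eq_square) (metis le_square le_trans)
    moreover have "0 \<le> 2 * p * real K" using E0 by simp
    then have "L (K\<^sup>2) \<ge> \<beta> * (real K)\<^sup>2 - (\<epsilon> * real (K\<^sup>2) + H)"
      using LS[of K] K(2) absorb[of K "K\<^sup>2"] GK[of K] assms(2) by linarith
    ultimately show ?thesis by (intro exI[of _ "K\<^sup>2"]) (simp add: algebra_simps)
  qed
  ultimately show ?thesis by blast
qed

section \<open>The dimension of a family of word sequences\<close>

lemma word_seq_dist_agree: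
  assumes "b \<ge> 2" "m \<ge> 1" "word_seq_dist b m x y \<le> 1 / (real b ^ m) ^ n" "k < n"
  shows "x k = y k"
proof (rule ccontr)
  assume ne: "x k \<noteq> y k"
  define i where "i = Inf {k. x k \<noteq> y k}"
  have "i \<le> k" unfolding i_def using ne by (intro cInf_lower) auto
  then have "m * i < m * n" using assms(2,4) by simp
  have "x \<noteq> y" using ne by auto
  then have "real b powr (- real (m * i)) \<le> 1 / (real b ^ m) ^ n"
    using assms(3) by (simp add: word_seq_dist_def i_def del: of_nat_mult)
  also have "\<dots> = real b powr (- real (m * n))"
    using assms(1) by (simp add: powr_minus_divide powr_realpow power_mult[symmetric] del: of_nat_mult)
  finally show False using \<open>m * i < m * n\<close> assms(1) by (simp add: powr_le_cancel_iff del: of_nat_mult)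
qed

text \<open>Words at consecutive positions overlap as much as possible where \<open>t\<close> holds, and are
  incompatible where it does not. In both cases they are determined by the free digit sequence \<open>a\<close>.\<close>

definition extremal_seq :: "nat \<Rightarrow> nat \<Rightarrow> (nat \<Rightarrow> bool) \<Rightarrow> (nat \<Rightarrow> nat) \<Rightarrow> nat \<Rightarrow> nat list" where
  "extremal_seq b m t a k = map a [k..<k + m - 1] @
     [if t k then a (k + m - 1) else (a (k + m - 1) + 1) mod b]"

context avoidance
begin

lemma extremal_seq_in: "(\<And>i. a i < b) \<Longrightarrow> extremal_seq b m t a \<in> word_seqs b m"
  using m_ge2 b_ge3 by (auto simp: extremal_seq_def word_seqs_def words_def)

text \<open>As \<open>m \<ge> 2\<close>, the first digit of word \<open>k\<close> is
  \<open>a k\<close> in both cases, so two sequences within \<open>b powr (- m * n)\<close> come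
  from the same first \<open>n\<close> digits of \<open>a\<close>. Each covering set thus selects at
  most one node of the full \<open>b\<close>-ary tree, and \<open>b powr (- n)\<close> is the power
  \<open>1 / m\<close> of its scale.\<close>

lemma hausdorff_dim_extremal_seqs:
  assumes A: "\<And>a. (\<And>i. a i < b) \<Longrightarrow> extremal_seq b m t a \<in> A"
  shows "ereal (1 / real m) \<le> hausdorff_dim (word_seq_metric b m) A"
proof (rule hausdorff_dim_ge[of "real b ^ m" 1])
  show "1 < real b ^ m" using b_ge3 m_ge2 by (intro one_less_power) auto
  show "(0::real) < 1" by simp
  fix U :: "nat \<Rightarrow> (nat \<Rightarrow> nat list) set" and n :: "nat \<Rightarrow> nat"
  assume U: "A \<subseteq> (\<Union>i. U i)"
    and d: "\<And>i x y. x \<in> U i \<Longrightarrow> y \<in> U i \<Longrightarrow> mdist (word_seq_metric b m) x y \<le> 1 / (real b ^ m) ^ n i"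
  \<comment> \<open>The tree of all free sequences \<open>a\<close>; here homogeneity holds with
    constant 1.\<close>
  define T where "T = {w. set w \<subseteq> {0..<b}}"
  have lev: "level T k = words b k" for k by (auto simp: level_def T_def words_def)
  have desc: "descendants T w j = words b j" if "w \<in> T" for w j
    using that by (auto simp: descendants_def T_def words_def)
  interpret T: digit_tree b T 1
  proof
    fix w assume "w \<in> T"
    then show "\<exists>x. w @ [x] \<in> T" using b_ge3 by (intro exI[of _ 0]) (auto simp: T_def)
  qed (use b_ge3 in \<open>auto simp: lev desc finite_words power_add\<close>, auto simp: T_def)
  define S where "S i = {w \<in> words b (n i). \<exists>a. (\<forall>k. a k < b) \<and> map a [0..<n i] = w
      \<and> extremal_seq b m t a \<in> U i}" for i
  have "\<exists>k. 1 \<le> (\<Sum>i<k. real 1 / (1 * real (card (level T (n i)))))"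
  proof (rule T.bar_weight[of S])
    show "S i \<subseteq> level T (n i)" for i by (auto simp: S_def lev)
    show "card (S i) \<le> 1" for i
    proof -
      have "v = w" if vw: "v \<in> S i" "w \<in> S i" for v w
      proof -
        obtain a a' where a: "map a [0..<n i] = v" "extremal_seq b m t a \<in> U i"
          "map a' [0..<n i] = w" "extremal_seq b m t a' \<in> U i" using vw unfolding S_def by blast
        have "a k = a' k" if "k < n i" for k
        proof -
          have "word_seq_dist b m (extremal_seq b m t a) (extremal_seq b m t a') \<le> 1 / (real b ^ m) ^ n i"
            using d[OF a(2,4)] b_ge3 by (simp add: mdist_word_seq_metric)
          then have "extremal_seq b m t a k = extremal_seq b m t a' k"
            using b_ge3 m_ge2 that by (intro word_seq_dist_agree[of b m]) auto
          then have "map a [k..<k + m - 1] = map a' [k..<k + m - 1]" by (simp add: extremal_seq_def)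
          moreover have "k \<in> set [k..<k + m - 1]" using m_ge2 by auto
          ultimately show ?thesis by (metis map_eq_conv)
        qed
        then show ?thesis using a(1,3) by (auto intro: nth_equalityI)
      qed
      moreover have "finite (S i)" using finite_words(1) by (simp add: S_def)
      ultimately show ?thesis by (simp add: card_le_Suc0_iff_eq)
    qed
    fix a assume a: "a \<in> T.branches"
    have ab: "a k < b" for k by (rule T.branch_digit[OF a])
    then obtain i where "extremal_seq b m t a \<in> U i" using A[of a] U by blast
    then have "map a [0..<n i] \<in> S i" using ab by (auto simp: S_def words_def)
    then show "\<exists>i. map a [0..<n i] \<in> S i" ..
  qed
  then obtain k where "1 \<le> (\<Sum>i<k. real 1 / (1 * real (card (level T (n i)))))" ..
  moreover have "real 1 / (1 * real (card (level T (n i)))) = (real b ^ m) powr (- (1 / real m) * real (n i))" for i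
    using b_ge3 m_ge2 by (simp add: lev finite_words powr_realpow[symmetric] powr_powr powr_minus_divide)
  ultimately show "\<exists>k. 1 \<le> (\<Sum>i<k. (real b ^ m) powr (- (1 / real m) * real (n i)))" by auto
qed

end

section \<open>Extremal growth rates\<close>

locale extremal_growth = avoidance +
  fixes lam eta :: real
  assumes lam: "real b - 1 < lam" "lam < real b" "lam ^ m - (real b - 1) * (\<Sum>i<m. lam ^ i) = 0"
    and eta: "real b - 1 < eta" "eta < real b" "eta ^ m - real b * eta ^ (m - 1) + 1 = 0"
begin

definition p :: real where "p = ln lam / ln (real b)"

definition q :: real where "q = ln eta / ln (real b)"

text \<open>The constant of \<open>f_le_eta_power\<close>. It also dominates the factor
  \<open>b ^ m\<close> of \<open>f_le_lambda_power\<close> and the loss \<open>2 ^ (m - 1)\<close>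
  of \<open>f_add_ge\<close>, so one constant serves all four growth bounds.\<close>

definition growth_const :: real where
  "growth_const = real b ^ m / (1 - real (m - 1) / eta ^ m)"

lemma bounds: "lam > 2" "eta > 2" "real b > 1"
  using lam(1) eta(1) b_ge3 by linarith+

lemma powr_p: "real b powr (p * real j) = lam ^ j"
  and powr_q: "real b powr (q * real j) = eta ^ j"
proof -
  have "real b powr (ln x / ln (real b) * real j) = x ^ j" if "x > 0" for x
  proof -
    have "real b powr (ln x / ln (real b)) = x"
      using powr_log_cancel[of "real b" x] that bounds by (simp add: log_def)
    moreover have "real b powr (ln x / ln (real b) * real j)
        = (real b powr (ln x / ln (real b))) powr real j" by (simp add: powr_powr)
    ultimately show ?thesis using that by (simp add: powr_realpow)
  qed
  then show "real b powr (p * real j) = lam ^ j" "real b powr (q * real j) = eta ^ j"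
    using bounds by (simp_all add: p_def q_def)
qed

text \<open>Multiplying by \<open>eta - 1\<close> shows that
  \<open>(b - 1) * (\<Sum>i<m. eta ^ i)\<close> exceeds \<open>eta ^ m\<close>, the surplus being
  \<open>eta - (b - 1) > 0\<close> after the multiplication. Since
  \<open>(\<Sum>i<m. x ^ i) / x ^ m\<close> decreases in \<open>x\<close>, the point of equality
  \<open>lam\<close> lies further right.\<close>

lemma eta_less_lam: "eta < lam"
proof (rule ccontr)
  assume "\<not> eta < lam"
  then have le: "lam \<le> eta" by simp
  have geo: "(eta - 1) * (\<Sum>i<m. eta ^ i) = eta ^ m - 1"
    using power_diff_1_eq[of eta m] by simp
  have e: "eta ^ m = eta * eta ^ (m - 1)" using m_ge2 by (metis Suc_diff_1 less_le_trans pos2 power_Suc)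
  have "(eta - 1) * ((real b - 1) * (\<Sum>i<m. eta ^ i) - eta ^ m)
      = (real b - 1) * (eta ^ m - 1) - (eta - 1) * eta ^ m"
    unfolding geo[symmetric] by (simp add: algebra_simps)
  also have "\<dots> = eta * (real b * eta ^ (m - 1) - eta ^ m) - (real b - 1)"
    unfolding e by (simp add: algebra_simps)
  also have "real b * eta ^ (m - 1) - eta ^ m = 1" using eta(3) by simp
  finally have "0 < (eta - 1) * ((real b - 1) * (\<Sum>i<m. eta ^ i) - eta ^ m)" using eta(1) by linarith
  then have gt: "eta ^ m < (real b - 1) * (\<Sum>i<m. eta ^ i)" using bounds by (simp add: zero_less_mult_iff)
  have "(\<Sum>i<m. eta ^ i) * lam ^ m \<le> (\<Sum>i<m. lam ^ i) * eta ^ m"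
    unfolding sum_distrib_right
  proof (rule sum_mono)
    fix i assume "i \<in> {..<m}"
    then have "lam ^ m = lam ^ i * lam ^ (m - i)" "eta ^ m = eta ^ i * eta ^ (m - i)"
      by (simp_all add: power_add[symmetric])
    moreover have "lam ^ (m - i) \<le> eta ^ (m - i)" using le bounds by (intro power_mono) auto
    ultimately show "eta ^ i * lam ^ m \<le> lam ^ i * eta ^ m"
      using bounds by (simp add: mult_left_mono mult_ac)
  qed
  then have "(real b - 1) * (\<Sum>i<m. eta ^ i) * lam ^ m \<le> (real b - 1) * (\<Sum>i<m. lam ^ i) * eta ^ m"
    using bounds by (simp add: mult_left_mono mult.assoc)
  also have "\<dots> = lam ^ m * eta ^ m" using lam(3) by simp
  finally have "(real b - 1) * (\<Sum>i<m. eta ^ i) \<le> eta ^ m" using bounds by (simp add: mult.commute)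
  with gt show False by simp
qed

lemma p_q: "0 < q" "q < p"
  using eta_less_lam bounds by (auto simp: p_def q_def divide_strict_right_mono)

lemma growth_const_ge: "growth_const \<ge> real b ^ m" "growth_const \<ge> 2 ^ (m - 1)" "growth_const \<ge> 1"
proof -
  have "real m < 2 ^ m" by (rule of_nat_less_two_power)
  also have "\<dots> \<le> eta ^ m" using bounds by (intro power_mono) auto
  finally have "real (m - 1) / eta ^ m < 1" using bounds m_ge2 by (auto simp: of_nat_diff)
  then have "0 < 1 - real (m - 1) / eta ^ m" "1 - real (m - 1) / eta ^ m \<le> 1" using bounds by auto
  then show 1: "growth_const \<ge> real b ^ m" by (simp add: growth_const_def pos_le_divide_eq mult_left_le)
  have "(2::real) ^ (m - 1) \<le> 2 ^ m" by (rule power_increasing) auto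
  also have "\<dots> \<le> real b ^ m" using b_ge3 by (intro power_mono) auto
  finally show 2: "growth_const \<ge> 2 ^ (m - 1)" using 1 by linarith
  have "(1::real) \<le> 2 ^ (m - 1)" by simp
  with 2 show "growth_const \<ge> 1" by linarith
qed

section \<open>Growth over a single stretch\<close>

lemma f_add_ge_growth:
  assumes "x \<le> real (f (shift n \<omega>) j)"
  shows "real (f \<omega> n) * x \<le> growth_const * real (f \<omega> (n + j))"
proof -
  have "real (f \<omega> n) * x \<le> real (f \<omega> n) * real (f (shift n \<omega>) j)"
    using assms by (intro mult_left_mono) auto
  also have "\<dots> = 2 ^ (m - 1) * ((1 / 2) ^ (m - 1) * (real (f \<omega> n) * real (f (shift n \<omega>) j)))"
    by (simp add: power_divide)
  also have "\<dots> \<le> 2 ^ (m - 1) * real (f \<omega> (n + j))"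
    using f_add_ge[of \<omega> n j] by (intro mult_left_mono) auto
  also have "\<dots> \<le> growth_const * real (f \<omega> (n + j))"
    using growth_const_ge by (intro mult_right_mono) auto
  finally show ?thesis .
qed

lemma f_add_le_growth:
  assumes "real (f (shift n \<omega>) j) \<le> growth_const * x"
  shows "real (f \<omega> (n + j)) \<le> growth_const * (real (f \<omega> n) * x)"
proof -
  have "real (f \<omega> (n + j)) \<le> real (f \<omega> n) * real (f (shift n \<omega>) j)"
    using f_add_le[of \<omega> n j] by (simp flip: of_nat_mult)
  also have "\<dots> \<le> real (f \<omega> n) * (growth_const * x)" using assms by (intro mult_left_mono) auto
  finally show ?thesis by (simp add: mult_ac)
qed

lemma slow_growth: "real (f \<omega> n) * eta ^ j \<le> growth_const * real (f \<omega> (n + j))"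
  using bounds eta by (intro f_add_ge_growth f_ge_eta_power) auto

lemma fast_growth:
  assumes "\<omega> \<in> word_seqs b m"
  shows "real (f \<omega> (n + j)) \<le> growth_const * (real (f \<omega> n) * lam ^ j)"
proof (rule f_add_le_growth)
  have "real (f (shift n \<omega>) j) \<le> real b ^ m * lam ^ j"
    using bounds lam assms by (intro f_le_lambda_power) (auto simp: shift_def word_seqs_def)
  also have "\<dots> \<le> growth_const * lam ^ j" using growth_const_ge bounds by (intro mult_right_mono) auto
  finally show "real (f (shift n \<omega>) j) \<le> growth_const * lam ^ j" .
qed

text \<open>\<open>f (shift n \<omega>) j\<close> involves only words lying inside the stretch,
  which are all factors of \<open>a\<close>; those straddling position \<open>n\<close> are paid for
  by \<open>growth_const\<close>.\<close>

lemma fast_run_growth: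
  assumes a: "\<And>i. a i < b" and t: "\<And>i. n \<le> i \<Longrightarrow> i < n + j \<Longrightarrow> t i"
  shows "real (f (extremal_seq b m t a) n) * lam ^ j
    \<le> growth_const * real (f (extremal_seq b m t a) (n + j))"
proof (rule f_add_ge_growth, rule f_ge_lambda_power[of _ _ _ "shift n a"])
  fix k assume "k + m \<le> j"
  then have "t (k + n)" using m_ge2 by (intro t) auto
  then have "extremal_seq b m t a (k + n) = map a [k + n..<k + n + m]"
    using m_ge2 by (cases m) (auto simp: extremal_seq_def)
  then show "shift n (extremal_seq b m t a) k = map (shift n a) [k..<k + m]"
    using m_ge2 by (auto simp: shift_def add_ac intro!: nth_equalityI)
qed (use a bounds lam in \<open>auto simp: shift_def\<close>)

lemma slow_run_growth:
  assumes a: "\<And>i. a i < b" and t: "\<And>i. n \<le> i \<Longrightarrow> i < n + j \<Longrightarrow> \<not> t i"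
  shows "real (f (extremal_seq b m t a) (n + j))
    \<le> growth_const * (real (f (extremal_seq b m t a) n) * eta ^ j)"
proof (rule f_add_le_growth, unfold growth_const_def,
    rule f_le_eta_power[of _ _ _ "shift n a" "shift n (\<lambda>i. (a i + 1) mod b)"])
  fix k assume "k + m \<le> j"
  then have "\<not> t (k + n)" using m_ge2 by (intro t) auto
  then show "shift n (extremal_seq b m t a) k
      = map (shift n a) [k..<k + m - 1] @ [shift n (\<lambda>i. (a i + 1) mod b) (k + m - 1)]"
    using m_ge2 by (auto simp: shift_def extremal_seq_def add_ac nth_append intro!: nth_equalityI)
next
  fix k
  show "shift n (\<lambda>i. (a i + 1) mod b) k \<noteq> shift n a k"
    using a[of "k + n"] b_ge3 by (auto simp: shift_def mod_if split: if_splits)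
qed (use a bounds eta b_ge3 in \<open>auto simp: shift_def\<close>)

theorem dimension_chain:
  assumes "\<omega> \<in> word_seqs b m"
  shows "ereal q \<le> lower_dim (K_set b m \<omega>)"
    and "lower_dim (K_set b m \<omega>) \<le> dim_H (K_set b m \<omega>)"
    and "dim_H (K_set b m \<omega>) \<le> packing_dim (K_set b m \<omega>)"
    and "packing_dim (K_set b m \<omega>) \<le> assouad_dim (K_set b m \<omega>)"
    and "assouad_dim (K_set b m \<omega>) \<le> ereal p"
proof -
  interpret T: digit_tree b "avoiding_tree \<omega>" "(1 / 2) ^ (m - 1)" by (rule digit_tree_avoiding_tree)
  show "lower_dim (K_set b m \<omega>) \<le> dim_H (K_set b m \<omega>)"
    "dim_H (K_set b m \<omega>) \<le> packing_dim (K_set b m \<omega>)"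
    "packing_dim (K_set b m \<omega>) \<le> assouad_dim (K_set b m \<omega>)"
    unfolding K_set_eq_tree_set
    by (rule T.lower_dim_le_hausdorff_dim T.hausdorff_dim_le_packing_dim T.packing_dim_le_assouad_dim)+
  show "ereal q \<le> lower_dim (K_set b m \<omega>)"
    unfolding K_set_eq_tree_set
  proof (rule T.lower_dim_tree_ge[of _ "1 / growth_const"])
    fix n j
    show "1 / growth_const * real b powr (q * real j) * real (card (level (avoiding_tree \<omega>) n))
        \<le> real (card (level (avoiding_tree \<omega>) (n + j)))"
      using slow_growth[of \<omega> n j] growth_const_ge(3)
      unfolding powr_q level_avoiding_tree by (simp add: pos_divide_le_eq mult_ac)
  qed (use p_q growth_const_ge(3) in auto)
  show "assouad_dim (K_set b m \<omega>) \<le> ereal p"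
    unfolding K_set_eq_tree_set
  proof (rule T.assouad_dim_tree_le[of _ growth_const])
    fix n j
    show "real (card (level (avoiding_tree \<omega>) (n + j)))
        \<le> growth_const * real b powr (p * real j) * real (card (level (avoiding_tree \<omega>) n))"
      using fast_growth[OF assms, of n j] unfolding powr_p level_avoiding_tree by (simp add: mult_ac)
  qed (use p_q in auto)
qed

section \<open>Oscillating sequences and their dimensions\<close>

lemma log_growth:
  assumes "x > 0" "y > 0" "z > 0"
  shows "x * z ^ j \<le> growth_const * y \<Longrightarrow>
      log b x + ln z / ln (real b) * real j - log b growth_const \<le> log b y"
    and "y \<le> growth_const * (x * z ^ j) \<Longrightarrow>
      log b y \<le> log b x + ln z / ln (real b) * real j + log b growth_const"
proof -
  have c: "growth_const > 0" using growth_const_ge(3) by linarith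
  have e: "log b (x * z ^ j) = log b x + ln z / ln (real b) * real j"
    using assms bounds by (simp add: log_mult log_nat_power) (simp add: log_def)
  have l: "log b (growth_const * y) = log b growth_const + log b y"
    "log b (growth_const * (x * z ^ j)) = log b growth_const + log b (x * z ^ j)"
    using c assms bounds by (simp_all add: log_mult)
  {
    assume "x * z ^ j \<le> growth_const * y"
    then have "log b (x * z ^ j) \<le> log b (growth_const * y)" using assms bounds c by simp
    then show "log b x + ln z / ln (real b) * real j - log b growth_const \<le> log b y"
      using e l by simp
  next
    assume "y \<le> growth_const * (x * z ^ j)"
    then have "log b y \<le> log b (growth_const * (x * z ^ j))" using assms bounds c by simp
    then show "log b y \<le> log b x + ln z / ln (real b) * real j + log b growth_const"
      using e l by simp
  }
qed

abbreviation osc_type :: "real \<Rightarrow> real \<Rightarrow> nat \<Rightarrow> bool" where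
  "osc_type \<alpha> \<beta> \<equiv> block_type q p (oscillate \<alpha> \<beta>)"

definition osc_seq :: "real \<Rightarrow> real \<Rightarrow> (nat \<Rightarrow> nat) \<Rightarrow> nat \<Rightarrow> nat list" where
  "osc_seq \<alpha> \<beta> a = extremal_seq b m (osc_type \<alpha> \<beta>) a"

lemma osc_seq_growth:
  assumes \<alpha>: "q \<le> \<alpha>" "\<alpha> \<le> \<beta>" "\<beta> \<le> p" and a: "\<And>i. a i < b" and "\<epsilon> > 0"
  shows "\<exists>H. (\<forall>n. f (osc_seq \<alpha> \<beta> a) n \<ge> real b powr - H * real b powr ((\<alpha> - \<epsilon>) * n))
     \<and> (\<forall>n. f (osc_seq \<alpha> \<beta> a) n \<le> real b powr H * real b powr ((\<beta> + \<epsilon>) * n))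
     \<and> (\<forall>N. \<exists>n\<ge>N. f (osc_seq \<alpha> \<beta> a) n \<le> real b powr H * real b powr ((\<alpha> + \<epsilon>) * n))
     \<and> (\<forall>N. \<exists>n\<ge>N. f (osc_seq \<alpha> \<beta> a) n \<ge> real b powr - H * real b powr ((\<beta> - \<epsilon>) * n))"
proof -
  let ?\<omega> = "osc_seq \<alpha> \<beta> a"
  define L where "L n = log b (f ?\<omega> n)" for n
  have pos: "real (f ?\<omega> n) > 0" for n using f_pos[of ?\<omega> n] by linarith
  have in_seqs: "?\<omega> \<in> word_seqs b m" unfolding osc_seq_def by (rule extremal_seq_in[OF a])
  have bL: "real (f ?\<omega> n) = real b powr L n" for n using pos[of n] bounds by (simp add: L_def)
  have "\<exists>H. (\<forall>n. L n \<ge> (\<alpha> - \<epsilon>) * n - H) \<and> (\<forall>n. L n \<le> (\<beta> + \<epsilon>) * n + H)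
     \<and> (\<forall>N. \<exists>n\<ge>N. L n \<le> (\<alpha> + \<epsilon>) * n + H) \<and> (\<forall>N. \<exists>n\<ge>N. L n \<ge> (\<beta> - \<epsilon>) * n - H)"
  proof (rule oscillating_growth[of q p "log b growth_const"])
    show "q < p" "0 \<le> q" using p_q by auto
    show "0 \<le> log b growth_const" using bounds growth_const_ge(3) by (intro zero_le_log_cancel_iff[THEN iffD2]) auto
    show "L 0 = 0" using f_short[of 0 ?\<omega>] m_ge2 by (simp add: L_def)
    fix n j
    show "L (n + j) \<ge> L n + q * j - log b growth_const"
      unfolding L_def q_def using slow_growth bounds by (intro log_growth(1) pos) auto
    show "L (n + j) \<le> L n + p * j + log b growth_const"
      unfolding L_def p_def using fast_growth[OF in_seqs] bounds by (intro log_growth(2) pos) auto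
  next
    fix n j
    assume run: "\<And>i. n \<le> i \<Longrightarrow> i < n + j \<Longrightarrow> osc_type \<alpha> \<beta> i"
    show "L (n + j) \<ge> L n + p * j - log b growth_const"
      using log_growth(1)[OF pos pos _ fast_run_growth[where a = a and n = n and j = j
          and t = "osc_type \<alpha> \<beta>", OF a run, folded osc_seq_def]] bounds
      unfolding L_def p_def by simp
  next
    fix n j
    assume run: "\<And>i. n \<le> i \<Longrightarrow> i < n + j \<Longrightarrow> \<not> osc_type \<alpha> \<beta> i"
    show "L (n + j) \<le> L n + q * j + log b growth_const"
      using log_growth(2)[OF pos pos _ slow_run_growth[where a = a and n = n and j = j
          and t = "osc_type \<alpha> \<beta>", OF a run, folded osc_seq_def]] bounds
      unfolding L_def q_def by simp
  qed (use assms in auto)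
  then obtain H where H: "\<And>n. L n \<ge> (\<alpha> - \<epsilon>) * n - H" "\<And>n. L n \<le> (\<beta> + \<epsilon>) * n + H"
    "\<And>N. \<exists>n\<ge>N. L n \<le> (\<alpha> + \<epsilon>) * n + H" "\<And>N. \<exists>n\<ge>N. L n \<ge> (\<beta> - \<epsilon>) * n - H" by blast
  have le: "real (f ?\<omega> n) \<le> real b powr H * real b powr (x * n) \<longleftrightarrow> L n \<le> x * n + H" for x n
    unfolding bL using bounds by (simp add: powr_add[symmetric] add.commute)
  have ge: "real (f ?\<omega> n) \<ge> real b powr - H * real b powr (x * n) \<longleftrightarrow> L n \<ge> x * n - H" for x n
    unfolding bL using bounds by (simp add: powr_add[symmetric])
  show ?thesis by (rule exI[of _ H], unfold le ge) (use H in blast)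
qed

lemma osc_seq_dims:
  assumes \<alpha>: "q \<le> \<alpha>" "\<alpha> \<le> \<beta>" "\<beta> \<le> p" and a: "\<And>i. a i < b"
  shows "dim_H (K_set b m (osc_seq \<alpha> \<beta> a)) = ereal \<alpha>"
    and "packing_dim (K_set b m (osc_seq \<alpha> \<beta> a)) = ereal \<beta>"
proof -
  let ?\<omega> = "osc_seq \<alpha> \<beta> a"
  interpret T: digit_tree b "avoiding_tree ?\<omega>" "(1 / 2) ^ (m - 1)" by (rule digit_tree_avoiding_tree)
  have pos: "real b powr H > 0" for H using bounds by simp
  have dims: "ereal (\<alpha> - \<epsilon>) \<le> dim_H (K_set b m ?\<omega>)
      \<and> dim_H (K_set b m ?\<omega>) \<le> ereal (\<alpha> + \<epsilon>)
      \<and> ereal (\<beta> - \<epsilon>) \<le> packing_dim (K_set b m ?\<omega>)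
      \<and> packing_dim (K_set b m ?\<omega>) \<le> ereal (\<beta> + \<epsilon>)" if \<epsilon>: "\<epsilon> > 0" for \<epsilon>
  proof -
    obtain H where H: "\<And>n. f ?\<omega> n \<ge> real b powr - H * real b powr ((\<alpha> - \<epsilon>) * n)"
     "\<And>n. f ?\<omega> n \<le> real b powr H * real b powr ((\<beta> + \<epsilon>) * n)"
     "\<And>N. \<exists>n\<ge>N. f ?\<omega> n \<le> real b powr H * real b powr ((\<alpha> + \<epsilon>) * n)"
     "\<And>N. \<exists>n\<ge>N. f ?\<omega> n \<ge> real b powr - H * real b powr ((\<beta> - \<epsilon>) * n)"
      using osc_seq_growth[of \<alpha> \<beta> a, OF \<alpha> a \<epsilon>] by blast
    have nonneg: "0 \<le> \<alpha> + \<epsilon>" "0 \<le> \<beta> + \<epsilon>" using p_q \<alpha> \<epsilon> by linarith+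
    show ?thesis
      unfolding K_set_eq_tree_set
      using T.hausdorff_dim_tree_ge[OF pos, unfolded level_avoiding_tree, OF H(1)]
        T.hausdorff_dim_tree_le[OF nonneg(1), unfolded level_avoiding_tree, OF H(3)]
        T.packing_dim_tree_ge[OF pos, unfolded level_avoiding_tree, OF H(4)]
        T.packing_dim_tree_le[OF nonneg(2), unfolded level_avoiding_tree, OF H(2)]
      by blast
  qed
  have squeeze: "x = ereal y" if "\<And>\<epsilon>. \<epsilon> > 0 \<Longrightarrow> ereal (y - \<epsilon>) \<le> x \<and> x \<le> ereal (y + \<epsilon>)" for x y
  proof (rule antisym)
    show "x \<le> ereal y" by (rule ereal_le_epsilon2) (use that in auto)
    show "ereal y \<le> x"
    proof (rule ereal_le_epsilon2)
      fix e :: real assume "0 < e"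
      then have "ereal (y - e) + ereal e \<le> x + ereal e" using that by (intro add_right_mono) auto
      then show "ereal y \<le> x + ereal e" by simp
    qed
  qed
  show "dim_H (K_set b m ?\<omega>) = ereal \<alpha>"
    "packing_dim (K_set b m ?\<omega>) = ereal \<beta>"
    by (rule squeeze; use dims in blast)+
qed

lemma unbounded_of_linear:
  fixes x :: real
  assumes "x > 0" "\<And>k. real (g k) \<ge> x * (2 * real k + 1) - 1"
  shows "\<exists>k\<ge>n0. g k \<ge> N"
proof -
  obtain k :: nat where k: "real k > (real N + 1) / x" using reals_Archimedean2 by blast
  define k' where "k' = max k n0"
  have "real N + 1 < x * real k" using k assms(1) by (simp add: pos_divide_less_eq mult.commute)
  also have "\<dots> \<le> x * (2 * real k' + 1)" using assms(1) by (intro mult_left_mono) (auto simp: k'_def)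
  finally have "real N \<le> real (g k')" using assms(2)[of k'] by linarith
  then show ?thesis by (intro exI[of _ k']) (auto simp: k'_def)
qed

text \<open>With \<alpha> above \<open>q\<close> and \<beta> below \<open>p\<close>, every block
  gives a fixed share to each kind of run, up to rounding, so pure runs of both kinds become
  arbitrarily long and occur arbitrarily far out. There the growth is exactly of rate
  \<open>q\<close> or \<open>p\<close> up to a constant, which contradicts a uniform exponent above
  \<open>q\<close> or below \<open>p\<close>.\<close>

lemma osc_seq_extreme_dims:
  assumes \<alpha>: "q < \<alpha>" "\<alpha> \<le> \<beta>" "\<beta> < p" and a: "\<And>i. a i < b"
  shows "lower_dim (K_set b m (osc_seq \<alpha> \<beta> a)) \<le> ereal q"
    and "ereal p \<le> assouad_dim (K_set b m (osc_seq \<alpha> \<beta> a))"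
proof -
  let ?\<omega> = "osc_seq \<alpha> \<beta> a"
  interpret T: digit_tree b "avoiding_tree ?\<omega>" "(1 / 2) ^ (m - 1)" by (rule digit_tree_avoiding_tree)
  define c where "c k = block_len q p (oscillate \<alpha> \<beta>) k" for k
  have osc: "q \<le> oscillate \<alpha> \<beta> k" "oscillate \<alpha> \<beta> k \<le> p" "\<alpha> \<le> oscillate \<alpha> \<beta> k" "oscillate \<alpha> \<beta> k \<le> \<beta>" for k
    using \<alpha> by (auto simp: oscillate_def)
  note len = block_len_bounds[of q p "oscillate \<alpha> \<beta>", OF p_q(2) osc(1,2), folded c_def]
  have pos: "real (f ?\<omega> n) > 0" for n using f_pos[of ?\<omega> n] by linarith
  show "lower_dim (K_set b m ?\<omega>) \<le> ereal q"
  proof (rule ccontr)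
    assume "\<not> ?thesis"
    then have "ereal q < lower_dim T.tree_set" by (simp add: K_set_eq_tree_set)
    then obtain s K n0 where s: "q < s" "K > 0"
      "\<And>n j. n \<ge> n0 \<Longrightarrow> f ?\<omega> (n + j) \<ge> K * real b powr (s * real j) * f ?\<omega> n"
      using T.lower_admissible_growth[unfolded level_avoiding_tree] by blast
    obtain N where N: "\<And>j. j \<ge> N \<Longrightarrow> growth_const * real b powr (- (s - q) * real j) < K"
      using powr_decay[of "real b" "s - q" K growth_const] bounds s by auto
    have "real (2 * k + 1 - c k) \<ge> (p - \<beta>) / (p - q) * (2 * real k + 1) - 1" for k
    proof -
      have "(p - q) * c k \<le> (\<beta> - q) * (2 * real k + 1)"
        using len(2)[of k] osc(4)[of k] by (elim order_trans) (intro mult_right_mono, auto)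
      then have "real (c k) \<le> (\<beta> - q) / (p - q) * (2 * real k + 1)"
        using p_q by (simp add: pos_le_divide_eq mult.commute)
      moreover have "(p - \<beta>) / (p - q) * (2 * real k + 1)
          = 2 * real k + 1 - (\<beta> - q) / (p - q) * (2 * real k + 1)"
      proof -
        have "(p - \<beta>) / (p - q) = 1 - (\<beta> - q) / (p - q)" using p_q by (simp add: field_simps)
        then show ?thesis by (simp only: left_diff_distrib mult_1)
      qed
      moreover have "real (2 * k + 1 - c k) = 2 * real k + 1 - real (c k)"
        using len(1)[of k] by (simp add: of_nat_diff)
      ultimately show ?thesis by linarith
    qed
    then obtain k where k: "k \<ge> n0" "2 * k + 1 - c k \<ge> N"
      using unbounded_of_linear[of "(p - \<beta>) / (p - q)" "\<lambda>k. 2 * k + 1 - c k" n0 N] \<alpha> p_q by auto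
    define n where "n = k\<^sup>2 + c k"
    define j where "j = 2 * k + 1 - c k"
    have "n0 \<le> n" using k(1) by (simp add: n_def power2_eq_square) (metis le_square le_trans trans_le_add1)
    then have "K * real b powr (s * real j) * f ?\<omega> n \<le> f ?\<omega> (n + j)" by (rule s(3))
    also have "\<dots> \<le> growth_const * (f ?\<omega> n * eta ^ j)"
      unfolding osc_seq_def
    proof (rule slow_run_growth[OF a])
      fix i assume "n \<le> i" "i < n + j"
      then show "\<not> osc_type \<alpha> \<beta> i"
        using block_type_iff[of "i - k\<^sup>2" k q p "oscillate \<alpha> \<beta>"] len(1)[of k]
        by (simp add: n_def j_def c_def)
    qed
    finally have "K * real b powr (s * real j) \<le> growth_const * real b powr (q * real j)"
      unfolding powr_q using pos[of n] by (simp add: mult_ac)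
    then have "K * real b powr (s * real j) * real b powr (- s * real j)
        \<le> growth_const * real b powr (q * real j) * real b powr (- s * real j)"
      by (rule mult_right_mono) simp
    then have "K \<le> growth_const * real b powr (- (s - q) * real j)"
      using bounds by (simp add: mult.assoc powr_add[symmetric] algebra_simps)
    with N[of j] k(2) show False by (simp add: j_def)
  qed
  show "ereal p \<le> assouad_dim (K_set b m ?\<omega>)"
  proof (rule ccontr)
    assume "\<not> ?thesis"
    then have "assouad_dim T.tree_set < ereal p" by (simp add: K_set_eq_tree_set)
    then obtain s K n0 where s: "s < p" "K > 0"
      "\<And>n j. n \<ge> n0 \<Longrightarrow> f ?\<omega> (n + j) \<le> K * real b powr (s * real j) * f ?\<omega> n"
      using T.assouad_admissible_growth[unfolded level_avoiding_tree] by blast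
    have c0: "growth_const > 0" using growth_const_ge(3) by linarith
    obtain N where N: "\<And>j. j \<ge> N \<Longrightarrow> (growth_const * K) * real b powr (- (p - s) * real j) < 1"
      using powr_decay[of "real b" "p - s" 1 "growth_const * K"] bounds s by auto
    have "real (c k) \<ge> (\<alpha> - q) / (p - q) * (2 * real k + 1) - 1" for k
    proof -
      have "(\<alpha> - q) / (p - q) * (2 * real k + 1) \<le> (oscillate \<alpha> \<beta> k - q) / (p - q) * (2 * real k + 1)"
        using osc(3)[of k] p_q by (intro mult_right_mono divide_right_mono) auto
      then show ?thesis using len(4)[of k] by linarith
    qed
    then obtain k where k: "k \<ge> n0" "c k \<ge> N"
      using unbounded_of_linear[of "(\<alpha> - q) / (p - q)" c n0 N] \<alpha> p_q by auto
    define n where "n = k\<^sup>2"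
    define j where "j = c k"
    have "n0 \<le> n" using k(1) by (simp add: n_def power2_eq_square) (metis le_square le_trans)
    have "f ?\<omega> n * lam ^ j \<le> growth_const * f ?\<omega> (n + j)"
      unfolding osc_seq_def
    proof (rule fast_run_growth[OF a])
      fix i assume "n \<le> i" "i < n + j"
      then show "osc_type \<alpha> \<beta> i"
        using block_type_iff[of "i - k\<^sup>2" k q p "oscillate \<alpha> \<beta>"] len(1)[of k]
        by (simp add: n_def j_def c_def)
    qed
    also have "\<dots> \<le> growth_const * (K * real b powr (s * real j) * f ?\<omega> n)"
      using c0 s(3)[OF \<open>n0 \<le> n\<close>, of j] by (intro mult_left_mono) auto
    finally have "real b powr (p * real j) \<le> growth_const * K * real b powr (s * real j)"
      unfolding powr_p using pos[of n] by (simp add: mult_ac)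
    then have "real b powr (p * real j) * real b powr (- p * real j)
        \<le> growth_const * K * real b powr (s * real j) * real b powr (- p * real j)"
      by (rule mult_right_mono) simp
    then have "1 \<le> (growth_const * K) * real b powr (- (p - s) * real j)"
      using bounds by (simp add: mult.assoc powr_add[symmetric] algebra_simps)
    with N[of j] k(2) show False by (simp add: j_def)
  qed
qed

end

theorem theorem1p6:
  fixes b m :: nat and lam eta :: real
  assumes "b \<ge> 3" and "m \<ge> 2"
    and "pisot lam" and "real b - 1 < lam" and "lam < real b"
    and "lam ^ m - (real b - 1) * (\<Sum>i<m. lam ^ i) = 0"
    and "pisot eta" and "real b - 1 < eta" and "eta < real b"
    and "eta ^ m - real b * eta ^ (m - 1) + 1 = 0"
  shows
    "(\<forall>\<omega> \<in> word_seqs b m.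
        ereal (ln eta / ln (real b)) \<le> lower_dim (K_set b m \<omega>) \<and>
        lower_dim (K_set b m \<omega>) \<le> hausdorff_dim euclidean_metric (K_set b m \<omega>) \<and>
        hausdorff_dim euclidean_metric (K_set b m \<omega>) \<le> packing_dim (K_set b m \<omega>) \<and>
        packing_dim (K_set b m \<omega>) \<le> assouad_dim (K_set b m \<omega>) \<and>
        assouad_dim (K_set b m \<omega>) \<le> ereal (ln lam / ln (real b))) \<and>
     (\<forall>\<alpha> \<beta> :: real.
        ln eta / ln (real b) \<le> \<alpha> \<and> \<alpha> \<le> \<beta> \<and> \<beta> \<le> ln lam / ln (real b) \<longrightarrow>
        hausdorff_dim (word_seq_metric b m)
          {\<omega> \<in> word_seqs b m. hausdorff_dim euclidean_metric (K_set b m \<omega>) = ereal \<alpha> \<and>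
                               packing_dim (K_set b m \<omega>) = ereal \<beta>}
        \<ge> ereal (1 / real m)) \<and>
     hausdorff_dim (word_seq_metric b m)
       {\<omega> \<in> word_seqs b m.
          lower_dim (K_set b m \<omega>) < hausdorff_dim euclidean_metric (K_set b m \<omega>) \<and>
          hausdorff_dim euclidean_metric (K_set b m \<omega>) < packing_dim (K_set b m \<omega>) \<and>
          packing_dim (K_set b m \<omega>) < assouad_dim (K_set b m \<omega>)}
     \<ge> ereal (1 / real m)"
proof -
  interpret extremal_growth b m lam eta
    using assms by unfold_locales auto
  let ?H = "\<lambda>\<omega>. dim_H (K_set b m \<omega>)"
  have ii: "ereal (1 / real m) \<le> hausdorff_dim (word_seq_metric b m)
      {\<omega> \<in> word_seqs b m. ?H \<omega> = ereal \<alpha> \<and> packing_dim (K_set b m \<omega>) = ereal \<beta>}" (is "_ \<le> hausdorff_dim _ ?A")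
    if "q \<le> \<alpha>" "\<alpha> \<le> \<beta>" "\<beta> \<le> p" for \<alpha> \<beta>
  proof (rule hausdorff_dim_extremal_seqs)
    fix a :: "nat \<Rightarrow> nat" assume a: "\<And>i. a i < b"
    show "extremal_seq b m (osc_type \<alpha> \<beta>) a \<in> ?A"
      using extremal_seq_in[OF a] osc_seq_dims[OF that a] by (simp add: osc_seq_def)
  qed
  \<comment> \<open>Values strictly inside the interval from \<open>q\<close> to \<open>p\<close>
    separate all four dimensions; these trisect it.\<close>
  define \<alpha> where "\<alpha> = (2 * q + p) / 3"
  define \<beta> where "\<beta> = (q + 2 * p) / 3"
  have ab: "q < \<alpha>" "\<alpha> < \<beta>" "\<beta> < p" using p_q by (auto simp: \<alpha>_def \<beta>_def)
  have iii: "ereal (1 / real m) \<le> hausdorff_dim (word_seq_metric b m)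
      {\<omega> \<in> word_seqs b m. lower_dim (K_set b m \<omega>) < ?H \<omega> \<and> ?H \<omega> < packing_dim (K_set b m \<omega>) \<and>
        packing_dim (K_set b m \<omega>) < assouad_dim (K_set b m \<omega>)}" (is "_ \<le> hausdorff_dim _ ?A")
  proof (rule hausdorff_dim_extremal_seqs)
    fix a :: "nat \<Rightarrow> nat" assume a: "\<And>i. a i < b"
    let ?K = "K_set b m (osc_seq \<alpha> \<beta> a)"
    have H: "dim_H ?K = ereal \<alpha>" and P: "packing_dim ?K = ereal \<beta>"
      using osc_seq_dims[of \<alpha> \<beta> a] ab a by auto
    have "lower_dim ?K \<le> ereal q" "ereal p \<le> assouad_dim ?K"
      using osc_seq_extreme_dims[of \<alpha> \<beta> a] ab a by auto
    moreover have "ereal q < ereal \<alpha>" "ereal \<alpha> < ereal \<beta>" "ereal \<beta> < ereal p" using ab by auto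
    ultimately have "lower_dim ?K < dim_H ?K"
      "dim_H ?K < packing_dim ?K" "packing_dim ?K < assouad_dim ?K"
      unfolding H P by (auto intro: le_less_trans less_le_trans[of _ "ereal p"])
    then show "extremal_seq b m (osc_type \<alpha> \<beta>) a \<in> ?A"
      using extremal_seq_in[OF a] by (simp add: osc_seq_def)
  qed
  show ?thesis
    unfolding p_def[symmetric] q_def[symmetric] using dimension_chain ii iii by blast
qed

end
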